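(* Let $A$ be a multiset configuration with ground set $C$ such that $X_A$ is self-dual. Then there exist a generalized Lawrence matrix $C'=\mathrm{GLM}(\varepsilon_1,\mathbf a'_1,\ldots,\mathbf a'_s\mid\mathbf c'_0,\mathbf c'_1,\ldots,\mathbf c'_s)$ and a multiset configuration $A'$ with ground set the set of columns of $C'$, such that $X_A=X_{A'}$ after a possible renumeration of the columns, where $k=|A|-|C|$ (with $|A|$ counted with multiplicity), $\mathbf c'_0\in\mathbb Z^k$, $c'_{01}=1$, $\mathbf a'_i=(0,*,\ldots,* )\in\mathbb Z^d$ (that is, each $\mathbf a'_i$ has first component $0$), $\mathbf a'_1,\ldots,\mathbf a'_s$ is a non-pyramidal configuration, and $\sum_j c'_{ij}=0$ for all $i=1,\ldots,s$. Here $\varepsilon_1=(1,0,\ldots,0)\in\mathbb Z^d$.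
   Context: A configuration is a finite list of vectors in some $\mathbb Z^m$, identified with the integer matrix having these columns. A multiset configuration $A$ with ground set a finite set $C$ of vectors is a multiset in which each element of $C$ occurs at least once and nothing else occurs; it is identified with the matrix whose columns are its elements, listed with multiplicity. Non-pyramidal: for a configuration $\mathbf a_1,\dots,\mathbf a_n$ forming the columns of a matrix $A$, the vector $\mathbf a_i$ is called free if every $\mathbf u\in\ker_{\mathbb Z}(A)$ has $u_i=0$. The configuration is non-pyramidal if it has no free vectors. Generalized Lawrence matrices: let $\mathbf b_0,\ldots,\mathbf b_s\in\mathbb Z^d$ be a configuration and let $\mathbf c'_i=(c'_{i1},\ldots,c'_{im_i})\in\mathbb Z^{m_i}$, $m_i\ge 1$ ($i=0,\ldots,s$), be primitive vectors (gcd of the components is $1$), each having full support (all components nonzero) and positive first component. Let $C_i\in\mathbb Z^{(m_i-1)\times m_i}$ be the matrix whose $r$-th row ($1\le r\le m_i-1$) has first entry $-c'_{i,r+1}$, $(r+1)$-st entry $c'_{i1}$, and all other entries $0$. Choose integers $\lambda_{i1},\ldots,\lambda_{im_i}$ with $\lambda_{i1}c'_{i1}+\cdots+\lambda_{im_i}c'_{im_i}=1$ and put $A_i=[\lambda_{i1}\mathbf b_i,\ldots,\lambda_{im_i}\mathbf b_i]\in\mathbb Z^{d\times m_i}$. Then $\mathrm{GLM}(\mathbf b_0,\ldots,\mathbf b_s\mid\mathbf c'_0,\ldots,\mathbf c'_s)$ is the block matrix with first block row $(A_0\ A_1\ \cdots\ A_s)$ and, below it, the block diagonal matrix $\mathrm{diag}(C_0,\ldots,C_s)$;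 it has $m_0+\cdots+m_s$ columns and $d+\sum_i(m_i-1)$ rows. Different choices of the $\lambda_{ij}$ give matrices with the same kernel. (In the claim $\mathbf b_0=\varepsilon_1$, $\mathbf b_i=\mathbf a'_i$ for $i\ge1$, and $m_0=k$.) Toric varieties: $K$ is an algebraically closed field of characteristic zero. For an integer matrix $A$ with $N$ columns, $I_A\subset K[x_1,\ldots,x_N]$ is the toric ideal generated by all binomials $x^{\mathbf u^+}-x^{\mathbf u^-}$, $\mathbf u\in\ker_{\mathbb Z}(A)$, where $\mathbf u=\mathbf u^+-\mathbf u^-$ with $\mathbf u^+,\mathbf u^-\in\mathbb N^N$ of disjoint support. Standing assumption: $(1,\ldots,1)$ lies in the row span of $A$; then $I_A$ is homogeneous and $X_A=V(I_A)\subset\mathbb P_K^{N-1}$ is a projective toric variety. The dual variety $X_A^*$ is the closure, in the dual projective space, of the set of hyperplanes that intersect the regular points of $X_A$ non-transversally. $X_A$ is self-dual if it is isomorphic to $X_A^*$ as embedded projective varieties. "After a possible renumeration of the columns" means after permuting the columns (equivalently, the coordinates of the projective space).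
   Formalization: When k=0 (A has no repeated vectors) no c'_0 in Z^0 with c'_01=1 exists; in that case the block of ε_1 and c'_0 is left out, so C'=GLM(a'_1,…,a'_s | c'_1,…,c'_s), and c'_01=1 is claimed only for k≥1. *)

theory Defs
  imports
    "HOL-Library.Poly_Mapping"
    "HOL-Library.Extended_Nat"
    "HOL-Combinatorics.List_Permutation"
    "HOL-Computational_Algebra.Polynomial"
    "HOL-Algebra.Ideal"
    "Jordan_Normal_Form.Matrix_Kernel"
begin

section \<open>Configurations\<close>

text \<open>
  All indices are 0-based: the coordinates of \<^term>\<open>v :: 'a vec\<close> are
  \<open>v $ 0, \<dots>, v $ (dim_vec v - 1)\<close>. The kernel \<open>ker\<^sub>\<int>(A)\<close> of an integer matrix is
  \<^term>\<open>mat_kernel (A :: int mat)\<close>.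
\<close>

definition multiset_configuration :: "nat \<Rightarrow> int vec multiset \<Rightarrow> int vec set \<Rightarrow> bool" where
  "multiset_configuration m A C \<longleftrightarrow> finite C \<and> C \<subseteq> carrier_vec m \<and> set_mset A = C"

definition free_column :: "int mat \<Rightarrow> nat \<Rightarrow> bool" where
  "free_column A i \<longleftrightarrow> i < dim_col A \<and> (\<forall>u \<in> mat_kernel A. u $ i = 0)"

definition non_pyramidal :: "int mat \<Rightarrow> bool" where
  "non_pyramidal A \<longleftrightarrow> \<not> (\<exists>i. free_column A i)"

text \<open>The row span is taken over \<open>\<rat>\<close>.\<close>

definition ones_in_row_span :: "int mat \<Rightarrow> bool" where
  "ones_in_row_span A \<longleftrightarrow>
     vec (dim_col A) (\<lambda>_. 1) \<in> vec_space.row_space (dim_col A) (map_mat rat_of_int A)"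


section \<open>Generalized Lawrence matrices\<close>

definition primitive_vec :: "int vec \<Rightarrow> bool" where
  "primitive_vec c \<longleftrightarrow> Gcd (vec_set c) = 1"

definition full_support :: "int vec \<Rightarrow> bool" where
  "full_support c \<longleftrightarrow> (\<forall>j < dim_vec c. c $ j \<noteq> 0)"

definition glm_C :: "int vec \<Rightarrow> int mat" where
  "glm_C c = mat (dim_vec c - 1) (dim_vec c)
     (\<lambda>(r, j). if j = 0 then - (c $ (r + 1)) else if j = r + 1 then c $ 0 else 0)"

definition glm_A_cols :: "int vec \<Rightarrow> int vec \<Rightarrow> int vec list" where
  "glm_A_cols b l = map (\<lambda>j. (l $ j) \<cdot>\<^sub>v b) [0..<dim_vec l]"

definition glm :: "nat \<Rightarrow> int vec list \<Rightarrow> int vec list \<Rightarrow> int vec list \<Rightarrow> int mat" where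
  "glm d bs cs ls =
     mat_of_cols d (concat (map2 glm_A_cols bs ls)) @\<^sub>r diag_block_mat (map glm_C cs)"

text \<open>
  \<open>is_GLM d bs cs M\<close>: the matrix \<open>M\<close> is \<open>GLM(bs | cs)\<close> with \<open>bs\<close> in \<open>\<int>\<^sup>d\<close>, for some admissible
  choice \<open>ls\<close> of the integers \<open>\<lambda>\<^sub>i\<^sub>j\<close>. Every block has at least one column; a block with
  \<open>c'\<^sub>0 \<in> \<int>\<^sup>0\<close> is expressed by leaving it out of both lists.
\<close>

definition is_GLM :: "nat \<Rightarrow> int vec list \<Rightarrow> int vec list \<Rightarrow> int mat \<Rightarrow> bool" where
  "is_GLM d bs cs M \<longleftrightarrow>
     length bs = length cs \<and> set bs \<subseteq> carrier_vec d \<and>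
     (\<forall>c \<in> set cs. 1 \<le> dim_vec c \<and> primitive_vec c \<and> full_support c \<and> 0 < c $ 0) \<and>
     (\<exists>ls. length ls = length cs \<and>
        (\<forall>i < length cs. dim_vec (ls ! i) = dim_vec (cs ! i) \<and>
           (\<Sum>j < dim_vec (cs ! i). ls ! i $ j * cs ! i $ j) = 1) \<and>
        M = glm d bs cs ls)"


section \<open>Polynomials in \<open>N\<close> variables\<close>

text \<open>
  A polynomial is a finitely supported map from exponents to coefficients;
  \<open>K[x\<^sub>1, \<dots>, x\<^sub>N]\<close> consists of the polynomials in which only variables of index \<open>< N\<close> occur.
\<close>

type_synonym 'k mpoly = "(nat \<Rightarrow>\<^sub>0 nat) \<Rightarrow>\<^sub>0 'k"

definition mpoly_ring :: "nat \<Rightarrow> ('k :: field) mpoly ring" where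
  "mpoly_ring N = \<lparr> carrier = {f. \<forall>e \<in> Poly_Mapping.keys f. Poly_Mapping.keys e \<subseteq> {..<N}},
                    mult = (*), one = 1, zero = 0, add = (+) \<rparr>"

definition mpoly_eval :: "('k :: field) mpoly \<Rightarrow> 'k vec \<Rightarrow> 'k" where
  "mpoly_eval f v = (\<Sum>e \<in> Poly_Mapping.keys f.
     Poly_Mapping.lookup f e * (\<Prod>i \<in> Poly_Mapping.keys e. v $ i ^ Poly_Mapping.lookup e i))"

definition mpoly_pderiv :: "nat \<Rightarrow> ('k :: field) mpoly \<Rightarrow> 'k mpoly" where
  "mpoly_pderiv i f =
     (\<Sum>e \<in> Poly_Mapping.keys f. Poly_Mapping.single (e - Poly_Mapping.single i 1)
        (of_nat (Poly_Mapping.lookup e i) * Poly_Mapping.lookup f e))"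

definition homogeneous_mpoly :: "('k :: field) mpoly \<Rightarrow> bool" where
  "homogeneous_mpoly f \<longleftrightarrow> (\<exists>D. \<forall>e \<in> Poly_Mapping.keys f.
     (\<Sum>i \<in> Poly_Mapping.keys e. Poly_Mapping.lookup e i) = D)"


section \<open>Projective varieties\<close>

text \<open>
  A subset of \<open>\<P>\<^sup>N\<^sup>-\<^sup>1\<close> is represented by the set of all homogeneous coordinate vectors (nonzero
  vectors in \<open>K\<^sup>N\<close>) of its points. Hyperplanes are points of the dual projective space:
  \<open>h\<close> stands for the hyperplane \<open>h\<^sub>1 x\<^sub>1 + \<dots> + h\<^sub>N x\<^sub>N = 0\<close>. Linear subspaces of \<open>\<P>\<^sup>N\<^sup>-\<^sup>1\<close>,
  in particular embedded tangent spaces, are given by linear subspaces of \<open>K\<^sup>N\<close> (with \<open>0\<close>).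
\<close>

definition proj_zeros :: "nat \<Rightarrow> ('k :: field) mpoly set \<Rightarrow> 'k vec set" where
  "proj_zeros N F = {v \<in> carrier_vec N. v \<noteq> 0\<^sub>v N \<and> (\<forall>f \<in> F. mpoly_eval f v = 0)}"

definition homogeneous_vanishing :: "nat \<Rightarrow> ('k :: field) vec set \<Rightarrow> 'k mpoly set" where
  "homogeneous_vanishing N X =
     {f \<in> carrier (mpoly_ring N). homogeneous_mpoly f \<and> (\<forall>x \<in> X. mpoly_eval f x = 0)}"

definition proj_closure :: "nat \<Rightarrow> ('k :: field) vec set \<Rightarrow> 'k vec set" where
  "proj_closure N X = proj_zeros N (homogeneous_vanishing N X)"

definition proj_closed :: "nat \<Rightarrow> ('k :: field) vec set \<Rightarrow> bool" where
  "proj_closed N X \<longleftrightarrow>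
     (\<exists>F \<subseteq> {f \<in> carrier (mpoly_ring N). homogeneous_mpoly f}. X = proj_zeros N F)"

definition proj_irreducible :: "nat \<Rightarrow> ('k :: field) vec set \<Rightarrow> bool" where
  "proj_irreducible N X \<longleftrightarrow>
     X \<noteq> {} \<and>
     (\<forall>Y Z. proj_closed N Y \<longrightarrow> proj_closed N Z \<longrightarrow> X \<subseteq> Y \<union> Z \<longrightarrow> X \<subseteq> Y \<or> X \<subseteq> Z)"

text \<open>Dimension of a closed set: supremum of the lengths of chains of irreducible closed subsets.\<close>

definition proj_dim :: "nat \<Rightarrow> ('k :: field) vec set \<Rightarrow> enat" where
  "proj_dim N X = Sup {enat n | n. \<exists>Z :: nat \<Rightarrow> 'k vec set.
     (\<forall>i \<le> n. proj_closed N (Z i) \<and> proj_irreducible N (Z i) \<and> Z i \<subseteq> X) \<and>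
     (\<forall>i < n. Z i \<subset> Z (i + 1))}"

text \<open>The homogeneous polynomials vanishing on \<open>X\<close> generate the vanishing ideal of \<open>X\<close>.\<close>

definition tangent_space :: "nat \<Rightarrow> ('k :: field) vec set \<Rightarrow> 'k vec \<Rightarrow> 'k vec set" where
  "tangent_space N X p = {v \<in> carrier_vec N.
     \<forall>f \<in> homogeneous_vanishing N X. (\<Sum>i < N. mpoly_eval (mpoly_pderiv i f) p * v $ i) = 0}"

text \<open>
  For irreducible \<open>X\<close>, whose local dimension is the same at all points. The summand 1 accounts
  for the passage from the projective tangent space to the linear space representing it.
\<close>

definition regular_point :: "nat \<Rightarrow> ('k :: field) vec set \<Rightarrow> 'k vec \<Rightarrow> bool" where
  "regular_point N X p \<longleftrightarrow> p \<in> X \<and>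
     enat (vectorspace.dim class_ring (module_vec TYPE('k) N\<lparr>carrier := tangent_space N X p\<rparr>))
       = proj_dim N X + 1"

definition hyperplane :: "nat \<Rightarrow> ('k :: field) vec \<Rightarrow> 'k vec set" where
  "hyperplane N h = {v \<in> carrier_vec N. (\<Sum>i < N. h $ i * v $ i) = 0}"

definition meets_non_transversally ::
    "nat \<Rightarrow> ('k :: field) vec set \<Rightarrow> 'k vec \<Rightarrow> 'k vec \<Rightarrow> bool" where
  "meets_non_transversally N X h p \<longleftrightarrow> p \<in> hyperplane N h \<and>
     {v + w | v w. v \<in> tangent_space N X p \<and> w \<in> hyperplane N h} \<noteq> carrier_vec N"

definition dual_variety :: "nat \<Rightarrow> ('k :: field) vec set \<Rightarrow> 'k vec set" where
  "dual_variety N X = proj_closure N {h \<in> carrier_vec N. h \<noteq> 0\<^sub>v N \<and>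
     (\<exists>p. regular_point N X p \<and> meets_non_transversally N X h p)}"

text \<open>
  Isomorphism as embedded projective varieties: a linear isomorphism of the ambient
  projective spaces maps one variety onto the other.
\<close>

definition embedded_isomorphic :: "nat \<Rightarrow> ('k :: field) vec set \<Rightarrow> 'k vec set \<Rightarrow> bool" where
  "embedded_isomorphic N X Y \<longleftrightarrow>
     (\<exists>M \<in> carrier_mat N N. invertible_mat M \<and> (\<lambda>v. M *\<^sub>v v) ` X = Y)"

definition self_dual :: "nat \<Rightarrow> ('k :: field) vec set \<Rightarrow> bool" where
  "self_dual N X \<longleftrightarrow> embedded_isomorphic N X (dual_variety N X)"


section \<open>Toric varieties\<close>

definition pos_exponent :: "int vec \<Rightarrow> (nat \<Rightarrow>\<^sub>0 nat)" where
  "pos_exponent u = (\<Sum>i < dim_vec u. Poly_Mapping.single i (nat (u $ i)))"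

text \<open>\<open>x\<^bsup>u\<^sup>+\<^esup> - x\<^bsup>u\<^sup>-\<^esup>\<close>, where \<open>u\<^sup>-\<close> is the positive part of \<open>-u\<close>.\<close>

definition toric_binomial :: "int vec \<Rightarrow> ('k :: field) mpoly" where
  "toric_binomial u =
     Poly_Mapping.single (pos_exponent u) 1 - Poly_Mapping.single (pos_exponent (- u)) 1"

definition toric_ideal :: "int mat \<Rightarrow> ('k :: field) mpoly set" where
  "toric_ideal A = genideal (mpoly_ring (dim_col A)) (toric_binomial ` mat_kernel A)"

definition toric_variety :: "int mat \<Rightarrow> ('k :: field) vec set" where
  "toric_variety A = proj_zeros (dim_col A) (toric_ideal A)"

end

theory Submission
  imports Defs
begin

text \<open>
  Let \<open>L\<close> be the kernel lattice of the configuration and \<open>T\<close> the torus cut out by \<open>L\<close>, a dense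
  subset of \<open>X\<^sub>A\<close>. The conormal vectors of \<open>X\<^sub>A\<close> at points of \<open>T\<close> are the \<open>u / t\<close> with \<open>t \<in> T\<close>
  and \<open>u\<close> in the kernel of \<open>A\<close> over \<open>K\<close>, and they are dense in the dual variety. If a linear
  isomorphism maps \<open>X\<^sub>A\<close> onto its dual, then at a general \<open>u / t\<close> the tangent space of the dual has
  the same dimension as that of \<open>X\<^sub>A\<close>. It contains both the kernel translated by \<open>t\<close> and the
  tangent space of the orbit of \<open>u / t\<close>. Counting dimensions, with linear forms vanishing on the two
  varieties compared through the isomorphism, shows that the ground set has exactly \<open>|A| - |C|\<close> free
  vectors, and that for every \<open>v\<close> in the kernel lattice of the ground set the monomial \<open>u\<^sup>v\<close> has
  vanishing logarithmic derivative on the kernel. Its residues say that the coordinates of \<open>v\<close> sum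
  to zero over each class of proportional coordinates, that is, over each line of the Gale dual.
  These classes, with their primitive directions as \<open>c'\<^sub>i\<close>, are the blocks of the
  generalized Lawrence matrix, the free vectors forming the block of \<open>\<epsilon>\<^sub>1\<close>. The toric variety
  depends only on the kernel, which this matrix reproduces.
\<close>

subsection \<open>Polynomial functions\<close>

text \<open>Facts about polynomials vanishing on the torus reduce to one variable: a curve
  \<open>z ^ w i\<close> with \<open>w\<close> in the row span keeps apart finitely many exponents
  that differ modulo the kernel lattice, so such a polynomial has coefficient sum zero on each
  class. The geometric obstacle is that the dual is defined through regular points and a dimension
  given by chains; that torus points are regular rests on the exact dimension, obtained by bounding
  chains through the growth of spaces of forms. The two counts of free vectors go in opposite
  directions. A free vector gives a linear form on the dual, the sum of coordinates over its copies,
  and a repeated column gives one on the variety, so at most \<open>N - n\<close> vectors are free.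
  For the reverse inequality the orbit of \<open>u / t\<close> may be too small at free indices,
  where all fiber sums of \<open>u\<close> are zero; unit vectors added there make up for this, and
  their number enters the count. Equality leaves no slack: on the other indices every kernel vector
  is \<open>u\<close> times a combination of rows, and rows are orthogonal to the kernel
  lattice.\<close>

definition power_prod :: "nat \<Rightarrow> (nat \<Rightarrow> nat) \<Rightarrow> (nat \<Rightarrow> 'k) \<Rightarrow> 'k :: field" where
  "power_prod N b x = (\<Prod>i<N. x i ^ b i)"

definition eval_terms :: "nat \<Rightarrow> ('k \<times> (nat \<Rightarrow> nat)) list \<Rightarrow> (nat \<Rightarrow> 'k) \<Rightarrow> 'k :: field" where
  "eval_terms N ms x = (\<Sum>(c, b)\<leftarrow>ms. c * power_prod N b x)"

text \<open>\<open>E\<close> is the set of allowed total degrees: \<open>{e}\<close> means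
  homogeneous of degree \<open>e\<close>, \<open>UNIV\<close> no restriction. The zero function
  belongs to every \<open>E\<close> through the empty term list. Exponents are functions on all of
  \<open>nat\<close>, of which only the values below \<open>N\<close> count.\<close>

definition polyfun :: "nat \<Rightarrow> nat set \<Rightarrow> ((nat \<Rightarrow> 'k :: field) \<Rightarrow> 'k) \<Rightarrow> bool" where
  "polyfun N E F \<longleftrightarrow> (\<exists>ms. (\<forall>(c, b)\<in>set ms. sum b {..<N} \<in> E) \<and> F = eval_terms N ms)"

lemma poly_sum_list_map: "poly (\<Sum>m\<leftarrow>ms. P m) z = (\<Sum>m\<leftarrow>ms. poly (P m) z)"
  by (induction ms) auto

lemma coeff_sum_list_map: "coeff (\<Sum>m\<leftarrow>ms. P m) k = (\<Sum>m\<leftarrow>ms. coeff (P m) k)"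
  by (induction ms) auto

lemma eval_terms_append: "eval_terms N (ms @ ms') x = eval_terms N ms x + eval_terms N ms' x"
  by (simp add: eval_terms_def)

lemma eval_terms_Nil [simp]: "eval_terms N [] x = 0"
  by (simp add: eval_terms_def)

lemma eval_terms_Cons: "eval_terms N ((c, b) # ms) x = c * power_prod N b x + eval_terms N ms x"
  by (simp add: eval_terms_def)

lemma power_prod_add: "power_prod N (\<lambda>i. b i + b' i) x = power_prod N b x * power_prod N b' x"
  by (simp add: power_prod_def power_add prod.distrib)

lemma power_prod_mult: "power_prod N b (\<lambda>i. x i * y i) = power_prod N b x * power_prod N b y"
  by (simp add: power_prod_def power_mult_distrib prod.distrib)

lemma power_prod_inverse: "power_prod N b (\<lambda>i. inverse (x i)) = inverse (power_prod N b x)"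
  using prod_inversef[of "\<lambda>i. x i ^ b i" "{..<N}"] by (simp add: power_prod_def power_inverse o_def)

lemma power_prod_cong: "(\<And>i. i < N \<Longrightarrow> x i = y i) \<Longrightarrow> power_prod N b x = power_prod N b y"
  by (simp add: power_prod_def)

lemma power_prod_scale: "power_prod N b (\<lambda>i. c * x i) = c ^ sum b {..<N} * power_prod N b x"
  by (simp add: power_prod_def power_mult_distrib prod.distrib power_sum)

lemma eval_terms_cong: "(\<And>i. i < N \<Longrightarrow> x i = y i) \<Longrightarrow> eval_terms N ms x = eval_terms N ms y"
  using power_prod_cong[of N x y] by (simp add: eval_terms_def)

lemma polyfun_cong: "polyfun N E F \<Longrightarrow> (\<And>i. i < N \<Longrightarrow> x i = y i) \<Longrightarrow> F x = F y"
  using eval_terms_cong unfolding polyfun_def by blast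

lemma polyfun_mono: "polyfun N E F \<Longrightarrow> E \<subseteq> E' \<Longrightarrow> polyfun N E' F"
  unfolding polyfun_def by fast

lemma polyfun_UNIV: "polyfun N E F \<Longrightarrow> polyfun N UNIV F"
  by (rule polyfun_mono) auto

lemma polyfun_const: "0 \<in> E \<Longrightarrow> polyfun N E (\<lambda>x. c)"
  unfolding polyfun_def
  by (rule exI[of _ "[(c, \<lambda>_. 0)]"]) (auto simp: eval_terms_def power_prod_def)

lemma polyfun_zero: "polyfun N E (\<lambda>x. 0)"
  unfolding polyfun_def by (rule exI[of _ "[]"]) auto

lemma power_prod_unit: "i < N \<Longrightarrow> power_prod N (\<lambda>j. if j = i then n else 0) x = x i ^ n"
proof -
  assume "i < N"
  have "power_prod N (\<lambda>j. if j = i then n else 0) x = (\<Prod>j<N. if j = i then x i ^ n else 1)"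
    unfolding power_prod_def by (rule prod.cong) auto
  thus ?thesis using \<open>i < N\<close> by (simp add: prod.delta)
qed

lemma polyfun_var: "i < N \<Longrightarrow> 1 \<in> E \<Longrightarrow> polyfun N E (\<lambda>x. x i)"
  unfolding polyfun_def
  by (rule exI[of _ "[(1, \<lambda>j. if j = i then 1 else 0)]"])
     (auto simp: fun_eq_iff eval_terms_def power_prod_unit[where n = 1, simplified])

lemma polyfun_power_prod: "sum b {..<N} \<in> E \<Longrightarrow> polyfun N E (power_prod N b)"
  unfolding polyfun_def
  by (rule exI[of _ "[(1, b)]"]) (auto simp: fun_eq_iff eval_terms_def)

lemma polyfun_add: "polyfun N E F \<Longrightarrow> polyfun N E G \<Longrightarrow> polyfun N E (\<lambda>x. F x + G x)"
proof -
  assume "polyfun N E F" "polyfun N E G"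
  then obtain ms ms' where "\<forall>(c, b)\<in>set ms. sum b {..<N} \<in> E" "F = eval_terms N ms"
      "\<forall>(c, b)\<in>set ms'. sum b {..<N} \<in> E" "G = eval_terms N ms'"
    unfolding polyfun_def by blast
  thus ?thesis unfolding polyfun_def
    by (intro exI[of _ "ms @ ms'"]) (auto simp: fun_eq_iff eval_terms_append)
qed

lemma polyfun_sum: "(\<And>i. i \<in> I \<Longrightarrow> polyfun N E (F i)) \<Longrightarrow> polyfun N E (\<lambda>x. \<Sum>i\<in>I. F i x)"
  by (induction I rule: infinite_finite_induct) (auto simp: polyfun_zero polyfun_add)

lemma polyfun_sum_list:
  "(\<And>m. m \<in> set ms \<Longrightarrow> polyfun N E (F m)) \<Longrightarrow> polyfun N E (\<lambda>x. \<Sum>m\<leftarrow>ms. F m x)"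
  by (induction ms) (auto simp: polyfun_zero polyfun_add)

lemma polyfun_mult:
  assumes "polyfun N E F" "polyfun N E' G" "\<And>a b. a \<in> E \<Longrightarrow> b \<in> E' \<Longrightarrow> a + b \<in> E''"
  shows "polyfun N E'' (\<lambda>x. F x * G x)"
proof -
  obtain ms where ms: "\<forall>(c, b)\<in>set ms. sum b {..<N} \<in> E" "F = eval_terms N ms"
    using assms unfolding polyfun_def by blast
  obtain ms' where ms': "\<forall>(c, b)\<in>set ms'. sum b {..<N} \<in> E'" "G = eval_terms N ms'"
    using assms unfolding polyfun_def by blast
  have "polyfun N E'' (\<lambda>x. \<Sum>m\<leftarrow>ms. \<Sum>m'\<leftarrow>ms'. fst m * fst m' * power_prod N (\<lambda>i. snd m i + snd m' i) x)"
  proof (intro polyfun_sum_list)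
    fix m m' assume "m \<in> set ms" "m' \<in> set ms'"
    hence "sum (snd m) {..<N} \<in> E" "sum (snd m') {..<N} \<in> E'" using ms ms' by auto
    thus "polyfun N E'' (\<lambda>x. fst m * fst m' * power_prod N (\<lambda>i. snd m i + snd m' i) x)"
      unfolding polyfun_def
      by (intro exI[of _ "[(fst m * fst m', \<lambda>i. snd m i + snd m' i)]"])
         (auto simp: eval_terms_def sum.distrib assms(3))
  qed
  also have "(\<lambda>x. \<Sum>m\<leftarrow>ms. \<Sum>m'\<leftarrow>ms'. fst m * fst m' * power_prod N (\<lambda>i. snd m i + snd m' i) x) = (\<lambda>x. F x * G x)"
    unfolding ms ms' eval_terms_def
    by (auto simp: fun_eq_iff power_prod_add sum_list_mult_const[symmetric] sum_list_const_mult[symmetric]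
          case_prod_unfold mult_ac)
  finally show ?thesis .
qed

lemma polyfun_UNIV_mult: "polyfun N UNIV F \<Longrightarrow> polyfun N UNIV G \<Longrightarrow> polyfun N UNIV (\<lambda>x. F x * G x)"
  by (erule polyfun_mult) auto

lemma polyfun_cmult: "polyfun N E F \<Longrightarrow> polyfun N E (\<lambda>x. c * F x)"
  by (rule polyfun_mult[OF polyfun_const[of "{0}"]]) auto

lemma hpolyfun_mult: "polyfun N {a} F \<Longrightarrow> polyfun N {b} G \<Longrightarrow> polyfun N {a + b} (\<lambda>x. F x * G x)"
  by (erule polyfun_mult) auto

lemma polyfun_UNIV_prod: "(\<And>i. i \<in> I \<Longrightarrow> polyfun N UNIV (F i)) \<Longrightarrow> polyfun N UNIV (\<lambda>x. \<Prod>i\<in>I. F i x)"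
  by (induction I rule: infinite_finite_induct) (auto simp: polyfun_const polyfun_UNIV_mult)

lemma hpolyfun_prod:
  "finite I \<Longrightarrow> (\<And>i. i \<in> I \<Longrightarrow> polyfun N {e i} (F i)) \<Longrightarrow> polyfun N {sum e I} (\<lambda>x. \<Prod>i\<in>I. F i x)"
proof (induction I rule: finite_induct)
  case (insert i I)
  have "polyfun N {e i + sum e I} (\<lambda>x. F i x * (\<Prod>i\<in>I. F i x))"
    by (rule hpolyfun_mult) (use insert in auto)
  thus ?case using insert by simp
qed (simp add: polyfun_const)

lemma hpolyfun_power: "polyfun N {e} F \<Longrightarrow> polyfun N {n * e} (\<lambda>x. F x ^ n)"
  using hpolyfun_prod[of "{..<n}" N "\<lambda>_. e" "\<lambda>_. F"] by simp

lemma polyfun_UNIV_power: "polyfun N UNIV F \<Longrightarrow> polyfun N UNIV (\<lambda>x. F x ^ n)"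
  using polyfun_UNIV_prod[of "{..<n}" N "\<lambda>_. F"] by simp

lemma polyfun_UNIV_compose:
  assumes "polyfun N UNIV F" "\<And>i. i < N \<Longrightarrow> polyfun N' UNIV (G i)"
  shows "polyfun N' UNIV (\<lambda>x. F (\<lambda>i. G i x))"
proof -
  obtain ms where "F = eval_terms N ms" using assms(1) unfolding polyfun_def by blast
  thus ?thesis unfolding eval_terms_def power_prod_def case_prod_unfold
    by (auto intro!: polyfun_sum_list polyfun_cmult polyfun_UNIV_prod polyfun_UNIV_power assms(2))
qed

lemma hpolyfun_compose_linear:
  assumes "polyfun N {e} F" "\<And>i. i < N \<Longrightarrow> polyfun N' {1} (G i)"
  shows "polyfun N' {e} (\<lambda>x. F (\<lambda>i. G i x))"
proof -
  obtain ms where ms: "\<forall>(c, b)\<in>set ms. sum b {..<N} \<in> {e}" "F = eval_terms N ms"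
    using assms(1) unfolding polyfun_def by blast
  have "polyfun N' {e} (\<lambda>x. \<Prod>i<N. G i x ^ b i)" if "sum b {..<N} = e" for b
    using hpolyfun_prod[of "{..<N}" N' b "\<lambda>i x. G i x ^ b i"] that
      hpolyfun_power[OF assms(2)] by auto
  thus ?thesis using ms unfolding eval_terms_def power_prod_def case_prod_unfold
    by (auto intro!: polyfun_sum_list polyfun_cmult)
qed

lemma hpolyfun_scale: "polyfun N {e} F \<Longrightarrow> F (\<lambda>i. c * x i) = c ^ e * F x"
proof -
  assume "polyfun N {e} F"
  then obtain ms where ms: "\<forall>(c, b)\<in>set ms. sum b {..<N} = e" "F = eval_terms N ms"
    unfolding polyfun_def by auto
  have "(\<Sum>(a, b)\<leftarrow>ms. a * power_prod N b (\<lambda>i. c * x i)) = (\<Sum>(a, b)\<leftarrow>ms. c ^ e * (a * power_prod N b x))"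
    by (rule arg_cong[of _ _ sum_list], rule map_cong) (use ms in \<open>auto simp: power_prod_scale mult_ac\<close>)
  thus ?thesis unfolding ms eval_terms_def
    by (simp add: sum_list_const_mult case_prod_unfold)
qed

text \<open>Substituting the linear polynomials \<open>[:x i, v i:]\<close> into the terms gives the
  restriction to a line; derivatives and the irreducibility of linear spaces are read off from
  it.\<close>

lemma polyfun_line_poly:
  assumes "polyfun N E F"
  shows "\<exists>P. \<forall>z. poly P z = F (\<lambda>i. x i + z * v i)"
proof -
  obtain ms where "F = eval_terms N ms" using assms unfolding polyfun_def by blast
  hence "\<forall>z. poly (\<Sum>(c, b)\<leftarrow>ms. Polynomial.smult c (\<Prod>i<N. [:x i, v i:] ^ b i)) z = F (\<lambda>i. x i + z * v i)"
    by (simp add: eval_terms_def power_prod_def poly_sum_list_map case_prod_unfold poly_prod o_def)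
  thus ?thesis by blast
qed

text \<open>The derivative at \<open>x\<close> in direction \<open>v\<close>, read off the restriction to a line; meaningful for
  polynomial functions over an infinite field.\<close>

definition dir_deriv :: "((nat \<Rightarrow> 'k) \<Rightarrow> 'k) \<Rightarrow> (nat \<Rightarrow> 'k) \<Rightarrow> (nat \<Rightarrow> 'k) \<Rightarrow> 'k :: field" where
  "dir_deriv F x v = (THE D. \<exists>P. (\<forall>z. poly P z = F (\<lambda>i. x i + z * v i)) \<and> coeff P 1 = D)"

text \<open>The value at \<open>0\<close> is left out because monomial curves lie in the torus only
  for nonzero parameters, and because the residue argument for class sums divides by the
  parameter.\<close>

lemma poly_eqI_infinite:
  fixes P Q :: "'k :: field_char_0 poly"
  assumes "\<And>z. z \<noteq> 0 \<Longrightarrow> poly P z = poly Q z"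
  shows "P = Q"
proof (rule ccontr)
  assume "P \<noteq> Q"
  hence "finite {z. poly (P - Q) z = 0}" by (intro poly_roots_finite) simp
  moreover have "UNIV - {0} \<subseteq> {z. poly (P - Q) z = 0}" using assms by auto
  ultimately have "finite (UNIV - {0 :: 'k})" by (rule finite_subset[rotated])
  hence "finite (UNIV :: 'k set)" by simp
  thus False using infinite_UNIV_char_0 by blast
qed

lemma dir_deriv_eqI:
  fixes P :: "'k :: field_char_0 poly"
  assumes "\<And>z. poly P z = F (\<lambda>i. x i + z * v i)"
  shows "dir_deriv F x v = coeff P 1"
  unfolding dir_deriv_def
proof (rule the_equality)
  fix D assume "\<exists>P. (\<forall>z. poly P z = F (\<lambda>i. x i + z * v i)) \<and> coeff P 1 = D"
  then obtain Q where "\<forall>z. poly Q z = F (\<lambda>i. x i + z * v i)" "coeff Q 1 = D" by blast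
  moreover have "P = Q" by (rule poly_eqI_infinite) (use assms calculation in auto)
  ultimately show "D = coeff P 1" by simp
qed (use assms in blast)

lemma dir_deriv_eq_0:
  fixes F :: "(nat \<Rightarrow> 'k :: field_char_0) \<Rightarrow> 'k"
  assumes "polyfun N E F" "\<And>z. z \<noteq> 0 \<Longrightarrow> F (\<lambda>i. x i + z * v i) = 0"
  shows "dir_deriv F x v = 0"
proof -
  obtain P where P: "\<forall>z. poly P z = F (\<lambda>i. x i + z * v i)"
    using polyfun_line_poly[OF assms(1)] by blast
  have "P = 0" by (rule poly_eqI_infinite) (use P assms in auto)
  thus ?thesis using dir_deriv_eqI[of P F x v] P by simp
qed

lemma coeff_1_eq_pderiv: "coeff P 1 = poly (pderiv P) 0"
  by (simp add: poly_0_coeff_0 coeff_pderiv)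

text \<open>The linear coefficient along the line is the derivative at \<open>0\<close> of a product
  of powers of linear polynomials, so this is the product rule. The factor
  \<open>of_nat (b i)\<close> kills the terms in which \<open>b i - 1\<close> is truncated.\<close>

lemma dir_deriv_eval_terms:
  fixes x :: "nat \<Rightarrow> 'k :: field_char_0"
  shows "dir_deriv (eval_terms N ms) x v =
    (\<Sum>(c, b)\<leftarrow>ms. c * (\<Sum>i<N. of_nat (b i) * x i ^ (b i - 1) * (\<Prod>j\<in>{..<N} - {i}. x j ^ b j) * v i))"
proof -
  define P where "P = (\<lambda>(c, b). Polynomial.smult c (\<Prod>i<N. [:x i, v i:] ^ b i))"
  have "dir_deriv (eval_terms N ms) x v = coeff (\<Sum>m\<leftarrow>ms. P m) 1"
    by (rule dir_deriv_eqI) (simp add: P_def eval_terms_def power_prod_def poly_sum_list_map case_prod_unfold poly_prod o_def)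
  also have "\<dots> = (\<Sum>m\<leftarrow>ms. coeff (P m) 1)"
    by (simp add: coeff_sum_list_map)
  also have "\<dots> = (\<Sum>(c, b)\<leftarrow>ms. c * (\<Sum>i<N. of_nat (b i) * x i ^ (b i - 1) * (\<Prod>j\<in>{..<N} - {i}. x j ^ b j) * v i))"
    unfolding coeff_1_eq_pderiv P_def case_prod_unfold pderiv_smult pderiv_prod pderiv_power
    by (simp add: poly_sum poly_prod pderiv_pCons mult_ac)
  finally show ?thesis .
qed

lemma dir_deriv_linear:
  fixes F :: "(nat \<Rightarrow> 'k :: field_char_0) \<Rightarrow> 'k"
  assumes "polyfun N E F"
  shows "dir_deriv F x v = (\<Sum>i<N. dir_deriv F x (\<lambda>j. if j = i then 1 else 0) * v i)"
proof -
  obtain ms where F: "F = eval_terms N ms" using assms unfolding polyfun_def by blast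
  define h where "h = (\<lambda>b i. of_nat (b i) * x i ^ (b i - 1) * (\<Prod>j\<in>{..<N} - {i}. x j ^ b j) :: 'k)"
  have 1: "dir_deriv F x v = (\<Sum>(c, b)\<leftarrow>ms. c * (\<Sum>i<N. h b i * v i))" for v
    unfolding F dir_deriv_eval_terms h_def ..
  have 2: "dir_deriv F x (\<lambda>j. if j = i then 1 else 0) = (\<Sum>(c, b)\<leftarrow>ms. c * h b i)" if "i < N" for i
    unfolding 1 using that by (auto simp: if_distrib[of "\<lambda>x. _ * x"] sum.delta cong: if_cong)
  have "dir_deriv F x v = (\<Sum>i<N. (\<Sum>(c, b)\<leftarrow>ms. c * h b i) * v i)"
    unfolding 1
    by (induction ms) (auto simp: sum.distrib sum_distrib_left algebra_simps)
  thus ?thesis using 2 by simp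
qed

lemma polyfun_dir_deriv:
  fixes F :: "(nat \<Rightarrow> 'k :: field_char_0) \<Rightarrow> 'k"
  assumes "polyfun N E F"
  shows "polyfun N UNIV (\<lambda>x. dir_deriv F x v)"
proof -
  obtain ms where F: "F = eval_terms N ms" using assms unfolding polyfun_def by blast
  have *: "(\<Sum>i<N. of_nat (b i) * x i ^ (b i - 1) * (\<Prod>j\<in>{..<N} - {i}. x j ^ b j) * v i)
     = (\<Sum>i<N. (of_nat (b i) * v i) * (x i ^ (b i - 1) * (\<Prod>j\<in>{..<N} - {i}. x j ^ b j)))" for b and x :: "nat \<Rightarrow> 'k"
    by (simp add: mult_ac)
  show ?thesis unfolding F dir_deriv_eval_terms case_prod_unfold *
    by (auto intro!: polyfun_sum_list polyfun_cmult polyfun_sum polyfun_UNIV_mult polyfun_UNIV_power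
        polyfun_UNIV_prod polyfun_var)
qed

lemma dir_deriv_compose_linear:
  fixes F :: "(nat \<Rightarrow> 'k :: field_char_0) \<Rightarrow> 'k"
  assumes "polyfun N E F"
  shows "dir_deriv (\<lambda>x. F (\<lambda>i. \<Sum>j<N. m i j * x j)) x v =
    dir_deriv F (\<lambda>i. \<Sum>j<N. m i j * x j) (\<lambda>i. \<Sum>j<N. m i j * v j)"
proof -
  obtain P where P: "\<forall>z. poly P z = F (\<lambda>i. (\<Sum>j<N. m i j * x j) + z * (\<Sum>j<N. m i j * v j))"
    using polyfun_line_poly[OF assms, of "\<lambda>i. \<Sum>j<N. m i j * x j" "\<lambda>i. \<Sum>j<N. m i j * v j"] by blast
  have "dir_deriv F (\<lambda>i. \<Sum>j<N. m i j * x j) (\<lambda>i. \<Sum>j<N. m i j * v j) = coeff P 1"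
    by (rule dir_deriv_eqI) (use P in auto)
  moreover have "dir_deriv (\<lambda>x. F (\<lambda>i. \<Sum>j<N. m i j * x j)) x v = coeff P 1"
    by (rule dir_deriv_eqI)
       (simp add: P distrib_left sum.distrib sum_distrib_left mult_ac)
  ultimately show ?thesis by simp
qed

lemma dir_deriv_cong:
  assumes "polyfun N E F" "\<And>i. i < N \<Longrightarrow> x i = x' i" "\<And>i. i < N \<Longrightarrow> v i = v' i"
  shows "dir_deriv F x v = dir_deriv F x' v'"
proof -
  have "F (\<lambda>i. x i + z * v i) = F (\<lambda>i. x' i + z * v' i)" for z
    by (rule polyfun_cong[OF assms(1)]) (use assms in auto)
  thus ?thesis unfolding dir_deriv_def by simp
qed

subsection \<open>Monomial curves in the torus\<close>

definition row_kernel :: "nat \<Rightarrow> (nat \<Rightarrow> int) list \<Rightarrow> (nat \<Rightarrow> int) \<Rightarrow> bool" where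
  "row_kernel N rs u \<longleftrightarrow> (\<forall>r\<in>set rs. (\<Sum>i<N. r i * u i) = 0)"

definition exp_diff :: "(nat \<Rightarrow> nat) \<Rightarrow> (nat \<Rightarrow> nat) \<Rightarrow> nat \<Rightarrow> int" where
  "exp_diff b b' i = int (b i) - int (b' i)"

definition toric_cone :: "nat \<Rightarrow> (nat \<Rightarrow> int) list \<Rightarrow> (nat \<Rightarrow> 'k :: field) set" where
  "toric_cone N rs = {x. \<forall>b b'. row_kernel N rs (exp_diff b b') \<longrightarrow> power_prod N b x = power_prod N b' x}"

definition torus :: "nat \<Rightarrow> (nat \<Rightarrow> int) list \<Rightarrow> (nat \<Rightarrow> 'k :: field) set" where
  "torus N rs = {t \<in> toric_cone N rs. \<forall>i<N. t i \<noteq> 0}"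

lemma torus_mult: "s \<in> torus N rs \<Longrightarrow> t \<in> torus N rs \<Longrightarrow> (\<lambda>i. s i * t i) \<in> torus N rs"
  by (auto simp: torus_def toric_cone_def power_prod_mult)

lemma torus_inverse: "t \<in> torus N rs \<Longrightarrow> (\<lambda>i. inverse (t i)) \<in> torus N rs"
  by (auto simp: torus_def toric_cone_def power_prod_inverse)

lemma one_in_torus: "(\<lambda>_. 1) \<in> torus N rs"
  by (auto simp: torus_def toric_cone_def power_prod_def)

text \<open>The weight is the combination of the rows with coefficients \<open>n ^ k\<close>. Its
  pairing with a fixed \<open>u\<close> is a polynomial in \<open>n\<close> whose coefficients are
  the pairings of the rows with \<open>u\<close>, so for finitely many \<open>u\<close> all but
  finitely many \<open>n\<close> separate. The extra summand \<open>n ^ d\<close>, a multiple of the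
  row of ones, makes the weights nonnegative.\<close>

lemma exists_separating_weight:
  assumes "(\<lambda>_. 1) \<in> set rs" "finite \<Delta>"
  obtains w :: "nat \<Rightarrow> nat" where
    "\<And>u. row_kernel N rs u \<Longrightarrow> (\<Sum>i<N. int (w i) * u i) = 0"
    "\<And>u. u \<in> \<Delta> \<Longrightarrow> (\<Sum>i<N. int (w i) * u i) = 0 \<Longrightarrow> row_kernel N rs u"
proof -
  define d where "d = length rs"
  have d: "d > 0" using assms(1) by (cases rs) (auto simp: d_def)
  define W where "W = (\<lambda>(n :: int) j. n ^ d + (\<Sum>k<d. n ^ k * (rs ! k) j))"
  \<comment> \<open>\<open>B\<close> bounds the sum of the absolute row entries in each column, so
    for \<open>n \<ge> B\<close> the summand \<open>n ^ d\<close> dominates the rows, whose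
    coefficients are at most \<open>n ^ (d - 1)\<close>.\<close>
  define B where "B = (\<Sum>j<N. \<Sum>k<d. \<bar>(rs ! k) j\<bar>)"
  have W_nonneg: "W n j \<ge> 0" if "n \<ge> B" "n \<ge> 1" "j < N" for n j
  proof -
    have "(\<Sum>k<d. \<bar>(rs ! k) j\<bar>) \<le> B"
      unfolding B_def by (rule member_le_sum) (use that in \<open>auto intro: sum_nonneg\<close>)
    have "- (\<Sum>k<d. n ^ k * (rs ! k) j) \<le> (\<Sum>k<d. n ^ k * \<bar>(rs ! k) j\<bar>)"
      unfolding sum_negf[symmetric]
    proof (rule sum_mono)
      fix k
      have "n ^ k * - (rs ! k) j \<le> n ^ k * \<bar>(rs ! k) j\<bar>" by (rule mult_left_mono) (use that in auto)
      thus "- (n ^ k * (rs ! k) j) \<le> n ^ k * \<bar>(rs ! k) j\<bar>" by simp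
    qed
    also have "\<dots> \<le> (\<Sum>k<d. n ^ (d - 1) * \<bar>(rs ! k) j\<bar>)"
      by (intro sum_mono mult_right_mono power_increasing) (use that in auto)
    also have "\<dots> = n ^ (d - 1) * (\<Sum>k<d. \<bar>(rs ! k) j\<bar>)" by (simp add: sum_distrib_left)
    also have "\<dots> \<le> n ^ (d - 1) * n"
      by (intro mult_left_mono) (use that \<open>_ \<le> B\<close> in auto)
    also have "\<dots> = n ^ d" using d by (cases d) auto
    finally show ?thesis unfolding W_def by simp
  qed
  define p where "p = (\<lambda>u. monom (\<Sum>i<N. u i) d + (\<Sum>k<d. monom (\<Sum>i<N. (rs ! k) i * u i) k) :: int poly)"
  have p_W: "poly (p u) n = (\<Sum>i<N. W n i * u i)" for u n
    unfolding p_def W_def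
    by (simp add: poly_monom poly_sum sum_distrib_right sum.distrib distrib_right)
       (subst sum.swap, simp add: sum_distrib_left sum_distrib_right mult_ac)
  have p_0: "row_kernel N rs u" if "p u = 0" for u
  proof -
    have "(\<Sum>i<N. (rs ! k) i * u i) = 0" if "k < d" for k
    proof -
      have "coeff (p u) k = (\<Sum>i<N. (rs ! k) i * u i)"
        using that unfolding p_def
        by (simp add: coeff_sum sum.delta)
      thus ?thesis using \<open>p u = 0\<close> by simp
    qed
    thus ?thesis unfolding row_kernel_def d_def by (auto simp: in_set_conv_nth)
  qed
  have "finite (\<Union>u\<in>{u\<in>\<Delta>. p u \<noteq> 0}. {n. poly (p u) n = 0})"
    using assms(2) by (auto intro: poly_roots_finite)
  hence "finite ((\<Union>u\<in>{u\<in>\<Delta>. p u \<noteq> 0}. {n. poly (p u) n = 0}) \<union> {..<max B 1} \<inter> {0..})"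
    by (auto intro: finite_subset[of _ "{0..<max B 1}"])
  moreover have "infinite {0::int..}" by (simp add: infinite_Ici)
  ultimately have "infinite ({0..} - ((\<Union>u\<in>{u\<in>\<Delta>. p u \<noteq> 0}. {n. poly (p u) n = 0}) \<union> {..<max B 1} \<inter> {0..}))"
    by (rule Diff_infinite_finite)
  hence "{0..} - ((\<Union>u\<in>{u\<in>\<Delta>. p u \<noteq> 0}. {n. poly (p u) n = 0}) \<union> {..<max B 1} \<inter> {0..}) \<noteq> {}"
    by (rule infinite_imp_nonempty)
  then obtain n where n: "n \<in> {0..} - ((\<Union>u\<in>{u\<in>\<Delta>. p u \<noteq> 0}. {n. poly (p u) n = 0}) \<union> {..<max B 1} \<inter> {0..})"
    by blast
  hence "n \<ge> B" "n \<ge> 1" by auto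
  define w where "w = (\<lambda>j. nat (W n j))"
  have w: "(\<Sum>i<N. int (w i) * u i) = poly (p u) n" for u
    unfolding p_W w_def by (rule sum.cong) (use W_nonneg[OF \<open>n \<ge> B\<close> \<open>n \<ge> 1\<close>] in auto)
  show ?thesis
  proof
    fix u assume u: "row_kernel N rs u"
    have "(\<Sum>i<N. u i) = 0" using u assms(1) unfolding row_kernel_def by fastforce
    moreover have "(\<Sum>i<N. (rs ! k) i * u i) = 0" if "k < d" for k
      using u that unfolding row_kernel_def d_def by auto
    ultimately have "p u = 0" unfolding p_def by simp
    thus "(\<Sum>i<N. int (w i) * u i) = 0" unfolding w by simp
  next
    fix u assume "u \<in> \<Delta>" "(\<Sum>i<N. int (w i) * u i) = 0"
    hence "p u = 0" using n unfolding w by auto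
    thus "row_kernel N rs u" by (rule p_0)
  qed
qed

lemma power_prod_curve: "power_prod N b (\<lambda>i. z ^ w i) = z ^ (\<Sum>i<N. w i * b i)"
  by (simp add: power_prod_def power_sum power_mult)

lemma sum_int_diff: "(\<Sum>i<N. int (w i) * exp_diff b b' i) = int (\<Sum>i<N. w i * b i) - int (\<Sum>i<N. w i * b' i)"
  by (simp add: exp_diff_def right_diff_distrib sum_subtractf)

lemma exists_separating_curve:
  assumes "(\<lambda>_. 1) \<in> set rs" "finite Bs"
  obtains w :: "nat \<Rightarrow> nat" where
    "\<And>z :: 'k :: field. z \<noteq> 0 \<Longrightarrow> (\<lambda>i. z ^ w i) \<in> torus N rs"
    "\<And>b b'. b \<in> Bs \<Longrightarrow> b' \<in> Bs \<Longrightarrow> (\<Sum>i<N. w i * b i) = (\<Sum>i<N. w i * b' i) \<Longrightarrow> row_kernel N rs (exp_diff b b')"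
proof -
  obtain w :: "nat \<Rightarrow> nat" where w: "\<And>u. row_kernel N rs u \<Longrightarrow> (\<Sum>i<N. int (w i) * u i) = 0"
    "\<And>u. u \<in> (\<lambda>(b, b'). exp_diff b b') ` (Bs \<times> Bs) \<Longrightarrow> (\<Sum>i<N. int (w i) * u i) = 0 \<Longrightarrow> row_kernel N rs u"
    using exists_separating_weight[OF assms(1), of "(\<lambda>(b, b'). exp_diff b b') ` (Bs \<times> Bs)" N] assms(2) by auto
  show ?thesis
  proof
    fix z :: 'k assume z: "z \<noteq> 0"
    show "(\<lambda>i. z ^ w i) \<in> torus N rs" unfolding torus_def toric_cone_def
    proof (intro CollectI conjI allI impI)
      fix b b' assume "row_kernel N rs (exp_diff b b')"
      hence "int (\<Sum>i<N. w i * b i) = int (\<Sum>i<N. w i * b' i)" using w(1) sum_int_diff[where b = b and b' = b' and w = w and N = N] by force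
      thus "power_prod N b (\<lambda>i. z ^ w i) = power_prod N b' (\<lambda>i. z ^ w i)"
        unfolding power_prod_curve by (simp only: of_nat_eq_iff)
    qed (use z in auto)
  next
    fix b b' assume "b \<in> Bs" "b' \<in> Bs" "(\<Sum>i<N. w i * b i) = (\<Sum>i<N. w i * b' i)"
    thus "row_kernel N rs (exp_diff b b')"
      by (intro w(2)) (auto simp: sum_int_diff simp del: of_nat_sum)
  qed
qed

text \<open>The coefficient of the composed polynomial in degree \<open>k\<close> collects all terms
  of weight \<open>k\<close>. As \<open>\<phi>\<close> is constant on these, it factors through the
  degree as \<open>\<psi>\<close>, and the sum is a combination of vanishing coefficients.\<close>

lemma curve_poly_class_sum:
  fixes ms :: "('k :: field \<times> (nat \<Rightarrow> nat)) list" and N :: nat and w :: "nat \<Rightarrow> nat"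
  defines "deg \<equiv> \<lambda>b. \<Sum>i<N. w i * b i"
  assumes zero: "(\<Sum>(c, b)\<leftarrow>ms. monom c (deg b)) = 0"
    and sep: "\<And>b b'. b \<in> snd ` set ms \<Longrightarrow> b' \<in> snd ` set ms \<Longrightarrow> deg b = deg b' \<Longrightarrow> \<phi> b = \<phi> b'"
  shows "(\<Sum>(c, b)\<leftarrow>ms. c * \<phi> b) = 0"
proof -
  define \<psi> where "\<psi> = (\<lambda>k. \<phi> (SOME b. b \<in> snd ` set ms \<and> deg b = k))"
  have psi: "\<psi> (deg b) = \<phi> b" if "b \<in> snd ` set ms" for b
  proof -
    have "\<exists>b'. b' \<in> snd ` set ms \<and> deg b' = deg b" using that by blast
    from someI_ex[OF this] show ?thesis unfolding \<psi>_def using sep that by blast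
  qed
  obtain K where K: "\<And>b. b \<in> snd ` set ms \<Longrightarrow> deg b \<le> K"
    using finite_nat_set_iff_bounded_le[of "deg ` snd ` set ms"] by auto
  have "(\<Sum>(c, b)\<leftarrow>ms'. c * \<phi> b) = (\<Sum>k\<le>K. coeff (\<Sum>(c, b)\<leftarrow>ms'. monom c (deg b)) k * \<psi> k)"
    if "set ms' \<subseteq> set ms" for ms'
    using that
  proof (induction ms')
    case (Cons m ms')
    obtain c b where m: "m = (c, b)" by force
    have b: "b \<in> snd ` set ms" using Cons.prems m by force
    have "(\<Sum>k\<le>K. coeff (monom c (deg b)) k * \<psi> k) = (\<Sum>k\<le>K. if k = deg b then c * \<psi> k else 0)"
      by (rule sum.cong) auto
    also have "\<dots> = c * \<phi> b" using K[OF b] psi[OF b] by (simp add: sum.delta)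
    finally show ?case using Cons by (simp add: m distrib_right sum.distrib)
  qed simp
  from this[of ms] zero show ?thesis by simp
qed

lemma poly_curve: "poly (\<Sum>(c, b)\<leftarrow>ms. monom c (\<Sum>i<N. w i * b i)) z = eval_terms N ms (\<lambda>i. z ^ w i)"
  by (simp add: eval_terms_def power_prod_curve poly_sum_list_map poly_monom case_prod_unfold o_def)

text \<open>Along a curve that separates the classes of all exponents of both factors, the product
  becomes a product of two polynomials in one variable, one of which is zero. Its coefficients are
  the sums over congruence classes; the test functions \<open>\<phi>\<close> express that each of
  them vanishes.\<close>

lemma class_sum_of_product:
  fixes ms ms' :: "('k :: field_char_0 \<times> (nat \<Rightarrow> nat)) list"
  assumes ones: "(\<lambda>_. 1) \<in> set rs"
    and van: "\<And>t. t \<in> torus N rs \<Longrightarrow> eval_terms N ms t * eval_terms N ms' t = 0"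
  shows "(\<forall>\<phi>. (\<forall>b b'. row_kernel N rs (exp_diff b b') \<longrightarrow> \<phi> b = \<phi> b') \<longrightarrow> (\<Sum>(c, b)\<leftarrow>ms. c * \<phi> b) = 0) \<or>
    (\<forall>\<phi>. (\<forall>b b'. row_kernel N rs (exp_diff b b') \<longrightarrow> \<phi> b = \<phi> b') \<longrightarrow> (\<Sum>(c, b)\<leftarrow>ms'. c * \<phi> b) = 0)"
proof -
  obtain w :: "nat \<Rightarrow> nat" where w: "\<And>z :: 'k. z \<noteq> 0 \<Longrightarrow> (\<lambda>i. z ^ w i) \<in> torus N rs"
    "\<And>b b'. b \<in> snd ` set (ms @ ms') \<Longrightarrow> b' \<in> snd ` set (ms @ ms') \<Longrightarrow> (\<Sum>i<N. w i * b i) = (\<Sum>i<N. w i * b' i) \<Longrightarrow> row_kernel N rs (exp_diff b b')"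
    using exists_separating_curve[OF ones, where N = N and Bs = "snd ` set (ms @ ms')" and 'k = 'k] by auto
  define P where "P = (\<lambda>ms :: ('k \<times> (nat \<Rightarrow> nat)) list. \<Sum>(c, b)\<leftarrow>ms. monom c (\<Sum>i<N. w i * b i))"
  have "P ms * P ms' = 0"
    by (rule poly_eqI_infinite) (use van w(1) in \<open>auto simp: P_def poly_curve\<close>)
  hence "P ms = 0 \<or> P ms' = 0" by simp
  thus ?thesis
  proof (rule disj_forward; intro allI impI)
    fix \<phi> :: "(nat \<Rightarrow> nat) \<Rightarrow> 'k"
    assume "P ms = 0" "\<forall>b b'. row_kernel N rs (exp_diff b b') \<longrightarrow> \<phi> b = \<phi> b'"
    thus "(\<Sum>(c, b)\<leftarrow>ms. c * \<phi> b) = 0" unfolding P_def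
      by (intro curve_poly_class_sum[where w = w and N = N]) (use w(2) in \<open>auto simp: image_Un\<close>)
  next
    fix \<phi> :: "(nat \<Rightarrow> nat) \<Rightarrow> 'k"
    assume "P ms' = 0" "\<forall>b b'. row_kernel N rs (exp_diff b b') \<longrightarrow> \<phi> b = \<phi> b'"
    thus "(\<Sum>(c, b)\<leftarrow>ms'. c * \<phi> b) = 0" unfolding P_def
      by (intro curve_poly_class_sum[where w = w and N = N]) (use w(2) in \<open>auto simp: image_Un\<close>)
  qed
qed

text \<open>The choice of \<open>\<phi>\<close> decides what is learned: monomial values at a point
  of the cone give density, logarithmic derivatives give tangent vectors, and the indicator of a
  class gives the linear equations.\<close>

lemma class_sum:
  fixes ms :: "('k :: field_char_0 \<times> (nat \<Rightarrow> nat)) list"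
  assumes "(\<lambda>_. 1) \<in> set rs" "\<And>t. t \<in> torus N rs \<Longrightarrow> eval_terms N ms t = 0"
    "\<And>b b'. row_kernel N rs (exp_diff b b') \<Longrightarrow> \<phi> b = \<phi> b'"
  shows "(\<Sum>(c, b)\<leftarrow>ms. c * \<phi> b) = 0"
  using class_sum_of_product[OF assms(1), of N ms ms] assms(2,3) by auto

lemma torus_dense:
  fixes F :: "(nat \<Rightarrow> 'k :: field_char_0) \<Rightarrow> 'k"
  assumes "(\<lambda>_. 1) \<in> set rs" "polyfun N E F" "\<And>t. t \<in> torus N rs \<Longrightarrow> F t = 0" "x \<in> toric_cone N rs"
  shows "F x = 0"
proof -
  obtain ms where F: "F = eval_terms N ms" using assms(2) unfolding polyfun_def by blast
  show ?thesis unfolding F eval_terms_def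
    by (rule class_sum[OF assms(1)]) (use assms(3,4) F in \<open>auto simp: toric_cone_def\<close>)
qed

lemma toric_irreducible:
  fixes F :: "(nat \<Rightarrow> 'k :: field_char_0) \<Rightarrow> 'k"
  assumes "(\<lambda>_. 1) \<in> set rs" "polyfun N E F" "polyfun N E' G" "\<And>t. t \<in> torus N rs \<Longrightarrow> F t * G t = 0"
  shows "(\<forall>x\<in>toric_cone N rs. F x = 0) \<or> (\<forall>x\<in>toric_cone N rs. G x = 0)"
proof -
  obtain ms where F: "F = eval_terms N ms" using assms(2) unfolding polyfun_def by blast
  obtain ms' where G: "G = eval_terms N ms'" using assms(3) unfolding polyfun_def by blast
  have inv: "\<forall>b b'. row_kernel N rs (exp_diff b b') \<longrightarrow> power_prod N b x = power_prod N b' x"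
    if "x \<in> toric_cone N rs" for x :: "nat \<Rightarrow> 'k" using that by (auto simp: toric_cone_def)
  have van: "eval_terms N ms t * eval_terms N ms' t = 0" if "t \<in> torus N rs" for t
    using assms(4)[OF that] F G by simp
  have "(\<forall>\<phi>. (\<forall>b b'. row_kernel N rs (exp_diff b b') \<longrightarrow> \<phi> b = \<phi> b') \<longrightarrow> (\<Sum>(c, b)\<leftarrow>ms. c * \<phi> b) = 0) \<or>
    (\<forall>\<phi>. (\<forall>b b'. row_kernel N rs (exp_diff b b') \<longrightarrow> \<phi> b = \<phi> b') \<longrightarrow> (\<Sum>(c, b)\<leftarrow>ms'. c * \<phi> b) = 0)"
    by (rule class_sum_of_product[OF assms(1)]) (rule van)
  thus ?thesis
  proof (rule disj_forward; intro ballI)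
    fix x :: "nat \<Rightarrow> 'k" assume x: "x \<in> toric_cone N rs"
    assume "\<forall>\<phi>. (\<forall>b b'. row_kernel N rs (exp_diff b b') \<longrightarrow> \<phi> b = \<phi> b') \<longrightarrow> (\<Sum>(c, b)\<leftarrow>ms. c * \<phi> b) = 0"
    from this[THEN spec, of "\<lambda>b. power_prod N b x"] inv[OF x] show "F x = 0"
      unfolding F eval_terms_def by blast
  next
    fix x :: "nat \<Rightarrow> 'k" assume x: "x \<in> toric_cone N rs"
    assume "\<forall>\<phi>. (\<forall>b b'. row_kernel N rs (exp_diff b b') \<longrightarrow> \<phi> b = \<phi> b') \<longrightarrow> (\<Sum>(c, b)\<leftarrow>ms'. c * \<phi> b) = 0"
    from this[THEN spec, of "\<lambda>b. power_prod N b x"] inv[OF x] show "G x = 0"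
      unfolding G eval_terms_def by blast
  qed
qed

text \<open>Monomials are eigenvectors of the invariant vector fields: in direction
  \<open>t i * v i\<close> the derivative multiplies \<open>power_prod N b t\<close> by the pairing
  of \<open>b\<close> with \<open>v\<close>.\<close>

lemma dir_deriv_eval_terms_torus:
  fixes t :: "nat \<Rightarrow> 'k :: field_char_0"
  assumes "\<And>i. i < N \<Longrightarrow> t i \<noteq> 0"
  shows "dir_deriv (eval_terms N ms) t (\<lambda>i. t i * v i) =
    (\<Sum>(c, b)\<leftarrow>ms. c * (power_prod N b t * (\<Sum>i<N. of_nat (b i) * v i)))"
proof -
  have "of_nat (b i) * t i ^ (b i - 1) * (\<Prod>j\<in>{..<N} - {i}. t j ^ b j) * (t i * v i)
      = power_prod N b t * (of_nat (b i) * v i)" if "i < N" for b i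
  proof (cases "b i")
    case (Suc k)
    have "power_prod N b t = t i ^ b i * (\<Prod>j\<in>{..<N} - {i}. t j ^ b j)"
      unfolding power_prod_def using that by (subst prod.remove[of _ i]) auto
    thus ?thesis using Suc by simp
  qed simp
  hence "(\<Sum>i<N. of_nat (b i) * t i ^ (b i - 1) * (\<Prod>j\<in>{..<N} - {i}. t j ^ b j) * (t i * v i))
     = power_prod N b t * (\<Sum>i<N. of_nat (b i) * v i)" for b
    unfolding sum_distrib_left by (intro sum.cong) auto
  thus ?thesis unfolding dir_deriv_eval_terms by simp
qed

text \<open>This is the span of the rows over the field, as \<open>kernel_perp_eq_row_span\<close>
  shows, and the Lie algebra of the torus. It is described by integer kernel vectors because these
  are the differences of congruent exponents.\<close>

definition kernel_perp :: "nat \<Rightarrow> (nat \<Rightarrow> int) list \<Rightarrow> (nat \<Rightarrow> 'k :: field_char_0) set" where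
  "kernel_perp N rs = {v. \<forall>u. row_kernel N rs u \<longrightarrow> (\<Sum>i<N. of_int (u i) * v i) = 0}"

lemma torus_tangent:
  fixes F :: "(nat \<Rightarrow> 'k :: field_char_0) \<Rightarrow> 'k"
  assumes "(\<lambda>_. 1) \<in> set rs" "polyfun N E F" "\<And>t. t \<in> torus N rs \<Longrightarrow> F t = 0"
    "t \<in> torus N rs" "v \<in> kernel_perp N rs"
  shows "dir_deriv F t (\<lambda>i. t i * v i) = 0"
proof -
  obtain ms where F: "F = eval_terms N ms" using assms(2) unfolding polyfun_def by blast
  show ?thesis unfolding F
  proof (subst dir_deriv_eval_terms_torus)
    show "(\<Sum>(c, b)\<leftarrow>ms. c * (power_prod N b t * (\<Sum>i<N. of_nat (b i) * v i))) = 0"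
    proof (rule class_sum[OF assms(1)])
      fix b b' assume *: "row_kernel N rs (exp_diff b b')"
      hence "(\<Sum>i<N. of_int (exp_diff b b' i) * v i) = 0" using assms(5) unfolding kernel_perp_def by blast
      hence "(\<Sum>i<N. of_nat (b i) * v i) = (\<Sum>i<N. of_nat (b' i) * v i)"
        by (simp add: exp_diff_def left_diff_distrib sum_subtractf)
      thus "power_prod N b t * (\<Sum>i<N. of_nat (b i) * v i) = power_prod N b' t * (\<Sum>i<N. of_nat (b' i) * v i)"
        using * assms(4) by (auto simp: torus_def toric_cone_def)
    qed (use assms(3) F in auto)
  qed (use assms(4) in \<open>auto simp: torus_def\<close>)
qed

subsection \<open>Polynomials as functions\<close>

definition mono_eval :: "(nat \<Rightarrow>\<^sub>0 nat) \<Rightarrow> (nat \<Rightarrow> 'k) \<Rightarrow> 'k :: field" where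
  "mono_eval e x = (\<Prod>i\<in>Poly_Mapping.keys e. x i ^ Poly_Mapping.lookup e i)"

definition mpoly_fun :: "('k :: field) mpoly \<Rightarrow> (nat \<Rightarrow> 'k) \<Rightarrow> 'k" where
  "mpoly_fun f x = (\<Sum>e\<in>Poly_Mapping.keys f. Poly_Mapping.lookup f e * mono_eval e x)"

lemma mpoly_eval_eq: "mpoly_eval f v = mpoly_fun f (\<lambda>i. v $ i)"
  by (simp add: mpoly_eval_def mpoly_fun_def mono_eval_def)

lemma mono_eval_superset:
  "finite S \<Longrightarrow> Poly_Mapping.keys e \<subseteq> S \<Longrightarrow> mono_eval e x = (\<Prod>i\<in>S. x i ^ Poly_Mapping.lookup e i)"
  unfolding mono_eval_def by (rule prod.mono_neutral_left) (auto simp: in_keys_iff)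

lemma mono_eval_power_prod:
  "Poly_Mapping.keys e \<subseteq> {..<N} \<Longrightarrow> mono_eval e x = power_prod N (Poly_Mapping.lookup e) x"
  by (simp add: mono_eval_superset power_prod_def)

lemma mono_eval_add: "mono_eval (e + e') x = mono_eval e x * mono_eval e' x"
proof -
  define S where "S = Poly_Mapping.keys e \<union> Poly_Mapping.keys e'"
  have "Poly_Mapping.keys (e + e') \<subseteq> S" unfolding S_def by (rule keys_add)
  thus ?thesis
    using mono_eval_superset[of S e x] mono_eval_superset[of S e' x] mono_eval_superset[of S "e + e'" x]
    by (simp add: S_def lookup_add power_add prod.distrib)
qed

lemma mpoly_fun_superset:
  "finite S \<Longrightarrow> Poly_Mapping.keys f \<subseteq> S \<Longrightarrow> mpoly_fun f x = (\<Sum>e\<in>S. Poly_Mapping.lookup f e * mono_eval e x)"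
  unfolding mpoly_fun_def by (rule sum.mono_neutral_left) (auto simp: in_keys_iff)

lemma mpoly_fun_zero [simp]: "mpoly_fun 0 x = 0"
  by (simp add: mpoly_fun_def)

lemma mpoly_fun_add: "mpoly_fun (f + g) x = mpoly_fun f x + mpoly_fun g x"
proof -
  define S where "S = Poly_Mapping.keys f \<union> Poly_Mapping.keys g"
  have "Poly_Mapping.keys (f + g) \<subseteq> S" unfolding S_def by (rule keys_add)
  thus ?thesis
    using mpoly_fun_superset[of S f x] mpoly_fun_superset[of S g x] mpoly_fun_superset[of S "f + g" x]
    by (simp add: S_def lookup_add distrib_right sum.distrib)
qed

lemma mpoly_fun_uminus: "mpoly_fun (- f) x = - mpoly_fun f x"
  by (simp add: mpoly_fun_def sum_negf)

lemma mpoly_fun_single: "mpoly_fun (Poly_Mapping.single e c) x = c * mono_eval e x"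
  by (simp add: mpoly_fun_def)

lemma mpoly_fun_sum: "mpoly_fun (\<Sum>i\<in>I. f i) x = (\<Sum>i\<in>I. mpoly_fun (f i) x)"
  by (induction I rule: infinite_finite_induct) (auto simp: mpoly_fun_add)

lemma mpoly_fun_sum_list: "mpoly_fun (\<Sum>i\<leftarrow>I. f i) x = (\<Sum>i\<leftarrow>I. mpoly_fun (f i) x)"
  by (induction I) (auto simp: mpoly_fun_add)

lemma mpoly_sum_single: "(f :: ('k :: field) mpoly) = (\<Sum>e\<in>Poly_Mapping.keys f. Poly_Mapping.single e (Poly_Mapping.lookup f e))"
proof (rule poly_mapping_eqI)
  fix k
  have "(\<Sum>e\<in>Poly_Mapping.keys f. Poly_Mapping.lookup (Poly_Mapping.single e (Poly_Mapping.lookup f e)) k)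
     = (\<Sum>e\<in>Poly_Mapping.keys f. if e = k then Poly_Mapping.lookup f k else 0)"
    by (rule sum.cong) (auto simp: lookup_single when_def)
  also have "\<dots> = Poly_Mapping.lookup f k"
    by (auto simp: sum.delta in_keys_iff)
  finally show "Poly_Mapping.lookup f k = Poly_Mapping.lookup (\<Sum>e\<in>Poly_Mapping.keys f. Poly_Mapping.single e (Poly_Mapping.lookup f e)) k"
    by (simp add: lookup_sum)
qed

lemma mpoly_fun_mult: "mpoly_fun (f * g) x = mpoly_fun f x * mpoly_fun g x"
proof -
  have "f * g = (\<Sum>e\<in>Poly_Mapping.keys f. \<Sum>e'\<in>Poly_Mapping.keys g.
      Poly_Mapping.single (e + e') (Poly_Mapping.lookup f e * Poly_Mapping.lookup g e'))"
    by (subst mpoly_sum_single[of f], subst mpoly_sum_single[of g])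
       (simp add: sum_product mult_single)
  thus ?thesis
    by (simp add: mpoly_fun_sum mpoly_fun_single mono_eval_add) (simp add: mpoly_fun_def sum_product mult_ac)
qed

lemma mem_mpoly_ring: "f \<in> carrier (mpoly_ring N) \<longleftrightarrow> (\<forall>e\<in>Poly_Mapping.keys f. Poly_Mapping.keys e \<subseteq> {..<N})"
  by (simp add: mpoly_ring_def)

lemma zero_mem_mpoly_ring: "0 \<in> carrier (mpoly_ring N)"
  by (simp add: mem_mpoly_ring)

lemma single_mem_mpoly_ring: "Poly_Mapping.keys e \<subseteq> {..<N} \<Longrightarrow> Poly_Mapping.single e c \<in> carrier (mpoly_ring N)"
  by (simp add: mem_mpoly_ring)

lemma add_mem_mpoly_ring:
  "f \<in> carrier (mpoly_ring N) \<Longrightarrow> g \<in> carrier (mpoly_ring N) \<Longrightarrow> f + g \<in> carrier (mpoly_ring N)"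
  using keys_add[of f g] unfolding mem_mpoly_ring by blast

lemma uminus_mem_mpoly_ring: "f \<in> carrier (mpoly_ring N) \<Longrightarrow> - f \<in> carrier (mpoly_ring N)"
  unfolding mem_mpoly_ring by simp

lemma mult_mem_mpoly_ring:
  assumes "f \<in> carrier (mpoly_ring N)" "g \<in> carrier (mpoly_ring N)"
  shows "f * g \<in> carrier (mpoly_ring N)"
  unfolding mem_mpoly_ring
proof
  fix e assume "e \<in> Poly_Mapping.keys (f * g)"
  then obtain a b where "e = a + b" "a \<in> Poly_Mapping.keys f" "b \<in> Poly_Mapping.keys g"
    using keys_mult[of f g] by blast
  thus "Poly_Mapping.keys e \<subseteq> {..<N}" using assms keys_add[of a b] unfolding mem_mpoly_ring by blast
qed

lemma ring_mpoly_ring: "ring (mpoly_ring N :: ('k :: field) mpoly ring)"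
proof (rule ringI)
  show "abelian_group (mpoly_ring N :: 'k mpoly ring)"
  proof (rule abelian_groupI)
    fix f :: "'k mpoly" assume "f \<in> carrier (mpoly_ring N)"
    thus "\<exists>g\<in>carrier (mpoly_ring N). g \<oplus>\<^bsub>mpoly_ring N\<^esub> f = \<zero>\<^bsub>mpoly_ring N\<^esub>"
      by (intro bexI[of _ "- f"] uminus_mem_mpoly_ring) (auto simp: mpoly_ring_def)
  next
    fix f g :: "'k mpoly" assume "f \<in> carrier (mpoly_ring N)" "g \<in> carrier (mpoly_ring N)"
    from add_mem_mpoly_ring[OF this] show "f \<oplus>\<^bsub>mpoly_ring N\<^esub> g \<in> carrier (mpoly_ring N)"
      by (simp add: mpoly_ring_def)
  qed (auto simp: mpoly_ring_def add_ac)
  show "monoid (mpoly_ring N :: 'k mpoly ring)"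
  proof (rule monoidI)
    fix f g :: "'k mpoly" assume "f \<in> carrier (mpoly_ring N)" "g \<in> carrier (mpoly_ring N)"
    from mult_mem_mpoly_ring[OF this] show "f \<otimes>\<^bsub>mpoly_ring N\<^esub> g \<in> carrier (mpoly_ring N)"
      by (simp add: mpoly_ring_def)
  next
    show "\<one>\<^bsub>mpoly_ring N\<^esub> \<in> carrier (mpoly_ring N :: 'k mpoly ring)"
      by (simp add: mpoly_ring_def)
  next
    fix f g h :: "'k mpoly"
    show "f \<otimes>\<^bsub>mpoly_ring N\<^esub> g \<otimes>\<^bsub>mpoly_ring N\<^esub> h = f \<otimes>\<^bsub>mpoly_ring N\<^esub> (g \<otimes>\<^bsub>mpoly_ring N\<^esub> h)"
      by (simp only: mpoly_ring_def monoid.simps mult.assoc)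
  next
    fix f :: "'k mpoly"
    show "\<one>\<^bsub>mpoly_ring N\<^esub> \<otimes>\<^bsub>mpoly_ring N\<^esub> f = f" "f \<otimes>\<^bsub>mpoly_ring N\<^esub> \<one>\<^bsub>mpoly_ring N\<^esub> = f"
      by (simp_all only: mpoly_ring_def monoid.simps mult_1_left mult_1_right)
  qed
next
  fix f g h :: "'k mpoly"
  show "(f \<oplus>\<^bsub>mpoly_ring N\<^esub> g) \<otimes>\<^bsub>mpoly_ring N\<^esub> h = f \<otimes>\<^bsub>mpoly_ring N\<^esub> h \<oplus>\<^bsub>mpoly_ring N\<^esub> g \<otimes>\<^bsub>mpoly_ring N\<^esub> h"
    unfolding mpoly_ring_def monoid.simps ring.simps by (rule distrib_right)
  show "h \<otimes>\<^bsub>mpoly_ring N\<^esub> (f \<oplus>\<^bsub>mpoly_ring N\<^esub> g) = h \<otimes>\<^bsub>mpoly_ring N\<^esub> f \<oplus>\<^bsub>mpoly_ring N\<^esub> h \<otimes>\<^bsub>mpoly_ring N\<^esub> g"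
    unfolding mpoly_ring_def monoid.simps ring.simps by (rule distrib_left)
qed

lemma eval_terms_of_mpoly:
  assumes "f \<in> carrier (mpoly_ring N)"
  obtains es where "distinct es" "set es = Poly_Mapping.keys f"
    "mpoly_fun f = eval_terms N (map (\<lambda>e. (Poly_Mapping.lookup f e, Poly_Mapping.lookup e)) es)"
proof -
  obtain es where es: "distinct es" "set es = Poly_Mapping.keys f"
    using finite_distinct_list[OF finite_keys[of f]] by auto
  have "mpoly_fun f x = eval_terms N (map (\<lambda>e. (Poly_Mapping.lookup f e, Poly_Mapping.lookup e)) es) x" for x
  proof -
    have "eval_terms N (map (\<lambda>e. (Poly_Mapping.lookup f e, Poly_Mapping.lookup e)) es) x
      = (\<Sum>e\<leftarrow>es. Poly_Mapping.lookup f e * power_prod N (Poly_Mapping.lookup e) x)"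
      by (simp add: eval_terms_def o_def)
    also have "\<dots> = (\<Sum>e\<in>set es. Poly_Mapping.lookup f e * power_prod N (Poly_Mapping.lookup e) x)"
      by (rule sum_list_distinct_conv_sum_set[OF es(1)])
    also have "\<dots> = mpoly_fun f x" unfolding mpoly_fun_def es(2)
      by (rule sum.cong) (use assms in \<open>auto simp: mem_mpoly_ring mono_eval_power_prod\<close>)
    finally show ?thesis ..
  qed
  thus ?thesis using es by (intro that[of es]) auto
qed

lemma polyfun_of_mpoly:
  assumes "f \<in> carrier (mpoly_ring N)" "homogeneous_mpoly f"
  shows "\<exists>e. polyfun N {e} (mpoly_fun f)"
proof -
  obtain es where es: "distinct es" "set es = Poly_Mapping.keys f"
    "mpoly_fun f = eval_terms N (map (\<lambda>e. (Poly_Mapping.lookup f e, Poly_Mapping.lookup e)) es)"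
    using eval_terms_of_mpoly[OF assms(1)] .
  obtain D where D: "\<forall>e\<in>Poly_Mapping.keys f. (\<Sum>i\<in>Poly_Mapping.keys e. Poly_Mapping.lookup e i) = D"
    using assms(2) unfolding homogeneous_mpoly_def by blast
  have "(\<Sum>i<N. Poly_Mapping.lookup e i) = D" if "e \<in> Poly_Mapping.keys f" for e
  proof -
    have "(\<Sum>i<N. Poly_Mapping.lookup e i) = (\<Sum>i\<in>Poly_Mapping.keys e. Poly_Mapping.lookup e i)"
      by (rule sum.mono_neutral_right) (use assms(1) that in \<open>auto simp: mem_mpoly_ring in_keys_iff\<close>)
    thus ?thesis using D that by simp
  qed
  hence "\<forall>(c, b)\<in>set (map (\<lambda>e. (Poly_Mapping.lookup f e, Poly_Mapping.lookup e)) es). sum b {..<N} \<in> {D}"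
    using es(2) by auto
  thus ?thesis unfolding polyfun_def using es(3) by blast
qed

lemma lookup_exponent: "Poly_Mapping.lookup (\<Sum>i<(N :: nat). Poly_Mapping.single i (b i)) j = (if j < N then b j else 0 :: nat)"
proof -
  have "(\<Sum>i<N. Poly_Mapping.lookup (Poly_Mapping.single i (b i)) j) = (\<Sum>i<N. if j = i then b i else 0)"
    by (rule sum.cong) (auto simp: lookup_single when_def)
  also have "\<dots> = (if j < N then b j else 0)" by (subst sum.delta') auto
  finally show ?thesis by (simp add: lookup_sum)
qed

lemma keys_exponent: "Poly_Mapping.keys (\<Sum>i<(N :: nat). Poly_Mapping.single i (b i :: nat)) \<subseteq> {..<N}"
  by (auto simp: in_keys_iff lookup_exponent split: if_splits)

lemma mono_eval_exponent: "mono_eval (\<Sum>i<N. Poly_Mapping.single i (b i)) x = power_prod N b x"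
  unfolding mono_eval_power_prod[OF keys_exponent] by (simp add: power_prod_def lookup_exponent)

lemma mpoly_of_polyfun:
  assumes "polyfun N {e} F"
  obtains f where "f \<in> carrier (mpoly_ring N)" "homogeneous_mpoly f" "mpoly_fun f = F"
proof -
  obtain ms where ms: "\<forall>(c, b)\<in>set ms. sum b {..<N} = e" "F = eval_terms N ms"
    using assms unfolding polyfun_def by auto
  define ex where "ex = (\<lambda>b. \<Sum>i<N. Poly_Mapping.single i (b i :: nat))"
  define f where "f = (\<Sum>(c, b)\<leftarrow>ms. Poly_Mapping.single (ex b) c)"
  have keys: "Poly_Mapping.keys f \<subseteq> (\<lambda>(c, b). ex b) ` set ms"
    unfolding f_def
  proof (induction ms)
    case (Cons m ms)
    thus ?case using keys_add[of "Poly_Mapping.single (ex (snd m)) (fst m)" "\<Sum>(c, b)\<leftarrow>ms. Poly_Mapping.single (ex b) c"]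
      by (auto simp: case_prod_unfold split: if_splits)
  qed simp
  have "sum (Poly_Mapping.lookup (ex b)) (Poly_Mapping.keys (ex b)) = sum b {..<N}" for b
  proof -
    have "sum (Poly_Mapping.lookup (ex b)) (Poly_Mapping.keys (ex b)) = sum (Poly_Mapping.lookup (ex b)) {..<N}"
      by (rule sum.mono_neutral_left) (use keys_exponent[where N = N and b = b] in \<open>auto simp: ex_def in_keys_iff\<close>)
    thus ?thesis by (simp add: ex_def lookup_exponent)
  qed
  hence "homogeneous_mpoly f" unfolding homogeneous_mpoly_def using keys ms(1) by (intro exI[of _ e]) fastforce
  moreover have "f \<in> carrier (mpoly_ring N)"
    unfolding mem_mpoly_ring using keys keys_exponent[where N = N] by (fastforce simp: ex_def)
  moreover have "mpoly_fun f = F"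
    unfolding ms f_def eval_terms_def
    by (auto simp: fun_eq_iff mpoly_fun_sum_list case_prod_unfold mpoly_fun_single ex_def mono_eval_exponent)
  ultimately show ?thesis using that by blast
qed

lemma mpoly_pderiv_dir_deriv:
  fixes f :: "('k :: field_char_0) mpoly"
  assumes "f \<in> carrier (mpoly_ring N)"
  shows "(\<Sum>i<N. mpoly_fun (mpoly_pderiv i f) x * v i) = dir_deriv (mpoly_fun f) x v"
proof -
  obtain es where es: "distinct es" "set es = Poly_Mapping.keys f"
    and F: "mpoly_fun f = eval_terms N (map (\<lambda>e. (Poly_Mapping.lookup f e, Poly_Mapping.lookup e)) es)"
    using eval_terms_of_mpoly[OF assms] .
  define h where "h = (\<lambda>e i. of_nat (Poly_Mapping.lookup e i) * x i ^ (Poly_Mapping.lookup e i - 1) *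
      (\<Prod>j\<in>{..<N} - {i}. x j ^ Poly_Mapping.lookup e j))"
  have m: "of_nat (Poly_Mapping.lookup e i) * Poly_Mapping.lookup f e * mono_eval (e - Poly_Mapping.single i 1) x = Poly_Mapping.lookup f e * h e i"
    if "i < N" "e \<in> Poly_Mapping.keys f" for i e
  proof -
    have l: "Poly_Mapping.lookup (e - Poly_Mapping.single i 1) j = (if j = i then Poly_Mapping.lookup e i - 1 else Poly_Mapping.lookup e j)" for j
      by (simp add: lookup_minus lookup_single when_def)
    have "Poly_Mapping.keys (e - Poly_Mapping.single i 1) \<subseteq> Poly_Mapping.keys e"
      by (auto simp: in_keys_iff lookup_minus)
    also have "\<dots> \<subseteq> {..<N}" using assms that unfolding mem_mpoly_ring by blast
    finally have sub: "Poly_Mapping.keys (e - Poly_Mapping.single i 1) \<subseteq> {..<N}" .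
    have "mono_eval (e - Poly_Mapping.single i 1) x = (\<Prod>j<N. x j ^ (if j = i then Poly_Mapping.lookup e i - 1 else Poly_Mapping.lookup e j))"
      unfolding mono_eval_power_prod[OF sub] power_prod_def l ..
    also have "\<dots> = x i ^ (Poly_Mapping.lookup e i - 1) * (\<Prod>j\<in>{..<N} - {i}. x j ^ Poly_Mapping.lookup e j)"
      using that by (subst prod.remove[of _ i]) (auto intro!: prod.cong)
    finally show ?thesis by (simp add: h_def mult_ac)
  qed
  have "(\<Sum>i<N. mpoly_fun (mpoly_pderiv i f) x * v i) = (\<Sum>i<N. (\<Sum>e\<in>Poly_Mapping.keys f. Poly_Mapping.lookup f e * h e i) * v i)"
    unfolding mpoly_pderiv_def mpoly_fun_sum mpoly_fun_single
    by (intro sum.cong refl arg_cong2[of "sum _ _" "sum _ _" _ _ "(*)"] m) auto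
  also have "\<dots> = (\<Sum>e\<in>Poly_Mapping.keys f. Poly_Mapping.lookup f e * (\<Sum>i<N. h e i * v i))"
    by (simp add: sum_distrib_left sum_distrib_right mult.assoc) (rule sum.swap)
  also have "\<dots> = dir_deriv (mpoly_fun f) x v"
    unfolding F dir_deriv_eval_terms es(2)[symmetric] h_def
    using es(1) by (simp add: sum_list_distinct_conv_sum_set o_def)
  finally show ?thesis .
qed

subsection \<open>Projective notions in terms of polynomial functions\<close>

definition vanishing :: "nat \<Rightarrow> 'k vec set \<Rightarrow> ((nat \<Rightarrow> 'k :: field) \<Rightarrow> 'k) \<Rightarrow> bool" where
  "vanishing N X F \<longleftrightarrow> (\<exists>e. polyfun N {e} F) \<and> (\<forall>x\<in>X. F (\<lambda>i. x $ i) = 0)"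

lemma vanishing_iff_mpoly:
  "vanishing N X F \<longleftrightarrow> (\<exists>f\<in>homogeneous_vanishing N X. mpoly_fun f = F)"
proof
  assume *: "vanishing N X F"
  then obtain e where "polyfun N {e} F" unfolding vanishing_def by blast
  then obtain f where "f \<in> carrier (mpoly_ring N)" "homogeneous_mpoly f" "mpoly_fun f = F"
    using mpoly_of_polyfun by metis
  thus "\<exists>f\<in>homogeneous_vanishing N X. mpoly_fun f = F"
    using * by (auto simp: homogeneous_vanishing_def mpoly_eval_eq vanishing_def)
next
  assume "\<exists>f\<in>homogeneous_vanishing N X. mpoly_fun f = F"
  thus "vanishing N X F" using polyfun_of_mpoly
    by (auto simp: homogeneous_vanishing_def mpoly_eval_eq vanishing_def)
qed

lemma mem_proj_closure:
  "v \<in> proj_closure N X \<longleftrightarrow> v \<in> carrier_vec N \<and> v \<noteq> 0\<^sub>v N \<and> (\<forall>F. vanishing N X F \<longrightarrow> F (\<lambda>i. v $ i) = 0)"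
  unfolding proj_closure_def proj_zeros_def vanishing_iff_mpoly by (auto simp: mpoly_eval_eq)

lemma mem_tangent_space:
  fixes v :: "('k :: field_char_0) vec"
  shows "v \<in> tangent_space N X p \<longleftrightarrow>
    v \<in> carrier_vec N \<and> (\<forall>F. vanishing N X F \<longrightarrow> dir_deriv F (\<lambda>i. p $ i) (\<lambda>i. v $ i) = 0)"
proof -
  have "(\<Sum>i<N. mpoly_eval (mpoly_pderiv i f) p * v $ i) = dir_deriv (mpoly_fun f) (\<lambda>i. p $ i) (\<lambda>i. v $ i)"
    if "f \<in> homogeneous_vanishing N X" for f
    using that mpoly_pderiv_dir_deriv[of f N "\<lambda>i. p $ i" "\<lambda>i. v $ i"]
    by (simp add: homogeneous_vanishing_def mpoly_eval_eq)
  thus ?thesis unfolding tangent_space_def vanishing_iff_mpoly by auto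
qed

definition fun_zeros :: "nat \<Rightarrow> ((nat \<Rightarrow> 'k :: field) \<Rightarrow> 'k) set \<Rightarrow> 'k vec set" where
  "fun_zeros N Fs = {v \<in> carrier_vec N. v \<noteq> 0\<^sub>v N \<and> (\<forall>F\<in>Fs. F (\<lambda>i. v $ i) = 0)}"

lemma proj_closed_iff:
  "proj_closed N Y \<longleftrightarrow> (\<exists>Fs. (\<forall>F\<in>Fs. \<exists>e. polyfun N {e} F) \<and> Y = fun_zeros N Fs)"
proof
  assume "proj_closed N Y"
  then obtain Q where Q: "Q \<subseteq> {f \<in> carrier (mpoly_ring N). homogeneous_mpoly f}" "Y = proj_zeros N Q"
    unfolding proj_closed_def by blast
  show "\<exists>Fs. (\<forall>F\<in>Fs. \<exists>e. polyfun N {e} F) \<and> Y = fun_zeros N Fs"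
    by (rule exI[of _ "mpoly_fun ` Q"])
       (use Q polyfun_of_mpoly in \<open>auto simp: fun_zeros_def proj_zeros_def mpoly_eval_eq\<close>)
next
  assume "\<exists>Fs. (\<forall>F\<in>Fs. \<exists>e. polyfun N {e} F) \<and> Y = fun_zeros N Fs"
  then obtain Fs where Fs: "\<forall>F\<in>Fs. \<exists>e. polyfun N {e} F" "Y = fun_zeros N Fs" by blast
  define Q where "Q = {f \<in> carrier (mpoly_ring N). homogeneous_mpoly f \<and> mpoly_fun f \<in> Fs}"
  have "mpoly_fun ` Q = Fs"
  proof
    show "Fs \<subseteq> mpoly_fun ` Q"
    proof
      fix F assume F: "F \<in> Fs"
      then obtain e where "polyfun N {e} F" using Fs by blast
      then obtain f where "f \<in> carrier (mpoly_ring N)" "homogeneous_mpoly f" "mpoly_fun f = F"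
        using mpoly_of_polyfun by metis
      thus "F \<in> mpoly_fun ` Q" using F unfolding Q_def by blast
    qed
  qed (auto simp: Q_def)
  hence "Y = proj_zeros N Q" unfolding Fs by (auto simp: fun_zeros_def proj_zeros_def mpoly_eval_eq)
  thus "proj_closed N Y" unfolding proj_closed_def by (intro exI[of _ Q]) (auto simp: Q_def)
qed

lemma mpoly_fun_toric_binomial:
  assumes "dim_vec u = N"
  shows "mpoly_fun (toric_binomial u) x = power_prod N (\<lambda>i. nat (u $ i)) x - power_prod N (\<lambda>i. nat (- (u $ i))) x"
proof -
  have "pos_exponent u = (\<Sum>i<N. Poly_Mapping.single i (nat (u $ i)))"
       "pos_exponent (- u) = (\<Sum>i<N. Poly_Mapping.single i (nat (- (u $ i))))"
    using assms by (auto simp: pos_exponent_def)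
  thus ?thesis
    unfolding toric_binomial_def diff_conv_add_uminus mpoly_fun_add mpoly_fun_uminus mpoly_fun_single
    by (simp add: mono_eval_exponent)
qed

lemma toric_binomial_mem_mpoly_ring:
  assumes "dim_vec u = N"
  shows "toric_binomial u \<in> carrier (mpoly_ring N)"
  unfolding toric_binomial_def diff_conv_add_uminus pos_exponent_def
  using assms by (intro add_mem_mpoly_ring uminus_mem_mpoly_ring single_mem_mpoly_ring) (simp_all only: keys_exponent index_uminus_vec)

text \<open>The polynomials vanishing at a given point form an ideal, so a common zero of the
  generators is a zero of the whole ideal.\<close>

lemma proj_zeros_genideal:
  fixes S :: "('k :: field) mpoly set"
  assumes "S \<subseteq> carrier (mpoly_ring N)"
  shows "proj_zeros N (genideal (mpoly_ring N) S) = proj_zeros N S"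
proof
  show "proj_zeros N (genideal (mpoly_ring N) S) \<subseteq> proj_zeros N S"
    unfolding proj_zeros_def genideal_def by auto
  show "proj_zeros N S \<subseteq> proj_zeros N (genideal (mpoly_ring N) S)"
  proof
    fix v assume v: "v \<in> proj_zeros N S"
    define I where "I = {f \<in> carrier (mpoly_ring N). mpoly_eval f v = 0}"
    interpret ring "mpoly_ring N :: 'k mpoly ring" by (rule ring_mpoly_ring)
    have "ideal I (mpoly_ring N :: 'k mpoly ring)"
    proof (rule idealI)
      show "subgroup I (add_monoid (mpoly_ring N))"
      proof (rule group.subgroupI)
        show "group (add_monoid (mpoly_ring N :: 'k mpoly ring))" by (rule a_group)
        show "I \<noteq> {}" unfolding I_def using zero_mem_mpoly_ring[of N] by (auto simp: mpoly_eval_eq)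
        fix f :: "'k mpoly" assume f: "f \<in> I"
        have "\<ominus>\<^bsub>mpoly_ring N\<^esub> f = - f"
          by (rule minus_equality) (use f uminus_mem_mpoly_ring in \<open>auto simp: I_def mpoly_ring_def\<close>)
        thus "inv\<^bsub>add_monoid (mpoly_ring N)\<^esub> f \<in> I"
          using f uminus_mem_mpoly_ring[of f N] unfolding a_inv_def by (auto simp: I_def mpoly_eval_eq mpoly_fun_uminus)
      next
        fix f g :: "'k mpoly" assume "f \<in> I" "g \<in> I"
        thus "f \<otimes>\<^bsub>add_monoid (mpoly_ring N)\<^esub> g \<in> I"
          using add_mem_mpoly_ring[of f N g] by (auto simp: I_def mpoly_ring_def mpoly_eval_eq mpoly_fun_add)
      qed (auto simp: I_def)
    next
      fix f g :: "'k mpoly" assume "f \<in> I" "g \<in> carrier (mpoly_ring N)"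
      thus "g \<otimes>\<^bsub>mpoly_ring N\<^esub> f \<in> I" "f \<otimes>\<^bsub>mpoly_ring N\<^esub> g \<in> I"
        using mult_mem_mpoly_ring[of f N g] mult_mem_mpoly_ring[of g N f]
        by (auto simp: I_def mpoly_ring_def mpoly_eval_eq mpoly_fun_mult)
    qed (rule ring_mpoly_ring)
    moreover have "S \<subseteq> I" using v assms unfolding I_def proj_zeros_def by auto
    ultimately have "genideal (mpoly_ring N) S \<subseteq> I" unfolding genideal_def by blast
    thus "v \<in> proj_zeros N (genideal (mpoly_ring N) S)" using v unfolding I_def proj_zeros_def by auto
  qed
qed

section \<open>The toric variety as the locus where congruent monomials agree\<close>

definition toric_points :: "nat \<Rightarrow> (nat \<Rightarrow> int) list \<Rightarrow> ('k :: field) vec set" where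
  "toric_points N rs = {v \<in> carrier_vec N. v \<noteq> 0\<^sub>v N \<and> (\<lambda>i. v $ i) \<in> toric_cone N rs}"

lemma row_kernel_cong: "(\<And>i. i < N \<Longrightarrow> u i = u' i) \<Longrightarrow> row_kernel N rs u = row_kernel N rs u'"
  by (simp add: row_kernel_def)

lemma toric_variety_eq_points:
  assumes "dim_col A = N" "\<And>u. u \<in> carrier_vec N \<Longrightarrow> u \<in> mat_kernel A \<longleftrightarrow> row_kernel N rs (\<lambda>i. u $ i)"
  shows "toric_variety A = (toric_points N rs :: ('k :: field) vec set)"
proof -
  have dim: "u \<in> carrier_vec N" if "u \<in> mat_kernel A" for u
    using that assms(1) unfolding mat_kernel_def by simp
  have "toric_variety A = proj_zeros N (toric_binomial ` mat_kernel A :: 'k mpoly set)"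
    unfolding toric_variety_def toric_ideal_def assms(1)
    by (rule proj_zeros_genideal) (auto intro!: toric_binomial_mem_mpoly_ring dest!: dim)
  also have "\<dots> = toric_points N rs"
  proof (intro equalityI subsetI)
    fix v :: "'k vec" assume v: "v \<in> toric_points N rs"
    have "mpoly_eval (toric_binomial u) v = 0" if u: "u \<in> mat_kernel A" for u
    proof -
      have "row_kernel N rs (exp_diff (\<lambda>i. nat (u $ i)) (\<lambda>i. nat (- (u $ i))))"
        using u assms(2)[OF dim[OF u]] by (subst row_kernel_cong[of N _ "\<lambda>i. u $ i"]) (auto simp: exp_diff_def)
      thus ?thesis using v dim[OF u] unfolding toric_points_def toric_cone_def mpoly_eval_eq
        by (auto simp: mpoly_fun_toric_binomial[of u N])
    qed
    thus "v \<in> proj_zeros N (toric_binomial ` mat_kernel A)"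
      using v unfolding proj_zeros_def toric_points_def by auto
  next
    fix v :: "'k vec" assume v: "v \<in> proj_zeros N (toric_binomial ` mat_kernel A)"
    have "power_prod N b (\<lambda>i. v $ i) = power_prod N b' (\<lambda>i. v $ i)" if *: "row_kernel N rs (exp_diff b b')" for b b'
    proof -
      define u where "u = vec N (exp_diff b b')"
      have u: "u \<in> carrier_vec N" "dim_vec u = N" by (auto simp: u_def)
      have "row_kernel N rs (\<lambda>i. u $ i)" using * by (subst row_kernel_cong[of N _ "exp_diff b b'"]) (auto simp: u_def)
      hence "u \<in> mat_kernel A" using assms(2) u by blast
      hence "mpoly_eval (toric_binomial u) v = 0" using v unfolding proj_zeros_def by blast
      hence eq: "power_prod N (\<lambda>i. nat (u $ i)) (\<lambda>i. v $ i) = power_prod N (\<lambda>i. nat (- (u $ i))) (\<lambda>i. v $ i)"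
        unfolding mpoly_eval_eq by (simp add: mpoly_fun_toric_binomial u)
      \<comment> \<open>The common part \<open>min (b i) (b' i)\<close> is factored out; what
        remains are the positive and negative parts of the difference \<open>u\<close>, whose
        binomial is one of the generators.\<close>
      have "power_prod N b x = power_prod N (\<lambda>i. min (b i) (b' i)) x * power_prod N (\<lambda>i. nat (u $ i)) x"
        "power_prod N b' x = power_prod N (\<lambda>i. min (b i) (b' i)) x * power_prod N (\<lambda>i. nat (- (u $ i))) x" for x :: "nat \<Rightarrow> 'k"
        unfolding power_prod_add[symmetric] unfolding power_prod_def
        by (rule prod.cong, simp, rule arg_cong[of _ _ "\<lambda>n. _ ^ n"], simp add: u_def exp_diff_def)+
      thus ?thesis using eq by simp
    qed
    thus "v \<in> toric_points N rs" using v unfolding toric_points_def toric_cone_def proj_zeros_def by auto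
  qed
  finally show ?thesis .
qed

subsection \<open>Linear algebra\<close>

text \<open>Gaussian elimination on the equations indexed by \<open>J\<close>: a pivot
  \<open>p\<close> solves equation \<open>j\<close>, and the remaining unknowns satisfy the reduced
  equations.\<close>

lemma exists_nontrivial_relation:
  fixes g :: "'i \<Rightarrow> 'j \<Rightarrow> 'k :: field"
  assumes "finite J" "finite I" "card J < card I"
  shows "\<exists>c. (\<exists>i\<in>I. c i \<noteq> 0) \<and> (\<forall>j\<in>J. (\<Sum>i\<in>I. c i * g i j) = 0)"
  using assms
proof (induction J arbitrary: I g rule: finite_induct)
  case empty
  then obtain i where "i \<in> I" by (metis card.empty ex_in_conv less_numeral_extra(3))
  thus ?case by (intro exI[of _ "\<lambda>_. 1"]) auto
next
  case (insert j J)
  show ?case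
  proof (cases "\<forall>i\<in>I. g i j = 0")
    case True
    have "card J < card I" using insert by simp
    then obtain c where "\<exists>i\<in>I. c i \<noteq> 0" "\<forall>j\<in>J. (\<Sum>i\<in>I. c i * g i j) = 0"
      using insert.IH[OF insert.prems(1)] by blast
    thus ?thesis using True by (intro exI[of _ c]) auto
  next
    case False
    then obtain p where p: "p \<in> I" "g p j \<noteq> 0" by blast
    define I' where "I' = I - {p}"
    have I': "finite I'" "p \<notin> I'" "I = insert p I'" using p insert.prems by (auto simp: I'_def)
    have "card J < card I'" using insert I' by simp
    from insert.IH[OF I'(1) this, of "\<lambda>i j'. g i j' - g i j / g p j * g p j'"]
    obtain c where c: "\<exists>i\<in>I'. c i \<noteq> 0" "\<forall>j'\<in>J. (\<Sum>i\<in>I'. c i * (g i j' - g i j / g p j * g p j')) = 0"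
      by blast
    define c' where "c' = c(p := - (\<Sum>i\<in>I'. c i * g i j) / g p j)"
    have sum: "(\<Sum>i\<in>I. c' i * g i j') = (\<Sum>i\<in>I'. c i * g i j') - (\<Sum>i\<in>I'. c i * g i j) / g p j * g p j'" for j'
    proof -
      have "(\<Sum>i\<in>I'. c' i * g i j') = (\<Sum>i\<in>I'. c i * g i j')"
        by (rule sum.cong) (use I' in \<open>auto simp: c'_def\<close>)
      thus ?thesis using I' by (simp add: c'_def)
    qed
    have "(\<Sum>i\<in>I. c' i * g i j') = 0" if "j' \<in> J" for j'
    proof -
      have "(\<Sum>i\<in>I'. c i * (g i j / g p j * g p j')) = (\<Sum>i\<in>I'. c i * g i j) / g p j * g p j'"
        by (simp add: sum_divide_distrib sum_distrib_right mult.assoc)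
      thus ?thesis using c(2)[rule_format, OF that] unfolding sum
        by (simp only: right_diff_distrib sum_subtractf)
    qed
    moreover have "(\<Sum>i\<in>I. c' i * g i j) = 0" unfolding sum using p by simp
    moreover have "\<exists>i\<in>I. c' i \<noteq> 0" using c(1) I' by (auto simp: c'_def)
    ultimately show ?thesis by blast
  qed
qed

text \<open>The Steinitz bound for families of functions on \<open>X\<close>, without forming a
  vector space; it serves for coordinate vectors as well as for polynomial functions on a
  variety.\<close>

lemma family_card_le:
  fixes a :: "'i \<Rightarrow> 'x \<Rightarrow> 'k :: field"
  assumes "finite I" "finite J"
    and comb: "\<And>i. i \<in> I \<Longrightarrow> \<exists>g. \<forall>x\<in>X. a i x = (\<Sum>j\<in>J. g j * b j x)"
    and indep: "\<And>c. (\<And>x. x \<in> X \<Longrightarrow> (\<Sum>i\<in>I. c i * a i x) = 0) \<Longrightarrow> \<forall>i\<in>I. c i = 0"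
  shows "card I \<le> card J"
proof (rule ccontr)
  assume "\<not> card I \<le> card J"
  obtain g where g: "\<And>i x. i \<in> I \<Longrightarrow> x \<in> X \<Longrightarrow> a i x = (\<Sum>j\<in>J. g i j * b j x)"
    using comb by metis
  from exists_nontrivial_relation[OF assms(2,1), of g] \<open>\<not> card I \<le> card J\<close>
  obtain c where c: "\<exists>i\<in>I. c i \<noteq> 0" "\<forall>j\<in>J. (\<Sum>i\<in>I. c i * g i j) = 0" by auto
  have "(\<Sum>i\<in>I. c i * a i x) = 0" if "x \<in> X" for x
  proof -
    have "(\<Sum>i\<in>I. c i * a i x) = (\<Sum>i\<in>I. \<Sum>j\<in>J. c i * g i j * b j x)"
      by (rule sum.cong) (simp_all add: g that sum_distrib_left mult.assoc)
    also have "\<dots> = (\<Sum>j\<in>J. (\<Sum>i\<in>I. c i * g i j) * b j x)"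
      by (subst sum.swap) (simp add: sum_distrib_right)
    finally show ?thesis using c(2) by simp
  qed
  with indep c(1) show False by blast
qed

text \<open>Otherwise adjoining \<open>w\<close> to the family \<open>a\<close>, under the index
  \<open>None\<close>, would give an independent family with more members than \<open>J\<close>
  has.\<close>

lemma family_spans:
  fixes a :: "'i \<Rightarrow> 'x \<Rightarrow> 'k :: field"
  assumes "finite I" "finite J" "card J \<le> card I"
    and comb: "\<And>i. i \<in> I \<Longrightarrow> \<exists>g. \<forall>x\<in>X. a i x = (\<Sum>j\<in>J. g j * b j x)"
    and indep: "\<And>c. (\<And>x. x \<in> X \<Longrightarrow> (\<Sum>i\<in>I. c i * a i x) = 0) \<Longrightarrow> \<forall>i\<in>I. c i = 0"
    and w: "\<exists>g. \<forall>x\<in>X. w x = (\<Sum>j\<in>J. g j * b j x)"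
  shows "\<exists>c. \<forall>x\<in>X. w x = (\<Sum>i\<in>I. c i * a i x)"
proof (rule ccontr)
  assume no: "\<not> ?thesis"
  define I' where "I' = insert None (Some ` I)"
  define a' where "a' = (\<lambda>i. case i of None \<Rightarrow> w | Some i \<Rightarrow> a i)"
  have fin: "finite I'" using assms(1) by (simp add: I'_def)
  have sum: "(\<Sum>i\<in>I'. c i * a' i x) = c None * w x + (\<Sum>i\<in>I. c (Some i) * a i x)" for c x
    unfolding I'_def using assms(1) by (subst sum.insert) (auto simp: a'_def sum.reindex)
  have "card I' \<le> card J"
  proof (rule family_card_le[where a = a' and X = X and b = b])
    fix i assume "i \<in> I'"
    thus "\<exists>g. \<forall>x\<in>X. a' i x = (\<Sum>j\<in>J. g j * b j x)"
      using comb w by (auto simp: I'_def a'_def)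
  next
    fix c assume rel: "\<And>x. x \<in> X \<Longrightarrow> (\<Sum>i\<in>I'. c i * a' i x) = 0"
    have None: "c None = 0"
    proof (rule ccontr)
      assume nz: "c None \<noteq> 0"
      have "w x = (\<Sum>i\<in>I. - c (Some i) / c None * a i x)" if "x \<in> X" for x
      proof -
        have "c None * w x = - (\<Sum>i\<in>I. c (Some i) * a i x)" using rel[OF that] unfolding sum by (simp add: eq_neg_iff_add_eq_0)
        hence "w x = - (\<Sum>i\<in>I. c (Some i) * a i x) / c None" using nz by (simp add: field_simps)
        thus ?thesis by (simp add: sum_negf sum_divide_distrib)
      qed
      hence "\<exists>c. \<forall>x\<in>X. w x = (\<Sum>i\<in>I. c i * a i x)"
        by (intro exI[of _ "\<lambda>i. - c (Some i) / c None"]) auto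
      with no show False by (rule notE)
    qed
    hence "\<forall>i\<in>I. c (Some i) = 0" using rel by (intro indep) (auto simp: sum)
    thus "\<forall>i\<in>I'. c i = 0" using None by (auto simp: I'_def)
  qed (use fin assms in auto)
  moreover have "card I' = Suc (card I)" unfolding I'_def using assms(1)
    by (subst card_insert_disjoint) (auto simp: card_image)
  ultimately show False using assms(3) by simp
qed

text \<open>Finite-dimensional duality by elimination of the last coordinate: if some
  \<open>p\<close> in \<open>S\<close> has a nonzero entry there, every vector is reduced by a
  multiple of \<open>p\<close>. \<open>S\<close> may be infinite, as for the gradients of all
  equations of a variety, hence the list \<open>ts\<close>.\<close>

lemma double_annihilator:
  fixes S :: "(nat \<Rightarrow> 'k :: field) set"
  assumes "\<And>v. (\<And>s. s \<in> S \<Longrightarrow> (\<Sum>i<N. s i * v i) = 0) \<Longrightarrow> (\<Sum>i<N. h i * v i) = 0"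
  shows "\<exists>ts. snd ` set ts \<subseteq> S \<and> (\<forall>i<N. h i = (\<Sum>(c, s)\<leftarrow>ts. c * s i))"
  using assms
proof (induction N arbitrary: S h)
  case 0
  show ?case by (rule exI[of _ "[]"]) auto
next
  case (Suc N)
  show ?case
  proof (cases "\<forall>s\<in>S. s N = 0")
    case True
    have "h N = 0"
      using Suc.prems[of "\<lambda>i. if i = N then 1 else 0"] True by (simp add: sum.delta')
    have "\<exists>ts. snd ` set ts \<subseteq> S \<and> (\<forall>i<N. h i = (\<Sum>(c, s)\<leftarrow>ts. c * s i))"
    proof (rule Suc.IH)
      fix v assume "\<And>s. s \<in> S \<Longrightarrow> (\<Sum>i<N. s i * v i) = 0"
      thus "(\<Sum>i<N. h i * v i) = 0" using Suc.prems[of v] True \<open>h N = 0\<close> by simp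
    qed
    then obtain ts where ts: "snd ` set ts \<subseteq> S" "\<forall>i<N. h i = (\<Sum>(c, s)\<leftarrow>ts. c * s i)" by blast
    have "(\<Sum>(c, s)\<leftarrow>ts. c * s N) = 0"
      using ts(1) True by (induction ts) auto
    thus ?thesis using ts \<open>h N = 0\<close> by (intro exI[of _ ts]) (auto simp: less_Suc_eq)
  next
    case False
    then obtain p where p: "p \<in> S" "p N \<noteq> 0" by blast
    define red where "red = (\<lambda>s i. s i - s N / p N * p i)"
    have "\<exists>ts. snd ` set ts \<subseteq> red ` S \<and> (\<forall>i<N. red h i = (\<Sum>(c, s)\<leftarrow>ts. c * s i))"
    proof (rule Suc.IH)
      fix v assume v: "\<And>s. s \<in> red ` S \<Longrightarrow> (\<Sum>i<N. s i * v i) = 0"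
      define v' where "v' = v(N := - (\<Sum>i<N. p i * v i) / p N)"
      have eq: "(\<Sum>i<Suc N. s i * v' i) = (\<Sum>i<N. red s i * v i)" for s
      proof -
        have "(\<Sum>i<N. s i * v' i) = (\<Sum>i<N. s i * v i)" by (rule sum.cong) (auto simp: v'_def)
        thus ?thesis using p(2)
          by (simp add: red_def v'_def left_diff_distrib sum_subtractf sum_distrib_left sum_divide_distrib mult.assoc)
      qed
      show "(\<Sum>i<N. red h i * v i) = 0"
        using Suc.prems[of v'] v unfolding eq by blast
    qed
    then obtain ts where ts: "snd ` set ts \<subseteq> red ` S" "\<forall>i<N. red h i = (\<Sum>(c, s)\<leftarrow>ts. c * s i)" by blast
    have "\<forall>m\<in>set ts. \<exists>s\<in>S. snd m = red s" using ts(1) by auto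
    then obtain f where f: "\<And>m. m \<in> set ts \<Longrightarrow> f m \<in> S \<and> snd m = red (f m)" by metis
    define ts' where "ts' = map (\<lambda>m. (fst m, f m)) ts"
    define k where "k = h N / p N - (\<Sum>m\<leftarrow>ts. fst m * (f m N / p N))"
    have split: "(\<Sum>m\<leftarrow>ts. fst m * snd m i) = (\<Sum>m\<leftarrow>ts. fst m * f m i) - (\<Sum>m\<leftarrow>ts. fst m * (f m N / p N)) * p i" for i
    proof -
      have "(\<Sum>m\<leftarrow>ts. fst m * snd m i) = (\<Sum>m\<leftarrow>ts. fst m * f m i - fst m * (f m N / p N) * p i)"
        by (rule arg_cong[of _ _ sum_list], rule map_cong) (use f in \<open>auto simp: red_def right_diff_distrib\<close>)
      thus ?thesis by (simp only: sum_list_subtractf sum_list_mult_const)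
    qed
    have "h i = (\<Sum>(c, s)\<leftarrow>(k, p) # ts'. c * s i)" if "i < Suc N" for i
    proof (cases "i = N")
      case True
      have "(\<Sum>m\<leftarrow>ts. fst m * (f m N / p N)) = (\<Sum>m\<leftarrow>ts. fst m * f m N) / p N"
        by (induction ts) (auto simp: add_divide_distrib)
      thus ?thesis using True p(2) by (simp add: ts'_def k_def case_prod_unfold o_def field_simps)
    next
      case False
      hence "red h i = (\<Sum>m\<leftarrow>ts. fst m * snd m i)" using ts(2) that by (simp add: case_prod_unfold)
      thus ?thesis unfolding split by (simp add: ts'_def k_def case_prod_unfold o_def red_def algebra_simps)
    qed
    moreover have "snd ` set ((k, p) # ts') \<subseteq> S" using p f by (auto simp: ts'_def)
    ultimately show ?thesis by blast
  qed
qed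

lemma common_denominator:
  fixes q :: "nat \<Rightarrow> rat"
  obtains n :: int and u :: "nat \<Rightarrow> int" where "n > 0" "\<And>i. i < N \<Longrightarrow> of_int n * q i = of_int (u i)"
proof (induction N arbitrary: thesis)
  case 0
  show ?case by (rule "0.prems"[of 1 "\<lambda>_. 0"]) auto
next
  case (Suc N)
  obtain n u where nu: "n > 0" "\<And>i. i < N \<Longrightarrow> of_int n * q i = of_int (u i)" using Suc.IH by blast
  obtain a b where ab: "b > 0" "q N = of_int a / of_int b"
    using quotient_of_denom_pos'[of "q N"] quotient_of_div[of "q N" "fst (quotient_of (q N))" "snd (quotient_of (q N))"] by auto
  show ?case
  proof (rule Suc.prems[of "n * b" "\<lambda>i. if i = N then n * a else b * u i"])
    fix i assume "i < Suc N"
    thus "of_int (n * b) * q i = of_int (if i = N then n * a else b * u i)"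
      using nu(2)[of i] ab by (auto simp: less_Suc_eq mult.assoc mult.commute[of _ "of_int b"] mult.left_commute)
  qed (use nu ab in auto)
qed

text \<open>A solution over the field is a combination of integer solutions: expand its
  coordinates in a basis of the field over the rationals.\<close>

lemma kernel_perp_field:
  fixes x w :: "nat \<Rightarrow> 'k :: field_char_0"
  assumes x: "\<And>r. r \<in> set rs \<Longrightarrow> (\<Sum>i<N. of_int (r i) * x i) = 0" and w: "w \<in> kernel_perp N rs"
  shows "(\<Sum>i<N. w i * x i) = 0"
proof -
  interpret Q: vector_space "\<lambda>q (y :: 'k). of_rat q * y"
    by (rule vector_space.intro) (rule distrib_left, simp_all only: distrib_right of_rat_add of_rat_mult mult.assoc of_rat_1 mult_1_left)
  obtain B where B: "Q.independent B" "UNIV \<subseteq> Q.span B"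
    using Q.maximal_independent_subset[of UNIV] by blast
  define \<rho> where "\<rho> = (\<lambda>i. Q.representation B (x i))"
  define K0 where "K0 = (\<Union>i<N. {\<kappa>. \<rho> i \<kappa> \<noteq> 0})"
  have fin: "finite K0" unfolding K0_def \<rho>_def by (auto intro: Q.finite_representation)
  have in_span: "y \<in> Q.span B" for y using B by auto
  have xi: "x i = (\<Sum>\<kappa>\<in>K0. of_rat (\<rho> i \<kappa>) * \<kappa>)" if "i < N" for i
  proof -
    have "x i = (\<Sum>\<kappa> | \<rho> i \<kappa> \<noteq> 0. of_rat (\<rho> i \<kappa>) * \<kappa>)"
      unfolding \<rho>_def using Q.sum_nonzero_representation_eq[OF B(1) in_span] by simp
    also have "\<dots> = (\<Sum>\<kappa>\<in>K0. of_rat (\<rho> i \<kappa>) * \<kappa>)"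
      by (rule sum.mono_neutral_left) (use fin that in \<open>auto simp: K0_def\<close>)
    finally show ?thesis .
  qed
  have \<rho>_ker: "(\<Sum>i<N. of_int (r i) * \<rho> i \<kappa>) = 0" if "r \<in> set rs" for r \<kappa>
  proof -
    have "Q.representation B (\<Sum>i<N. of_rat (of_int (r i)) * x i) \<kappa> = (\<Sum>i<N. of_int (r i) * \<rho> i \<kappa>)"
      using B(1) in_span
      by (simp add: Q.representation_sum Q.representation_scale \<rho>_def del: of_rat_of_int_eq)
    thus ?thesis using x[OF that] by (simp add: Q.representation_zero)
  qed
  \<comment> \<open>For each basis element the coordinates form a rational solution of the rows;
    clearing denominators gives an integer kernel vector, to which the hypothesis on
    \<open>w\<close> applies.\<close>
  have "(\<Sum>i<N. w i * of_rat (\<rho> i \<kappa>)) = 0" for \<kappa>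
  proof -
    obtain n u where nu: "n > 0" "\<And>i. i < N \<Longrightarrow> of_int n * \<rho> i \<kappa> = of_int (u i)"
      using common_denominator[of N "\<lambda>i. \<rho> i \<kappa>"] by blast
    have "row_kernel N rs u" unfolding row_kernel_def
    proof
      fix r assume r: "r \<in> set rs"
      have "rat_of_int (\<Sum>i<N. r i * u i) = (\<Sum>i<N. of_int (r i) * (of_int n * \<rho> i \<kappa>))"
        using nu(2) by simp
      also have "\<dots> = of_int n * (\<Sum>i<N. of_int (r i) * \<rho> i \<kappa>)" by (simp add: sum_distrib_left mult_ac)
      finally have "rat_of_int (\<Sum>i<N. r i * u i) = 0" using \<rho>_ker[OF r] by simp
      thus "(\<Sum>i<N. r i * u i) = 0" by (simp only: of_int_eq_0_iff)
    qed
    hence "0 = (\<Sum>i<N. of_int (u i) * w i)" using w unfolding kernel_perp_def by simp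
    also have "\<dots> = (\<Sum>i<N. of_int n * (w i * of_rat (\<rho> i \<kappa>)))"
    proof (rule sum.cong)
      fix i assume "i \<in> {..<N}"
      hence "(of_int (u i) :: 'k) = of_rat (of_int n * \<rho> i \<kappa>)" using nu(2)[of i] by simp
      thus "of_int (u i) * w i = of_int n * (w i * of_rat (\<rho> i \<kappa>))" by (simp add: of_rat_mult)
    qed simp
    also have "\<dots> = of_int n * (\<Sum>i<N. w i * of_rat (\<rho> i \<kappa>))" by (simp add: sum_distrib_left)
    finally show ?thesis using nu(1) by simp
  qed
  hence "0 = (\<Sum>\<kappa>\<in>K0. (\<Sum>i<N. w i * of_rat (\<rho> i \<kappa>)) * \<kappa>)" by simp
  also have "\<dots> = (\<Sum>i<N. \<Sum>\<kappa>\<in>K0. w i * of_rat (\<rho> i \<kappa>) * \<kappa>)"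
    unfolding sum_distrib_right by (rule sum.swap)
  also have "\<dots> = (\<Sum>i<N. w i * x i)" by (rule sum.cong) (auto simp: xi sum_distrib_left mult_ac)
  finally show ?thesis by simp
qed

text \<open>The direction that needs work is duality for the rows. Duality tests against solutions
  over the field, while \<open>kernel_perp\<close> only knows integer ones;
  \<open>kernel_perp_field\<close> bridges the two.\<close>

lemma kernel_perp_eq_row_span:
  fixes v :: "nat \<Rightarrow> 'k :: field_char_0"
  shows "v \<in> kernel_perp N rs \<longleftrightarrow> (\<exists>c. \<forall>i<N. v i = (\<Sum>k<length rs. c k * of_int ((rs ! k) i)))"
proof
  assume v: "v \<in> kernel_perp N rs"
  have "\<exists>ts. snd ` set ts \<subseteq> (\<lambda>r i. of_int (r i) :: 'k) ` set rs \<and> (\<forall>i<N. v i = (\<Sum>(c, s)\<leftarrow>ts. c * s i))"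
  proof (rule double_annihilator)
    fix x :: "nat \<Rightarrow> 'k"
    assume x: "\<And>s. s \<in> (\<lambda>r i. of_int (r i)) ` set rs \<Longrightarrow> (\<Sum>i<N. s i * x i) = 0"
    show "(\<Sum>i<N. v i * x i) = 0" by (rule kernel_perp_field[OF _ v]) (rule x, rule imageI)
  qed
  then obtain ts where ts: "snd ` set ts \<subseteq> (\<lambda>r i. of_int (r i) :: 'k) ` set rs" "\<forall>i<N. v i = (\<Sum>(c, s)\<leftarrow>ts. c * s i)" by blast
  have "\<exists>c. \<forall>i. (\<Sum>(c, s)\<leftarrow>ts. c * s i) = (\<Sum>k<length rs. c k * of_int ((rs ! k) i))"
    using ts(1)
  proof (induction ts)
    case Nil
    show ?case by (rule exI[of _ "\<lambda>_. 0"]) simp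
  next
    case (Cons m ts)
    then obtain c where c: "\<And>i. (\<Sum>(c, s)\<leftarrow>ts. c * s i) = (\<Sum>k<length rs. c k * of_int ((rs ! k) i))" by auto
    obtain k where k: "k < length rs" "snd m = (\<lambda>i. of_int ((rs ! k) i))"
      using Cons.prems by (auto simp: in_set_conv_nth)
    have "(\<Sum>k'<length rs. (if k' = k then fst m else 0) * of_int ((rs ! k') i)) = fst m * snd m i" for i
      using k by (simp add: if_distrib[of "\<lambda>x. x * _"] sum.delta cong: if_cong)
    thus ?case using c
      by (intro exI[of _ "\<lambda>k'. (if k' = k then fst m else 0) + c k'"])
         (simp add: case_prod_unfold distrib_right sum.distrib)
  qed
  then obtain c where "\<forall>i. (\<Sum>(c, s)\<leftarrow>ts. c * s i) = (\<Sum>k<length rs. c k * of_int ((rs ! k) i))" by blast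
  thus "\<exists>c. \<forall>i<N. v i = (\<Sum>k<length rs. c k * of_int ((rs ! k) i))"
    using ts(2) by (intro exI[of _ c]) simp
next
  assume "\<exists>c. \<forall>i<N. v i = (\<Sum>k<length rs. c k * of_int ((rs ! k) i))"
  then obtain c where c: "\<And>i. i < N \<Longrightarrow> v i = (\<Sum>k<length rs. c k * of_int ((rs ! k) i))" by blast
  have "(\<Sum>i<N. of_int (u i) * v i) = 0" if u: "row_kernel N rs u" for u
  proof -
    have "(\<Sum>i<N. of_int (u i) * v i) = (\<Sum>i<N. \<Sum>k<length rs. c k * of_int ((rs ! k) i * u i))"
      by (rule sum.cong) (auto simp: c sum_distrib_left mult_ac)
    also have "\<dots> = (\<Sum>k<length rs. c k * of_int (\<Sum>i<N. (rs ! k) i * u i))"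
      by (subst sum.swap) (simp add: sum_distrib_left)
    also have "\<dots> = 0" using u by (auto simp: row_kernel_def)
    finally show ?thesis .
  qed
  thus "v \<in> kernel_perp N rs" unfolding kernel_perp_def by blast
qed

lemma row_in_kernel_perp: "r \<in> set rs \<Longrightarrow> (\<lambda>i. of_int (r i)) \<in> kernel_perp N rs"
  unfolding kernel_perp_def row_kernel_def
  by (auto simp flip: of_int_mult of_int_sum simp: mult.commute)

definition independent_rows :: "'k :: field_char_0 itself \<Rightarrow> nat \<Rightarrow> (nat \<Rightarrow> int) list \<Rightarrow> bool" where
  "independent_rows _ N rs \<longleftrightarrow> (\<forall>c :: nat \<Rightarrow> 'k.
     (\<forall>i<N. (\<Sum>k<length rs. c k * of_int ((rs ! k) i)) = 0) \<longrightarrow> (\<forall>k<length rs. c k = 0))"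

subsection \<open>Tangent spaces at points of the torus\<close>

lemma torus_point:
  assumes "N > 0" "t \<in> torus N rs"
  shows "vec N t \<in> toric_points N rs"
proof -
  have "power_prod N b (\<lambda>i. vec N t $ i) = power_prod N b t" for b by (rule power_prod_cong) simp
  moreover have "vec N t \<noteq> 0\<^sub>v N"
  proof
    assume "vec N t = 0\<^sub>v N"
    hence "vec N t $ 0 = 0" using assms by simp
    thus False using assms by (auto simp: torus_def)
  qed
  ultimately show ?thesis using assms by (auto simp: toric_points_def torus_def toric_cone_def)
qed

lemma vanishing_toric_points:
  assumes "N > 0" "vanishing N (toric_points N rs) F" "t \<in> torus N rs"
  shows "F t = 0"
proof -
  obtain e where e: "polyfun N {e} F" using assms unfolding vanishing_def by blast
  have "F t = F (\<lambda>i. vec N t $ i)" by (rule polyfun_cong[OF e]) simp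
  thus ?thesis using assms(2) torus_point[OF assms(1,3)] unfolding vanishing_def by simp
qed

text \<open>The row of ones forces the entries of \<open>u\<close> to sum to zero, so the two
  monomials have the same degree.\<close>

lemma binomial_vanishing:
  fixes rs :: "(nat \<Rightarrow> int) list"
  assumes "(\<lambda>_. 1) \<in> set rs" "row_kernel N rs u"
  defines "ms \<equiv> [(1 :: 'k :: field, \<lambda>i. nat (u i)), (-1, \<lambda>i. nat (- u i))]"
  shows "vanishing N (toric_points N rs) (eval_terms N ms)"
    and "\<exists>e. polyfun N {e} (eval_terms N ms)"
proof -
  have "(\<Sum>i<N. u i) = 0" using assms unfolding row_kernel_def by fastforce
  have "int (\<Sum>i<N. nat (u i)) - int (\<Sum>i<N. nat (- u i)) = (\<Sum>i<N. u i)"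
    unfolding of_nat_sum sum_subtractf[symmetric] by (rule sum.cong) auto
  hence "int (\<Sum>i<N. nat (u i)) = int (\<Sum>i<N. nat (- u i))" using \<open>(\<Sum>i<N. u i) = 0\<close> by linarith
  hence "(\<Sum>i<N. nat (u i)) = (\<Sum>i<N. nat (- u i))" by (simp only: of_nat_eq_iff)
  thus 1: "\<exists>e. polyfun N {e} (eval_terms N ms)"
    unfolding polyfun_def by (intro exI[of _ "\<Sum>i<N. nat (u i)"] exI[of _ ms]) (auto simp: ms_def)
  have "row_kernel N rs (exp_diff (\<lambda>i. nat (u i)) (\<lambda>i. nat (- u i)))"
    using assms by (subst row_kernel_cong[of N _ u]) (auto simp: exp_diff_def)
  thus "vanishing N (toric_points N rs) (eval_terms N ms)"
    using 1 unfolding vanishing_def toric_points_def toric_cone_def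
    by (auto simp: eval_terms_def ms_def)
qed

text \<open>Division by the coordinates of \<open>p\<close> turns tangent vectors into elements of
  the row span: one inclusion is \<open>torus_tangent\<close>, the other comes from the logarithmic
  derivative of the binomial of each kernel vector.\<close>

lemma tangent_space_torus:
  fixes p :: "('k :: field_char_0) vec"
  assumes "N > 0" "(\<lambda>_. 1) \<in> set rs" "p \<in> carrier_vec N" "(\<lambda>i. p $ i) \<in> torus N rs"
  shows "tangent_space N (toric_points N rs) p = {v \<in> carrier_vec N. (\<lambda>i. v $ i / p $ i) \<in> kernel_perp N rs}"
proof (intro equalityI subsetI CollectI conjI)
  fix v assume v: "v \<in> {v \<in> carrier_vec N. (\<lambda>i. v $ i / p $ i) \<in> kernel_perp N rs}"
  have nz: "p $ i \<noteq> 0" if "i < N" for i using assms(4) that by (auto simp: torus_def)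
  have "dir_deriv F (\<lambda>i. p $ i) (\<lambda>i. v $ i) = 0" if F: "vanishing N (toric_points N rs) F" for F
  proof -
    obtain e where e: "polyfun N {e} F" using F unfolding vanishing_def by blast
    have "dir_deriv F (\<lambda>i. p $ i) (\<lambda>i. v $ i) = dir_deriv F (\<lambda>i. p $ i) (\<lambda>i. p $ i * (v $ i / p $ i))"
      by (rule dir_deriv_cong[OF e]) (use nz in auto)
    also have "\<dots> = 0"
      by (rule torus_tangent[OF assms(2) e _ assms(4)]) (use v vanishing_toric_points[OF assms(1) F] in auto)
    finally show ?thesis .
  qed
  thus "v \<in> tangent_space N (toric_points N rs) p" using v unfolding mem_tangent_space by auto
next
  fix v assume v: "v \<in> tangent_space N (toric_points N rs) p"
  thus "v \<in> carrier_vec N" by (simp add: mem_tangent_space)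
  have nz: "p $ i \<noteq> 0" if "i < N" for i using assms(4) that by (auto simp: torus_def)
  show "(\<lambda>i. v $ i / p $ i) \<in> kernel_perp N rs" unfolding kernel_perp_def
  proof (intro CollectI allI impI)
    fix u assume u: "row_kernel N rs u"
    define b b' where "b = (\<lambda>i. nat (u i))" and "b' = (\<lambda>i. nat (- u i))"
    define F where "F = eval_terms N [(1 :: 'k, b), (-1, b')]"
    have van: "vanishing N (toric_points N rs) F" and e: "\<exists>e. polyfun N {e} F"
      using binomial_vanishing[OF assms(2) u, where 'k = 'k] unfolding F_def b_def b'_def by auto
    have "row_kernel N rs (exp_diff b b')"
      using u by (subst row_kernel_cong[of N _ u]) (auto simp: exp_diff_def b_def b'_def)
    hence eq: "power_prod N b (\<lambda>i. p $ i) = power_prod N b' (\<lambda>i. p $ i)"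
      using assms(4) by (auto simp: torus_def toric_cone_def)
    have "0 = dir_deriv F (\<lambda>i. p $ i) (\<lambda>i. v $ i)" using v van by (simp add: mem_tangent_space)
    also have "\<dots> = dir_deriv F (\<lambda>i. p $ i) (\<lambda>i. p $ i * (v $ i / p $ i))"
    proof -
      obtain e' where "polyfun N {e'} F" using e by blast
      thus ?thesis by (rule dir_deriv_cong) (use nz in auto)
    qed
    also have "\<dots> = power_prod N b (\<lambda>i. p $ i) * ((\<Sum>i<N. of_nat (b i) * (v $ i / p $ i)) - (\<Sum>i<N. of_nat (b' i) * (v $ i / p $ i)))"
      unfolding F_def by (subst dir_deriv_eval_terms_torus) (use nz in \<open>auto simp: eq right_diff_distrib\<close>)
    also have "(\<Sum>i<N. of_nat (b i) * (v $ i / p $ i)) - (\<Sum>i<N. of_nat (b' i) * (v $ i / p $ i))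
        = (\<Sum>i<N. of_int (u i) * (v $ i / p $ i))"
      unfolding sum_subtractf[symmetric]
    proof (rule sum.cong)
      fix i
      have "(of_nat (b i) - of_nat (b' i) :: 'k) = of_int (int (b i) - int (b' i))" by simp
      also have "int (b i) - int (b' i) = u i" by (auto simp: b_def b'_def)
      finally show "of_nat (b i) * (v $ i / p $ i) - of_nat (b' i) * (v $ i / p $ i) = of_int (u i) * (v $ i / p $ i)"
        by (simp only: left_diff_distrib[symmetric])
    qed simp
    finally have "power_prod N b (\<lambda>i. p $ i) * (\<Sum>i<N. of_int (u i) * (v $ i / p $ i)) = 0" by simp
    moreover have "power_prod N b (\<lambda>i. p $ i) \<noteq> 0" using nz by (auto simp: power_prod_def)
    ultimately show "(\<Sum>i<N. of_int (u i) * (v $ i / p $ i)) = 0" by simp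
  qed
qed

text \<open>The vectors \<open>b k\<close>, the rows multiplied coordinatewise by \<open>p\<close>,
  form a basis. Since \<open>dim\<close> is the least size of a finite spanning set, minimality is a
  matter of the bound \<open>family_card_le\<close>.\<close>

lemma dim_tangent_space_torus:
  fixes p :: "('k :: field_char_0) vec"
  assumes "N > 0" "(\<lambda>_. 1) \<in> set rs" "independent_rows TYPE('k) N rs"
    "p \<in> carrier_vec N" "(\<lambda>i. p $ i) \<in> torus N rs"
  shows "vectorspace.dim class_ring (module_vec TYPE('k) N\<lparr>carrier := tangent_space N (toric_points N rs) p\<rparr>) = length rs"
proof -
  define W where "W = tangent_space N (toric_points N rs) p"
  have W: "W = {v \<in> carrier_vec N. (\<lambda>i. v $ i / p $ i) \<in> kernel_perp N rs}"
    unfolding W_def by (rule tangent_space_torus) fact+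
  define d where "d = length rs"
  define b where "b = (\<lambda>k. vec N (\<lambda>i. p $ i * of_int ((rs ! k) i)))"
  have nz: "p $ i \<noteq> 0" if "i < N" for i using assms(5) that by (auto simp: torus_def)
  interpret V: vec_space "TYPE('k)" N .
  have sub: "submodule class_ring W V.V"
  proof (rule submodule.intro)
    show "Module.module class_ring V.V" by (rule vec_module)
    show "W \<subseteq> carrier V.V" unfolding W by auto
    show "\<zero>\<^bsub>V.V\<^esub> \<in> W" unfolding W kernel_perp_def by (auto intro!: sum.neutral)
    fix v w assume vw: "v \<in> W" "w \<in> W"
    have "(\<Sum>i<N. of_int (u i) * ((v + w) $ i / p $ i)) = (\<Sum>i<N. of_int (u i) * (v $ i / p $ i)) + (\<Sum>i<N. of_int (u i) * (w $ i / p $ i))" for u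
      unfolding sum.distrib[symmetric] by (rule sum.cong) (use vw in \<open>auto simp: W add_divide_distrib distrib_left\<close>)
    thus "v \<oplus>\<^bsub>V.V\<^esub> w \<in> W" using vw unfolding W kernel_perp_def by auto
  next
    fix c v assume v: "v \<in> W"
    have "(\<Sum>i<N. of_int (u i) * ((c \<cdot>\<^sub>v v) $ i / p $ i)) = c * (\<Sum>i<N. of_int (u i) * (v $ i / p $ i))" for u
      unfolding sum_distrib_left by (rule sum.cong) (use v in \<open>auto simp: W\<close>)
    thus "c \<odot>\<^bsub>V.V\<^esub> v \<in> W" using v unfolding W kernel_perp_def by (auto simp: module_vec_simps)
  qed
  have vs: "vectorspace class_ring (V.vs W)"
    unfolding vectorspace_def using V.submodule_is_module[OF sub] class_field by blast
  have WC: "W \<subseteq> carrier_vec N" unfolding W by auto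
  have span: "module.span class_ring (V.vs W) S = V.span S" if "S \<subseteq> W" for S
    by (rule V.span_li_not_depend[OF that sub])
  have span_sub: "V.span S \<subseteq> W" if "S \<subseteq> W" for S
    using V.span_is_subset[OF that sub] .
  have bW: "b k \<in> W" if "k < d" for k
  proof -
    have "(\<lambda>i. of_int ((rs ! k) i) :: 'k) \<in> kernel_perp N rs" using that by (intro row_in_kernel_perp) (auto simp: d_def)
    moreover have "(\<Sum>i<N. of_int (u i) * (b k $ i / p $ i)) = (\<Sum>i<N. of_int (u i) * of_int ((rs ! k) i))" for u
      by (rule sum.cong) (use nz in \<open>auto simp: b_def\<close>)
    moreover have "b k \<in> carrier_vec N" by (simp add: b_def)
    ultimately show ?thesis unfolding W kernel_perp_def by (simp only: mem_Collect_eq simp_thms)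
  qed
  have indep: "\<forall>k\<in>{..<d}. c k = 0" if "\<And>i. i \<in> {..<N} \<Longrightarrow> (\<Sum>k<d. c k * b k $ i) = 0" for c
  proof -
    have "(\<Sum>k<length rs. c k * of_int ((rs ! k) i)) = 0" if i: "i < N" for i
    proof -
      have "0 = (\<Sum>k<d. c k * b k $ i)" using \<open>\<And>i. i \<in> {..<N} \<Longrightarrow> _\<close> i by simp
      also have "\<dots> = p $ i * (\<Sum>k<length rs. c k * of_int ((rs ! k) i))"
        using i by (simp add: b_def d_def sum_distrib_left mult_ac)
      finally show ?thesis using nz[OF i] by simp
    qed
    thus ?thesis using assms(3) unfolding independent_rows_def d_def by blast
  qed
  have inj: "inj_on b {..<d}"
  proof (rule inj_onI, rule ccontr)
    fix k l assume kl: "k \<in> {..<d}" "l \<in> {..<d}" "b k = b l" "k \<noteq> l"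
    have "(\<Sum>j<d. (if j = k then 1 else if j = l then -1 else 0) * b j $ i) = 0" for i
    proof -
      have "(\<Sum>j<d. (if j = k then 1 else if j = l then -1 else 0) * b j $ i) =
        (\<Sum>j<d. (if j = k then b k $ i else 0) + (if j = l then - (b l $ i) else 0))"
        by (rule sum.cong) (use kl in auto)
      also have "\<dots> = 0" using kl by (simp add: sum.distrib sum.delta)
      finally show ?thesis .
    qed
    from indep[OF this] kl(1) have "(if k = k then 1 else if k = l then - 1 else 0 :: 'k) = 0" by blast
    thus False by simp
  qed
  show ?thesis unfolding W_def[symmetric] vectorspace.dim_def[OF vs]
  proof (rule Least_equality)
    have BW: "b ` {..<d} \<subseteq> W" using bW by auto
    have "V.span (b ` {..<d}) = W"
    proof (rule equalityI[OF span_sub[OF BW]], rule subsetI)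
      fix v assume v: "v \<in> W"
      then obtain c where c: "\<And>i. i < N \<Longrightarrow> v $ i / p $ i = (\<Sum>k<d. c k * of_int ((rs ! k) i))"
        unfolding W d_def kernel_perp_eq_row_span by auto
      define a where "a = (\<lambda>x. c (the_inv_into {..<d} b x))"
      have a: "a (b k) = c k" if "k < d" for k
        unfolding a_def using the_inv_into_f_f[OF inj] that by simp
      have "v = V.lincomb a (b ` {..<d})"
      proof (rule eq_vecI)
        have "V.lincomb a (b ` {..<d}) \<in> carrier_vec N" using BW WC by (intro V.lincomb_closed) auto
        thus dim: "dim_vec v = dim_vec (V.lincomb a (b ` {..<d}))" using v WC by auto
        fix i assume "i < dim_vec (V.lincomb a (b ` {..<d}))"
        hence i: "i < N" using dim v WC by auto
        have "V.lincomb a (b ` {..<d}) $ i = (\<Sum>x\<in>b ` {..<d}. a x * x $ i)"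
          by (rule V.lincomb_index[OF i]) (use BW WC in auto)
        also have "\<dots> = (\<Sum>k<d. c k * (p $ i * of_int ((rs ! k) i)))"
          unfolding sum.reindex[OF inj] using i by (auto intro!: sum.cong simp: a) (simp add: b_def)
        also have "\<dots> = p $ i * (\<Sum>k<d. c k * of_int ((rs ! k) i))" by (simp add: sum_distrib_left mult_ac)
        also have "\<dots> = v $ i" using c[OF i] nz[OF i] by (simp add: field_simps)
        finally show "v $ i = V.lincomb a (b ` {..<d}) $ i" by simp
      qed
      thus "v \<in> V.span (b ` {..<d})" unfolding V.span_def by (auto simp: class_ring_simps)
    qed
    thus "\<exists>A. finite A \<and> card A = length rs \<and> A \<subseteq> carrier (V.vs W) \<and> module.span class_ring (V.vs W) A = carrier (V.vs W)"
      using BW by (intro exI[of _ "b ` {..<d}"]) (use card_image[OF inj] in \<open>auto simp: span d_def\<close>)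
  next
    fix n assume "\<exists>A. finite A \<and> card A = n \<and> A \<subseteq> carrier (V.vs W) \<and> module.span class_ring (V.vs W) A = carrier (V.vs W)"
    then obtain A where A: "finite A" "card A = n" "A \<subseteq> W" "V.span A = W" using span by auto
    have "card {..<d} \<le> card A"
    proof (rule family_card_le[where X = "{..<N}" and a = "\<lambda>k i. b k $ i" and b = "\<lambda>v i. v $ i"])
      fix k assume "k \<in> {..<d}"
      hence "b k \<in> V.span A" using bW A by simp
      then obtain a where "b k = V.lincomb a A" using V.finite_span[OF A(1)] A(3) WC by auto
      hence "b k $ i = (\<Sum>v\<in>A. a v * v $ i)" if "i < N" for i
        using V.lincomb_index[OF that, of A a] A(3) WC by auto
      thus "\<exists>g. \<forall>i\<in>{..<N}. b k $ i = (\<Sum>v\<in>A. g v * v $ i)" by (intro exI[of _ a]) auto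
    next
      fix c assume "\<And>i. i \<in> {..<N} \<Longrightarrow> (\<Sum>k\<in>{..<d}. c k * b k $ i) = 0"
      thus "\<forall>k\<in>{..<d}. c k = 0" by (rule indep)
    qed (simp_all add: A(1))
    thus "length rs \<le> n" using A by (simp add: d_def)
  qed
qed

subsection \<open>The dimension of a toric variety\<close>

lemma row_kernel_sum_eq:
  assumes "(\<lambda>_. 1) \<in> set rs" "row_kernel N rs (exp_diff b b')"
  shows "sum b {..<N} = sum b' {..<N}"
proof -
  have "(\<Sum>i<N. exp_diff b b' i) = 0" using assms unfolding row_kernel_def by fastforce
  hence "int (sum b {..<N}) = int (sum b' {..<N})" by (simp add: exp_diff_def sum_subtractf)
  thus ?thesis by (simp only: of_nat_eq_iff)
qed

lemma toric_points_closed: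
  assumes "(\<lambda>_. 1) \<in> set rs"
  shows "proj_closed N (toric_points N rs :: ('k :: field) vec set)"
  unfolding proj_closed_iff
proof (intro exI conjI)
  define Fs where "Fs = (\<lambda>(b, b') x. power_prod N b x + (- 1) * power_prod N b' x :: 'k) ` {(b, b'). row_kernel N rs (exp_diff b b')}"
  show "\<forall>F\<in>Fs. \<exists>e. polyfun N {e} F"
  proof
    fix F assume "F \<in> Fs"
    then obtain b b' where F: "F = (\<lambda>x. power_prod N b x + (- 1) * power_prod N b' x)" "row_kernel N rs (exp_diff b b')"
      unfolding Fs_def by auto
    have "polyfun N {sum b {..<N}} F"
      unfolding F by (intro polyfun_add polyfun_cmult polyfun_power_prod)
        (use row_kernel_sum_eq[OF assms F(2)] in auto)
    thus "\<exists>e. polyfun N {e} F" ..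
  qed
  show "toric_points N rs = fun_zeros N Fs"
    unfolding toric_points_def toric_cone_def fun_zeros_def Fs_def by auto
qed

lemma toric_points_irreducible:
  assumes "N > 0" "(\<lambda>_. 1) \<in> set rs"
  shows "proj_irreducible N (toric_points N rs :: ('k :: field_char_0) vec set)"
  unfolding proj_irreducible_def
proof (intro conjI allI impI)
  show "toric_points N rs \<noteq> ({} :: 'k vec set)" using torus_point[OF assms(1) one_in_torus] by blast
next
  fix Y Z :: "'k vec set"
  assume YZ: "proj_closed N Y" "proj_closed N Z" "toric_points N rs \<subseteq> Y \<union> Z"
  obtain Fs where Fs: "\<forall>F\<in>Fs. \<exists>e. polyfun N {e} F" "Y = fun_zeros N Fs" using YZ(1) unfolding proj_closed_iff by blast
  obtain Gs where Gs: "\<forall>F\<in>Gs. \<exists>e. polyfun N {e} F" "Z = fun_zeros N Gs" using YZ(2) unfolding proj_closed_iff by blast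
  show "toric_points N rs \<subseteq> Y \<or> toric_points N rs \<subseteq> Z"
  proof (rule ccontr)
    assume "\<not> ?thesis"
    then obtain y z where yz: "y \<in> toric_points N rs" "y \<notin> Y" "z \<in> toric_points N rs" "z \<notin> Z" by blast
    obtain F where F: "F \<in> Fs" "F (\<lambda>i. y $ i) \<noteq> 0" using yz unfolding Fs(2) fun_zeros_def toric_points_def by auto
    obtain G where G: "G \<in> Gs" "G (\<lambda>i. z $ i) \<noteq> 0" using yz unfolding Gs(2) fun_zeros_def toric_points_def by auto
    obtain e e' where e: "polyfun N {e} F" "polyfun N {e'} G" using F G Fs Gs by blast
    have "(\<forall>x\<in>toric_cone N rs. F x = 0) \<or> (\<forall>x\<in>toric_cone N rs. G x = 0)"
    proof (rule toric_irreducible[OF assms(2) e])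
      fix t :: "nat \<Rightarrow> 'k" assume t: "t \<in> torus N rs"
      have "vec N t \<in> Y \<union> Z" using torus_point[OF assms(1) t] YZ(3) by blast
      hence "F (\<lambda>i. vec N t $ i) = 0 \<or> G (\<lambda>i. vec N t $ i) = 0"
        using F(1) G(1) unfolding Fs(2) Gs(2) fun_zeros_def by auto
      moreover have "F (\<lambda>i. vec N t $ i) = F t" "G (\<lambda>i. vec N t $ i) = G t"
        by (rule polyfun_cong[OF e(1)], simp, rule polyfun_cong[OF e(2)], simp)
      ultimately show "F t * G t = 0" by auto
    qed
    thus False using F G yz unfolding toric_points_def by auto
  qed
qed

lemma toric_cone_mono: "set rs \<subseteq> set rs' \<Longrightarrow> toric_cone N rs \<subseteq> toric_cone N rs'"
  unfolding toric_cone_def row_kernel_def by blast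

lemma toric_points_mono: "set rs \<subseteq> set rs' \<Longrightarrow> toric_points N rs \<subseteq> toric_points N rs'"
  using toric_cone_mono unfolding toric_points_def by blast

text \<open>The point with coordinates \<open>2 ^ w i\<close>, where \<open>w\<close> is
  \<open>r\<close> shifted by a multiple of the row of ones, lies in the larger torus. As the powers
  of \<open>2\<close> are distinct in characteristic zero, lying in the smaller cone would make
  \<open>r\<close> orthogonal to the kernel of \<open>rs\<close>.\<close>

lemma toric_points_strict:
  assumes "N > 0" "(\<lambda>_. 1) \<in> set rs" "(\<lambda>i. of_int (r i) :: 'k :: field_char_0) \<notin> kernel_perp N rs"
  shows "\<not> (toric_points N (rs @ [r]) \<subseteq> (toric_points N rs :: 'k vec set))"
proof
  assume sub: "toric_points N (rs @ [r]) \<subseteq> (toric_points N rs :: 'k vec set)"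
  define c where "c = (\<Sum>i<N. \<bar>r i\<bar>)"
  define w where "w = (\<lambda>i. nat (r i + c))"
  have w: "int (w i) = r i + c" if "i < N" for i
  proof -
    have "\<bar>r i\<bar> \<le> c" unfolding c_def by (rule member_le_sum) (use that in auto)
    thus ?thesis unfolding w_def by simp
  qed
  have w_sum: "(\<Sum>i<N. int (w i) * u i) = (\<Sum>i<N. r i * u i) + c * (\<Sum>i<N. u i)" for u
  proof -
    have "(\<Sum>i<N. int (w i) * u i) = (\<Sum>i<N. r i * u i + c * u i)"
      by (rule sum.cong) (auto simp: w distrib_right)
    thus ?thesis by (simp add: sum.distrib sum_distrib_left)
  qed
  have sum0: "(\<Sum>i<N. u i) = 0" if "row_kernel N rs u" for u using that assms(2) unfolding row_kernel_def by fastforce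
  define t where "t = (\<lambda>i. (2 :: 'k) ^ w i)"
  have "t \<in> torus N (rs @ [r])" unfolding torus_def toric_cone_def
  proof (intro CollectI conjI allI impI)
    fix b b' assume rk: "row_kernel N (rs @ [r]) (exp_diff b b')"
    hence "row_kernel N rs (exp_diff b b')" "(\<Sum>i<N. r i * exp_diff b b' i) = 0" by (auto simp: row_kernel_def)
    hence "int (\<Sum>i<N. w i * b i) - int (\<Sum>i<N. w i * b' i) = 0"
      unfolding sum_int_diff[symmetric] w_sum using sum0 by simp
    hence "int (\<Sum>i<N. w i * b i) = int (\<Sum>i<N. w i * b' i)" by linarith
    hence "(\<Sum>i<N. w i * b i) = (\<Sum>i<N. w i * b' i)" by (simp only: of_nat_eq_iff)
    thus "power_prod N b t = power_prod N b' t" unfolding t_def power_prod_curve by simp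
  qed (simp add: t_def)
  hence "vec N t \<in> toric_points N rs" using sub torus_point[OF assms(1)] by blast
  moreover have "power_prod N b (\<lambda>i. vec N t $ i) = power_prod N b t" for b by (rule power_prod_cong) simp
  ultimately have t: "t \<in> toric_cone N rs" by (simp add: toric_points_def toric_cone_def)
  have "(\<Sum>i<N. of_int (u i) * of_int (r i)) = (0 :: 'k)" if u: "row_kernel N rs u" for u
  proof -
    have rk: "row_kernel N rs (exp_diff (\<lambda>i. nat (u i)) (\<lambda>i. nat (- u i)))"
      using u by (subst row_kernel_cong[of N _ u]) (auto simp: exp_diff_def)
    hence "(2 :: 'k) ^ (\<Sum>i<N. w i * nat (u i)) = 2 ^ (\<Sum>i<N. w i * nat (- u i))"
      using t unfolding toric_cone_def t_def power_prod_curve[symmetric] by blast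
    hence "(of_nat (2 ^ (\<Sum>i<N. w i * nat (u i))) :: 'k) = of_nat (2 ^ (\<Sum>i<N. w i * nat (- u i)))" by simp
    hence "(2 :: nat) ^ (\<Sum>i<N. w i * nat (u i)) = 2 ^ (\<Sum>i<N. w i * nat (- u i))"
      by (simp only: of_nat_eq_iff)
    hence "(\<Sum>i<N. w i * nat (u i)) = (\<Sum>i<N. w i * nat (- u i))"
      by (subst (asm) power_inject_exp) auto
    hence "(\<Sum>i<N. int (w i) * exp_diff (\<lambda>i. nat (u i)) (\<lambda>i. nat (- u i)) i) = 0"
      unfolding sum_int_diff by simp
    moreover have "exp_diff (\<lambda>i. nat (u i)) (\<lambda>i. nat (- u i)) = u" by (auto simp: exp_diff_def)
    ultimately have "(\<Sum>i<N. r i * u i) = 0" using w_sum[of u] sum0[OF u] by simp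
    hence "(of_int (\<Sum>i<N. r i * u i) :: 'k) = 0" by simp
    thus ?thesis by (simp add: mult.commute)
  qed
  thus False using assms(3) unfolding kernel_perp_def by blast
qed

lemma independent_row_not_in_perp:
  assumes "independent_rows TYPE('k :: field_char_0) N rs" "k < length rs"
  shows "(\<lambda>i. of_int ((rs ! k) i) :: 'k) \<notin> kernel_perp N (take k rs)"
proof
  assume "(\<lambda>i. of_int ((rs ! k) i) :: 'k) \<in> kernel_perp N (take k rs)"
  then obtain c where c: "\<And>i. i < N \<Longrightarrow> (of_int ((rs ! k) i) :: 'k) = (\<Sum>l<k. c l * of_int ((rs ! l) i))"
    unfolding kernel_perp_eq_row_span using assms(2) by auto
  define c' where "c' = (\<lambda>l. if l < k then c l else if l = k then - 1 else 0)"
  have "(\<Sum>l<length rs. c' l * of_int ((rs ! l) i)) = 0" if "i < N" for i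
  proof -
    have "(\<Sum>l<length rs. c' l * of_int ((rs ! l) i)) = (\<Sum>l<Suc k. c' l * of_int ((rs ! l) i))"
      by (rule sum.mono_neutral_right) (use assms(2) in \<open>auto simp: c'_def\<close>)
    also have "\<dots> = (\<Sum>l<k. c' l * of_int ((rs ! l) i)) - of_int ((rs ! k) i)"
      by (simp add: c'_def)
    also have "(\<Sum>l<k. c' l * of_int ((rs ! l) i)) = (\<Sum>l<k. c l * of_int ((rs ! l) i))"
      by (rule sum.cong) (auto simp: c'_def)
    finally show ?thesis using c[OF that] by simp
  qed
  hence "c' k = 0" using assms unfolding independent_rows_def by blast
  thus False by (simp add: c'_def)
qed

section \<open>Chains of irreducible closed subsets and their maximal length\<close>

definition irreducible_chain :: "nat \<Rightarrow> ('k :: field) vec set \<Rightarrow> nat \<Rightarrow> (nat \<Rightarrow> 'k vec set) \<Rightarrow> bool" where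
  "irreducible_chain N X n Z \<longleftrightarrow> (\<forall>i\<le>n. proj_closed N (Z i) \<and> proj_irreducible N (Z i) \<and> Z i \<subseteq> X) \<and>
     (\<forall>i<n. Z i \<subset> Z (i + 1))"

lemma proj_dim_eq: "proj_dim N X = Sup {enat n | n. \<exists>Z. irreducible_chain N X n Z}"
  unfolding proj_dim_def irreducible_chain_def ..

text \<open>Dropping rows enlarges the kernel and adds equations, so the prefixes of
  \<open>rs\<close> give nested toric varieties. The chain starts with the row of ones alone, which
  is why \<open>length rs\<close> rows give \<open>length rs - 1\<close> steps.\<close>

lemma toric_chain:
  assumes "N > 0" "rs \<noteq> []" "hd rs = (\<lambda>_. 1)" "independent_rows TYPE('k :: field_char_0) N rs"
  shows "irreducible_chain N (toric_points N rs :: 'k vec set) (length rs - 1) (\<lambda>i. toric_points N (take (i + 1) rs))"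
  unfolding irreducible_chain_def
proof (intro conjI allI impI)
  fix i
  have ones: "(\<lambda>_. 1) \<in> set (take (i + 1) rs)" using assms(2,3) by (cases rs) auto
  show "proj_closed N (toric_points N (take (i + 1) rs) :: 'k vec set)" by (rule toric_points_closed[OF ones])
  show "proj_irreducible N (toric_points N (take (i + 1) rs) :: 'k vec set)" by (rule toric_points_irreducible[OF assms(1) ones])
  show "toric_points N (take (i + 1) rs) \<subseteq> toric_points N rs" by (rule toric_points_mono) (rule set_take_subset)
  assume i: "i < length rs - 1"
  hence i': "i + 1 < length rs" by linarith
  hence eq: "take (i + 1 + 1) rs = take (i + 1) rs @ [rs ! (i + 1)]" by (simp add: take_Suc_conv_app_nth)
  show "toric_points N (take (i + 1) rs) \<subset> (toric_points N (take (i + 1 + 1) rs) :: 'k vec set)"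
    using toric_points_strict[OF assms(1) ones independent_row_not_in_perp[OF assms(4) i']]
      toric_points_mono[of "take (i + 1) rs" "take (i + 1 + 1) rs" N]
    unfolding eq by auto
qed

text \<open>\<open>G (Suc i)\<close> is a power of an equation of \<open>Z i\<close> that does not
  vanish on all of \<open>Z (Suc i)\<close>, and \<open>G 0\<close> is a power of a coordinate that
  is nonzero somewhere on \<open>Z 0\<close>. The powers bring all of them to a common degree
  \<open>\<delta>\<close>, so that products of equally many factors have equal degree.\<close>

lemma chain_functions:
  assumes chain: "irreducible_chain N X n (Z :: nat \<Rightarrow> ('k :: field_char_0) vec set)"
  obtains G \<delta> where "\<And>i. i \<le> n \<Longrightarrow> polyfun N {\<delta>} (G i)"
    "\<And>i x. i < n \<Longrightarrow> x \<in> Z i \<Longrightarrow> G (Suc i) (\<lambda>j. x $ j) = 0"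
    "\<And>i. i \<le> n \<Longrightarrow> \<exists>x\<in>Z i. G i (\<lambda>j. x $ j) \<noteq> 0"
proof -
  have "\<exists>F e. polyfun N {e} F \<and> (\<forall>x\<in>Z i. F (\<lambda>j. x $ j) = 0) \<and> (\<exists>x\<in>Z (Suc i). F (\<lambda>j. x $ j) \<noteq> 0)" if "i < n" for i
  proof -
    have "proj_closed N (Z i)" "proj_closed N (Z (Suc i))" "Z i \<subset> Z (Suc i)"
      using chain that unfolding irreducible_chain_def by auto
    then obtain Fs where Fs: "\<forall>F\<in>Fs. \<exists>e. polyfun N {e} F" "Z i = fun_zeros N Fs" unfolding proj_closed_iff by blast
    obtain x where x: "x \<in> Z (Suc i)" "x \<notin> Z i" using \<open>Z i \<subset> Z (Suc i)\<close> by blast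
    have "x \<in> carrier_vec N" "x \<noteq> 0\<^sub>v N" using \<open>proj_closed N (Z (Suc i))\<close> x(1)
      unfolding proj_closed_iff by (auto simp: fun_zeros_def)
    then obtain F where F: "F \<in> Fs" "F (\<lambda>j. x $ j) \<noteq> 0" using x(2) unfolding Fs(2) fun_zeros_def by auto
    moreover obtain e where "polyfun N {e} F" using F Fs by blast
    moreover have "\<forall>x\<in>Z i. F (\<lambda>j. x $ j) = 0" using F(1) unfolding Fs(2) fun_zeros_def by auto
    ultimately show ?thesis using x(1) by blast
  qed
  then obtain F e where F: "\<And>i. i < n \<Longrightarrow> polyfun N {e i} (F i)" "\<And>i x. i < n \<Longrightarrow> x \<in> Z i \<Longrightarrow> F i (\<lambda>j. x $ j) = 0"
    "\<And>i. i < n \<Longrightarrow> \<exists>x\<in>Z (Suc i). F i (\<lambda>j. x $ j) \<noteq> 0" by metis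
  have ne: "Z i \<noteq> {}" if "i \<le> n" for i
    using chain that unfolding irreducible_chain_def proj_irreducible_def by blast
  have e_pos: "e i > 0" if "i < n" for i
  proof (rule ccontr)
    assume "\<not> e i > 0"
    hence const: "F i x = F i (\<lambda>_. 0)" for x using hpolyfun_scale[OF F(1)[OF that], of 0 x] by simp
    have "Z i \<noteq> {}" using ne[of i] that by simp
    then obtain x where "x \<in> Z i" by blast
    with F(2)[OF that this] const have "F i y = 0" for y by metis
    thus False using F(3)[OF that] by blast
  qed
  obtain p where p: "p \<in> Z 0" using ne by blast
  have "proj_closed N (Z 0)" using chain by (auto simp: irreducible_chain_def)
  hence "p \<in> carrier_vec N" "p \<noteq> 0\<^sub>v N" using p unfolding proj_closed_iff by (auto simp: fun_zeros_def)
  hence "\<exists>j<N. p $ j \<noteq> 0" by (intro ccontr[of "\<exists>j<N. p $ j \<noteq> 0"]) (auto intro!: eq_vecI)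
  then obtain j where j: "j < N" "p $ j \<noteq> 0" by blast
  \<comment> \<open>The product of all degrees is divisible by each \<open>e i\<close>. It is
    positive: an equation of degree zero would be constant, yet it vanishes on the nonempty
    \<open>Z i\<close> and not on all of \<open>Z (Suc i)\<close>.\<close>
  define \<delta> where "\<delta> = (\<Prod>i<n. e i)"
  define G where "G = (\<lambda>i x. case i of 0 \<Rightarrow> x j ^ \<delta> | Suc i \<Rightarrow> F i x ^ (\<delta> div e i))"
  have dvd: "\<delta> div e i * e i = \<delta>" if "i < n" for i
    by (rule dvd_div_mult_self) (use that in \<open>auto simp: \<delta>_def\<close>)
  have pos: "\<delta> > 0" using e_pos by (simp add: \<delta>_def)
  show ?thesis
  proof (rule that[of \<delta> G])
    fix i assume i: "i \<le> n"
    show "polyfun N {\<delta>} (G i)"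
    proof (cases i)
      case 0
      thus ?thesis using hpolyfun_power[OF polyfun_var[OF j(1), of "{1}"], of \<delta>] by (simp add: G_def)
    next
      case (Suc k)
      thus ?thesis using hpolyfun_power[OF F(1)[of k], of "\<delta> div e k"] dvd[of k] i by (simp add: G_def)
    qed
    show "\<exists>x\<in>Z i. G i (\<lambda>j. x $ j) \<noteq> 0"
    proof (cases i)
      case 0
      thus ?thesis using p j by (auto simp: G_def)
    next
      case (Suc k)
      thus ?thesis using F(3)[of k] i by (auto simp: G_def)
    qed
  next
    fix i x assume i: "i < n" "x \<in> Z i"
    have "\<delta> div e i > 0" using dvd[OF i(1)] pos by (metis mult_0 neq0_conv)
    thus "G (Suc i) (\<lambda>j. x $ j) = 0" using F(2)[OF i] by (simp add: G_def)
  qed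
qed

text \<open>A relation on \<open>Z (Suc m)\<close> is divided by the lowest power of
  \<open>G (Suc m)\<close> occurring in it. By irreducibility the quotient \<open>H\<close> vanishes
  on all of \<open>Z (Suc m)\<close>; on \<open>Z m\<close>, where \<open>G (Suc m)\<close>
  vanishes, only the terms with the lowest exponent survive, and the induction hypothesis applies.
  Fixing the degree \<open>D\<close> keeps \<open>H\<close> homogeneous.\<close>

lemma chain_monomials_independent:
  assumes chain: "irreducible_chain N X n (Z :: nat \<Rightarrow> ('k :: field_char_0) vec set)"
    and G: "\<And>i. i \<le> n \<Longrightarrow> polyfun N {\<delta>} (G i)"
    "\<And>i x. i < n \<Longrightarrow> x \<in> Z i \<Longrightarrow> G (Suc i) (\<lambda>j. x $ j) = 0"
    "\<And>i. i \<le> n \<Longrightarrow> \<exists>x\<in>Z i. G i (\<lambda>j. x $ j) \<noteq> 0"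
    and "m \<le> n" "finite S" "inj_on (\<lambda>a. restrict a {..m}) S" "\<And>a. a \<in> S \<Longrightarrow> sum a {..m} = D"
    "\<And>x. x \<in> Z m \<Longrightarrow> (\<Sum>a\<in>S. c a * (\<Prod>i\<le>m. G i (\<lambda>j. x $ j) ^ a i)) = 0"
  shows "\<forall>a\<in>S. c a = 0"
  using assms(5-)
proof (induction m arbitrary: S D)
  case 0
  show ?case
  proof
    fix a assume a: "a \<in> S"
    have "b = a" if "b \<in> S" for b
      using 0(4)[OF a] 0(4)[OF that] by (intro inj_onD[OF 0(3) _ that a]) auto
    hence S: "S = {a}" using a by blast
    obtain x where "x \<in> Z 0" "G 0 (\<lambda>j. x $ j) \<noteq> 0" using G(3)[of 0] by auto
    thus "c a = 0" using 0(5)[of x] unfolding S by simp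
  qed
next
  case (Suc m)
  show ?case
  proof (rule ccontr)
    assume "\<not> ?case"
    define S' where "S' = {a \<in> S. c a \<noteq> 0}"
    have S': "finite S'" "S' \<noteq> {}" using \<open>\<not> ?case\<close> Suc.prems(2) by (auto simp: S'_def)
    define \<mu> where "\<mu> = Min ((\<lambda>a. a (Suc m)) ` S')"
    have \<mu>: "\<mu> \<le> a (Suc m)" if "a \<in> S'" for a using that S' by (auto simp: \<mu>_def)
    have "\<mu> \<in> (\<lambda>a. a (Suc m)) ` S'" unfolding \<mu>_def by (rule Min_in) (use S' in auto)
    then obtain a0 where a0: "a0 \<in> S'" "a0 (Suc m) = \<mu>" by blast
    define H where "H = (\<lambda>x. \<Sum>a\<in>S'. c a * (G (Suc m) x ^ (a (Suc m) - \<mu>) * (\<Prod>i\<le>m. G i x ^ a i)))"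
    have "polyfun N {(D - \<mu>) * \<delta>} H" unfolding H_def
    proof (intro polyfun_sum polyfun_cmult)
      fix a assume a: "a \<in> S'"
      have "polyfun N {(a (Suc m) - \<mu>) * \<delta> + (\<Sum>i\<le>m. a i * \<delta>)} (\<lambda>x. G (Suc m) x ^ (a (Suc m) - \<mu>) * (\<Prod>i\<le>m. G i x ^ a i))"
        using Suc.prems(1) by (intro hpolyfun_mult hpolyfun_power hpolyfun_prod G) auto
      also have "(a (Suc m) - \<mu>) * \<delta> + (\<Sum>i\<le>m. a i * \<delta>) = (D - \<mu>) * \<delta>"
      proof -
        have "(a (Suc m) - \<mu>) + sum a {..m} = D - \<mu>"
          using Suc.prems(4)[of a] a \<mu>[OF a] by (simp add: S'_def)
        thus ?thesis by (simp only: sum_distrib_right[symmetric] distrib_right[symmetric])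
      qed
      finally show "polyfun N {(D - \<mu>) * \<delta>} (\<lambda>x. G (Suc m) x ^ (a (Suc m) - \<mu>) * (\<Prod>i\<le>m. G i x ^ a i))" .
    qed
    hence closed: "proj_closed N (fun_zeros N {H})" "proj_closed N (fun_zeros N {G (Suc m)})"
      unfolding proj_closed_iff using G(1)[OF Suc.prems(1)] by blast+
    have Zm: "Z (Suc m) \<subseteq> carrier_vec N - {0\<^sub>v N}"
      using chain Suc.prems(1) unfolding irreducible_chain_def proj_closed_iff fun_zeros_def by blast
    have "H (\<lambda>j. x $ j) = 0" if x: "x \<in> Z (Suc m)" "G (Suc m) (\<lambda>j. x $ j) \<noteq> 0" for x
    proof -
      have "0 = (\<Sum>a\<in>S'. c a * (\<Prod>i\<le>Suc m. G i (\<lambda>j. x $ j) ^ a i))"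
        using Suc.prems(5)[OF x(1)] by (subst (asm) sum.mono_neutral_right[of S S']) (use Suc.prems(2) in \<open>auto simp: S'_def\<close>)
      also have "\<dots> = G (Suc m) (\<lambda>j. x $ j) ^ \<mu> * H (\<lambda>j. x $ j)"
        unfolding H_def sum_distrib_left
      proof (rule sum.cong)
        fix a assume "a \<in> S'"
        hence "G (Suc m) (\<lambda>j. x $ j) ^ a (Suc m) = G (Suc m) (\<lambda>j. x $ j) ^ \<mu> * G (Suc m) (\<lambda>j. x $ j) ^ (a (Suc m) - \<mu>)"
          using \<mu> by (simp flip: power_add)
        thus "c a * (\<Prod>i\<le>Suc m. G i (\<lambda>j. x $ j) ^ a i) = G (Suc m) (\<lambda>j. x $ j) ^ \<mu> *
            (c a * (G (Suc m) (\<lambda>j. x $ j) ^ (a (Suc m) - \<mu>) * (\<Prod>i\<le>m. G i (\<lambda>j. x $ j) ^ a i)))"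
          by (simp add: mult_ac)
      qed simp
      finally show ?thesis using x(2) by simp
    qed
    hence "Z (Suc m) \<subseteq> fun_zeros N {G (Suc m)} \<union> fun_zeros N {H}" using Zm by (auto simp: fun_zeros_def)
    moreover have "\<not> Z (Suc m) \<subseteq> fun_zeros N {G (Suc m)}" using G(3)[OF Suc.prems(1)] by (auto simp: fun_zeros_def)
    moreover have "proj_irreducible N (Z (Suc m))" using chain Suc.prems(1) by (auto simp: irreducible_chain_def)
    ultimately have HZ: "Z (Suc m) \<subseteq> fun_zeros N {H}" using closed unfolding proj_irreducible_def by blast
    have "\<forall>i<n. Z i \<subset> Z (i + 1)" using chain unfolding irreducible_chain_def by blast
    hence "Z m \<subset> Z (m + 1)" using Suc.prems(1) by (simp add: Suc_le_eq)
    hence sub: "Z m \<subseteq> Z (Suc m)" by auto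
    define S'' where "S'' = {a \<in> S'. a (Suc m) = \<mu>}"
    have "\<forall>a\<in>S''. c a = 0"
    proof (rule Suc.IH)
      show "m \<le> n" "finite S''" using Suc.prems(1) S' by (auto simp: S''_def)
      show "inj_on (\<lambda>a. restrict a {..m}) S''"
      proof (rule inj_onI)
        fix a b assume ab: "a \<in> S''" "b \<in> S''" "restrict a {..m} = restrict b {..m}"
        have "restrict a {..Suc m} = restrict b {..Suc m}"
        proof
          fix i
          show "restrict a {..Suc m} i = restrict b {..Suc m} i"
          proof (cases "i \<le> m")
            case True
            thus ?thesis using fun_cong[OF ab(3), of i] by simp
          next
            case False
            have "a (Suc m) = b (Suc m)" using ab(1,2) unfolding S''_def by simp
            thus ?thesis using False by (simp add: restrict_def le_Suc_eq)
          qed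
        qed
        moreover have "a \<in> S" "b \<in> S" using ab(1,2) by (simp_all add: S''_def S'_def)
        ultimately show "a = b" by (rule inj_onD[OF Suc.prems(3)])
      qed
      show "sum a {..m} = D - \<mu>" if "a \<in> S''" for a
        using Suc.prems(4)[of a] that by (auto simp: S''_def S'_def)
    next
      fix x assume x: "x \<in> Z m"
      have "G (Suc m) (\<lambda>j. x $ j) = 0" using G(2)[of m x] x Suc.prems(1) by simp
      have "0 = H (\<lambda>j. x $ j)" using x sub HZ by (auto simp: fun_zeros_def)
      also have "\<dots> = (\<Sum>a\<in>S''. c a * (G (Suc m) (\<lambda>j. x $ j) ^ (a (Suc m) - \<mu>) * (\<Prod>i\<le>m. G i (\<lambda>j. x $ j) ^ a i)))"
        unfolding H_def
      proof (rule sum.mono_neutral_right)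
        show "\<forall>a\<in>S' - S''. c a * (G (Suc m) (\<lambda>j. x $ j) ^ (a (Suc m) - \<mu>) * (\<Prod>i\<le>m. G i (\<lambda>j. x $ j) ^ a i)) = 0"
        proof
          fix a assume "a \<in> S' - S''"
          hence "a (Suc m) - \<mu> > 0" using \<mu>[of a] by (auto simp: S''_def)
          thus "c a * (G (Suc m) (\<lambda>j. x $ j) ^ (a (Suc m) - \<mu>) * (\<Prod>i\<le>m. G i (\<lambda>j. x $ j) ^ a i)) = 0"
            using \<open>G (Suc m) (\<lambda>j. x $ j) = 0\<close> by simp
        qed
      qed (use S' in \<open>auto simp: S''_def\<close>)
      also have "\<dots> = (\<Sum>a\<in>S''. c a * (\<Prod>i\<le>m. G i (\<lambda>j. x $ j) ^ a i))"
        by (rule sum.cong) (auto simp: S''_def)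
      finally show "(\<Sum>a\<in>S''. c a * (\<Prod>i\<le>m. G i (\<lambda>j. x $ j) ^ a i)) = 0" by simp
    qed
    moreover have "a0 \<in> S''" "c a0 \<noteq> 0" using a0 by (auto simp: S''_def S'_def)
    ultimately show False by blast
  qed
qed

text \<open>On the toric variety, a monomial of degree \<open>E\<close> only depends on the values of the rows on
  its exponent, which are bounded by a multiple of \<open>E\<close>.\<close>

lemma toric_hilbert_bound:
  assumes "rs \<noteq> []" "hd rs = (\<lambda>_. 1)"
  shows "\<exists>R :: nat. \<forall>E. \<exists>J :: (nat \<Rightarrow> int) set. \<exists>\<psi>. finite J \<and> card J = (2 * R * E + 1) ^ (length rs - 1) \<and>
    (\<forall>F. polyfun N {E} F \<longrightarrow> (\<exists>g. \<forall>x\<in>toric_cone N rs. F x = (\<Sum>j\<in>J. g j * \<psi> j x :: 'k :: field)))"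
proof -
  define d where "d = length rs"
  define R where "R = nat (\<Sum>k<d. \<Sum>i<N. \<bar>(rs ! k) i\<bar>)"
  have R: "\<bar>(rs ! k) i\<bar> \<le> int R" if "k < d" "i < N" for k i
  proof -
    have "\<bar>(rs ! k) i\<bar> \<le> (\<Sum>i<N. \<bar>(rs ! k) i\<bar>)" by (rule member_le_sum) (use that in auto)
    also have "\<dots> \<le> (\<Sum>k<d. \<Sum>i<N. \<bar>(rs ! k) i\<bar>)"
      by (rule member_le_sum[of k _ "\<lambda>k. \<Sum>i<N. \<bar>(rs ! k) i\<bar>"]) (use that in \<open>auto intro: sum_nonneg\<close>)
    finally have "\<bar>(rs ! k) i\<bar> \<le> (\<Sum>k<d. \<Sum>i<N. \<bar>(rs ! k) i\<bar>)" .
    moreover have "0 \<le> (\<Sum>k<d. \<Sum>i<N. \<bar>(rs ! k) i\<bar>)" by (intro sum_nonneg) auto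
    ultimately show ?thesis by (simp add: R_def)
  qed
  show ?thesis
  proof (intro exI[of _ R] allI)
    fix E
    \<comment> \<open>Row \<open>0\<close>, the row of ones, is left out because its value is the
      degree \<open>E\<close>; hence the exponent \<open>length rs - 1\<close> in the count.\<close>
    define key where "key = (\<lambda>b. \<lambda>k\<in>{1..<d}. \<Sum>i<N. (rs ! k) i * int (b i))"
    define J where "J = (PiE {1..<d} (\<lambda>_. {- int (R * E)..int (R * E)}))"
    have finJ: "finite J" by (auto simp: J_def intro!: finite_PiE)
    have cardJ: "card J = (2 * R * E + 1) ^ (length rs - 1)"
      unfolding J_def by (subst card_PiE) (auto simp: d_def nat_add_distrib nat_mult_distrib mult_ac)
    define \<psi> where "\<psi> = (\<lambda>j (x :: nat \<Rightarrow> 'k). power_prod N (SOME b. sum b {..<N} = E \<and> key b = j) x)"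
    have keyJ: "key b \<in> J" if "sum b {..<N} = E" for b
      unfolding J_def key_def
    proof (rule restrict_PiE_iff[THEN iffD2], intro ballI)
      fix k assume k: "k \<in> {1..<d}"
      have "\<bar>\<Sum>i<N. (rs ! k) i * int (b i)\<bar> \<le> (\<Sum>i<N. \<bar>(rs ! k) i * int (b i)\<bar>)" by (rule sum_abs)
      also have "\<dots> \<le> (\<Sum>i<N. int R * int (b i))"
        unfolding abs_mult by (intro sum_mono mult_mono) (use R k in auto)
      also have "\<dots> = int (R * E)" using that by (simp flip: sum_distrib_left of_nat_sum)
      finally show "(\<Sum>i<N. (rs ! k) i * int (b i)) \<in> {- int (R * E)..int (R * E)}" by auto
    qed
    have same: "power_prod N b x = power_prod N b' x"
      if "sum b {..<N} = E" "sum b' {..<N} = E" "key b = key b'" "x \<in> toric_cone N rs" for b b' and x :: "nat \<Rightarrow> 'k"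
    proof -
      have "(\<Sum>i<N. (rs ! k) i * exp_diff b b' i) = 0" if k: "k < d" for k
      proof (cases k)
        case 0
        have "int (sum b {..<N}) = int (sum b' {..<N})" using \<open>sum b _ = _\<close> \<open>sum b' _ = _\<close> by simp
        thus ?thesis using 0 assms by (simp add: hd_conv_nth exp_diff_def sum_subtractf)
      next
        case (Suc l)
        hence "(\<Sum>i<N. (rs ! k) i * int (b i)) = (\<Sum>i<N. (rs ! k) i * int (b' i))"
          using fun_cong[OF \<open>key b = key b'\<close>, of k] k by (simp add: key_def)
        thus ?thesis by (simp add: exp_diff_def right_diff_distrib sum_subtractf)
      qed
      hence "row_kernel N rs (exp_diff b b')" unfolding row_kernel_def d_def by (auto simp: in_set_conv_nth)
      thus ?thesis using that(4) by (auto simp: toric_cone_def)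
    qed
    have \<psi>: "power_prod N b x = \<psi> (key b) x" if "sum b {..<N} = E" "x \<in> toric_cone N rs" for b and x :: "nat \<Rightarrow> 'k"
    proof -
      have "\<exists>b'. sum b' {..<N} = E \<and> key b' = key b" using that by blast
      from someI_ex[OF this] show ?thesis unfolding \<psi>_def using that by (intro same) auto
    qed
    have "\<exists>g. \<forall>x\<in>toric_cone N rs. F x = (\<Sum>j\<in>J. g j * \<psi> j x)" if F: "polyfun N {E} F" for F
    proof -
      obtain ms where ms: "\<forall>(c, b)\<in>set ms. sum b {..<N} = E" "F = eval_terms N ms"
        using F unfolding polyfun_def by auto
      have "\<exists>g. \<forall>x\<in>toric_cone N rs. eval_terms N ms x = (\<Sum>j\<in>J. g j * \<psi> j x)"
        using ms(1)
      proof (induction ms)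
        case Nil
        show ?case by (rule exI[of _ "\<lambda>_. 0"]) simp
      next
        case (Cons m ms)
        obtain c b where m: "m = (c, b)" by force
        obtain g where g: "\<forall>x\<in>toric_cone N rs. eval_terms N ms x = (\<Sum>j\<in>J. g j * \<psi> j x)"
          using Cons by auto
        have b: "sum b {..<N} = E" using Cons.prems m by auto
        show ?case
        proof (intro exI ballI)
          fix x :: "nat \<Rightarrow> 'k" assume x: "x \<in> toric_cone N rs"
          have "(\<Sum>j\<in>J. (if j = key b then c else 0) * \<psi> j x) = (\<Sum>j\<in>J. if j = key b then c * \<psi> (key b) x else 0)"
            by (rule sum.cong) auto
          also have "\<dots> = c * power_prod N b x" using keyJ[OF b] finJ \<psi>[OF b x] by (simp add: sum.delta)
          finally show "eval_terms N (m # ms) x = (\<Sum>j\<in>J. ((if j = key b then c else 0) + g j) * \<psi> j x)"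
            using g x by (simp add: m eval_terms_Cons distrib_right sum.distrib)
        qed
      qed
      thus ?thesis using ms by simp
    qed
    thus "\<exists>J :: (nat \<Rightarrow> int) set. \<exists>\<psi>. finite J \<and> card J = (2 * R * E + 1) ^ (length rs - 1) \<and>
      (\<forall>F. polyfun N {E} F \<longrightarrow> (\<exists>g. \<forall>x\<in>toric_cone N rs. F x = (\<Sum>j\<in>J. g j * \<psi> j x :: 'k :: field)))"
      using finJ cardJ by (intro exI[of _ J] exI[of _ \<psi>]) auto
  qed
qed

text \<open>The functions \<open>G 0\<close> to \<open>G n\<close> have at least
  \<open>(e + 1) ^ n\<close> independent monomials of degree \<open>n * e\<close>, while the bound
  for the forms of the resulting degree on the toric variety grows in \<open>e\<close> only with
  exponent \<open>length rs - 1\<close>.\<close>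

lemma chain_length_le:
  assumes "rs \<noteq> []" "hd rs = (\<lambda>_. 1)"
    and chain: "irreducible_chain N (toric_points N rs) n (Z :: nat \<Rightarrow> ('k :: field_char_0) vec set)"
  shows "n \<le> length rs - 1"
proof -
  define d where "d = length rs - 1"
  obtain G \<delta> where G: "\<And>i. i \<le> n \<Longrightarrow> polyfun N {\<delta>} (G i)"
    "\<And>i x. i < n \<Longrightarrow> x \<in> Z i \<Longrightarrow> G (Suc i) (\<lambda>j. x $ j) = 0"
    "\<And>i. i \<le> n \<Longrightarrow> \<exists>x\<in>Z i. G i (\<lambda>j. x $ j) \<noteq> 0"
    using chain_functions[OF chain] by metis
  obtain R where R: "\<forall>E. \<exists>J :: (nat \<Rightarrow> int) set. \<exists>\<psi>. finite J \<and> card J = (2 * R * E + 1) ^ d \<and>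
    (\<forall>F. polyfun N {E} F \<longrightarrow> (\<exists>g. \<forall>x\<in>toric_cone N rs. F x = (\<Sum>j\<in>J. g j * \<psi> j x :: 'k)))"
    using toric_hilbert_bound[OF assms(1,2), where N = N and 'k = 'k, folded d_def] by (rule exE)
  have ZX: "(\<lambda>j. x $ j) \<in> toric_cone N rs" if "x \<in> Z n" for x
    using chain that unfolding irreducible_chain_def toric_points_def by auto
  have bound: "(e + 1) ^ n \<le> (2 * R * (n * e * \<delta>) + 1) ^ d" for e
  proof -
    define B where "B = (PiE {1..n} (\<lambda>_. {..e}))"
    \<comment> \<open>The exponents of \<open>G 1\<close> to \<open>G n\<close> range freely over
      \<open>{..e}\<close>; the exponent of \<open>G 0\<close> fills up to the total
      \<open>n * e\<close>.\<close>
    define a where "a = (\<lambda>b i. if i = 0 then n * e - sum b {1..n} else b i :: nat)"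
    have finB: "finite B" by (auto simp: B_def intro!: finite_PiE)
    have le: "sum b {1..n} \<le> n * e" if "b \<in> B" for b
      using sum_bounded_above[of "{1..n}" b e] that by (auto simp: B_def PiE_iff)
    have sum_a: "sum (a b) {..n} = n * e" if "b \<in> B" for b
    proof -
      have "{..n} = insert 0 {1..n}" by auto
      hence "sum (a b) {..n} = a b 0 + sum (a b) {1..n}" by simp
      also have "sum (a b) {1..n} = sum b {1..n}" by (rule sum.cong) (auto simp: a_def)
      finally show ?thesis using le[OF that] by (simp add: a_def)
    qed
    have inj_res: "inj_on (\<lambda>b. restrict (a b) {..n}) B"
    proof (rule inj_onI)
      fix b b' assume bb: "b \<in> B" "b' \<in> B" "restrict (a b) {..n} = restrict (a b') {..n}"
      show "b = b'"
      proof (rule PiE_ext[OF bb(1,2)[unfolded B_def]])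
        fix i assume "i \<in> {1..n}"
        thus "b i = b' i" using fun_cong[OF bb(3), of i] by (auto simp: a_def)
      qed
    qed
    hence inj: "inj_on a B" unfolding inj_on_def by auto
    obtain J :: "(nat \<Rightarrow> int) set" and \<psi> where J: "finite J" "card J = (2 * R * (n * e * \<delta>) + 1) ^ d"
      "\<And>F. polyfun N {n * e * \<delta>} F \<Longrightarrow> (\<exists>g. \<forall>x\<in>toric_cone N rs. F x = (\<Sum>j\<in>J. g j * \<psi> j x :: 'k))"
      using R[THEN spec, of "n * e * \<delta>"] by metis
    have "card B \<le> card J"
    proof (rule family_card_le[where X = "Z n" and a = "\<lambda>b x. \<Prod>i\<le>n. G i (\<lambda>j. x $ j) ^ a b i" and b = "\<lambda>j x. \<psi> j (\<lambda>i. x $ i)"])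
      fix b assume b: "b \<in> B"
      have "polyfun N {\<Sum>i\<le>n. a b i * \<delta>} (\<lambda>x. \<Prod>i\<le>n. G i x ^ a b i)"
        by (intro hpolyfun_prod hpolyfun_power G) auto
      also have "(\<Sum>i\<le>n. a b i * \<delta>) = n * e * \<delta>" using sum_a[OF b] by (simp flip: sum_distrib_right)
      finally obtain g where "\<forall>x\<in>toric_cone N rs. (\<Prod>i\<le>n. G i x ^ a b i) = (\<Sum>j\<in>J. g j * \<psi> j x)" using J(3) by blast
      thus "\<exists>g. \<forall>x\<in>Z n. (\<Prod>i\<le>n. G i (\<lambda>j. x $ j) ^ a b i) = (\<Sum>j\<in>J. g j * \<psi> j (\<lambda>i. x $ i))" using ZX by blast
    next
      fix c assume rel: "\<And>x. x \<in> Z n \<Longrightarrow> (\<Sum>b\<in>B. c b * (\<Prod>i\<le>n. G i (\<lambda>j. x $ j) ^ a b i)) = 0"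
      have "\<forall>a'\<in>a ` B. c (the_inv_into B a a') = 0"
      proof (rule chain_monomials_independent[OF chain G order_refl])
        show "inj_on (\<lambda>a. restrict a {..n}) (a ` B)" by (rule inj_on_imageI) (use inj_res in \<open>simp add: o_def\<close>)
        show "sum a' {..n} = n * e" if "a' \<in> a ` B" for a' using that sum_a by auto
        show "(\<Sum>a'\<in>a ` B. c (the_inv_into B a a') * (\<Prod>i\<le>n. G i (\<lambda>j. x $ j) ^ a' i)) = 0" if "x \<in> Z n" for x
          using rel[OF that] by (simp add: sum.reindex[OF inj] the_inv_into_f_f[OF inj])
      qed (use finB in auto)
      thus "\<forall>b\<in>B. c b = 0" using the_inv_into_f_f[OF inj] by auto
    qed (use finB J in auto)
    moreover have "card B = (e + 1) ^ n" unfolding B_def by (subst card_PiE) auto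
    ultimately show ?thesis using J by simp
  qed
  show ?thesis
  proof (rule ccontr)
    assume "\<not> ?thesis"
    hence n: "Suc d \<le> n" by (simp add: d_def)
    \<comment> \<open>\<open>C * (e + 1)\<close> dominates the base of the bound. After cancelling
      \<open>(e + 1) ^ d\<close> the inequality reads \<open>e + 1 \<le> C ^ d\<close>, which the
      choice \<open>e = C ^ d\<close> violates.\<close>
    define C where "C = 2 * R * n * \<delta> + 1"
    define e where "e = C ^ d"
    have "(e + 1) ^ Suc d \<le> (e + 1) ^ n" by (rule power_increasing[OF n]) simp
    also have "\<dots> \<le> (2 * R * (n * e * \<delta>) + 1) ^ d" by (rule bound)
    also have "\<dots> \<le> (C * (e + 1)) ^ d"
      by (rule power_mono) (simp_all add: C_def algebra_simps)
    also have "\<dots> = C ^ d * (e + 1) ^ d" by (rule power_mult_distrib)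
    finally have "(e + 1) * (e + 1) ^ d \<le> C ^ d * (e + 1) ^ d" by simp
    hence "e + 1 \<le> C ^ d" by (subst (asm) mult_le_cancel2) auto
    thus False by (simp add: e_def)
  qed
qed

lemma proj_dim_toric:
  assumes "N > 0" "rs \<noteq> []" "hd rs = (\<lambda>_. 1)" "independent_rows TYPE('k :: field_char_0) N rs"
  shows "proj_dim N (toric_points N rs :: 'k vec set) = enat (length rs - 1)"
  unfolding proj_dim_eq
proof (rule antisym)
  show "Sup {enat n |n. \<exists>Z. irreducible_chain N (toric_points N rs :: 'k vec set) n Z} \<le> enat (length rs - 1)"
    by (rule Sup_least) (use chain_length_le[OF assms(2,3)] in auto)
  show "enat (length rs - 1) \<le> Sup {enat n |n. \<exists>Z. irreducible_chain N (toric_points N rs :: 'k vec set) n Z}"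
    by (rule Sup_upper) (use toric_chain[OF assms] in blast)
qed

lemma torus_regular:
  fixes p :: "('k :: field_char_0) vec"
  assumes "N > 0" "rs \<noteq> []" "hd rs = (\<lambda>_. 1)" "independent_rows TYPE('k) N rs"
    "p \<in> carrier_vec N" "(\<lambda>i. p $ i) \<in> torus N rs"
  shows "regular_point N (toric_points N rs) p"
proof -
  have ones: "(\<lambda>_. 1) \<in> set rs" using assms(2,3) by (metis hd_in_set)
  have "p = vec N (\<lambda>i. p $ i)" using assms(5) by (auto intro!: eq_vecI)
  hence "p \<in> toric_points N rs" using torus_point[OF assms(1,6)] by simp
  moreover have "enat (length rs) = enat (length rs - 1) + 1" using assms(2) by (cases rs) (auto simp: one_enat_def)
  ultimately show ?thesis unfolding regular_point_def
    using dim_tangent_space_torus[OF assms(1) ones assms(4-6)] proj_dim_toric[OF assms(1-4)] by simp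
qed

subsection \<open>The dual variety\<close>

text \<open>Divided coordinatewise by a torus point \<open>t\<close>, this becomes the conormal
  space at \<open>t\<close>.\<close>

definition kernel_field :: "nat \<Rightarrow> (nat \<Rightarrow> int) list \<Rightarrow> (nat \<Rightarrow> 'k :: field_char_0) set" where
  "kernel_field N rs = {u. \<forall>r\<in>set rs. (\<Sum>i<N. of_int (r i) * u i) = 0}"

lemma kernel_field_line: "a \<in> kernel_field N rs \<Longrightarrow> b \<in> kernel_field N rs \<Longrightarrow> (\<lambda>i. a i + z * b i) \<in> kernel_field N rs"
  by (auto simp: kernel_field_def distrib_left sum.distrib mult.left_commute[of _ z] simp flip: sum_distrib_left)

lemma kernel_field_cong:
  "(\<And>i. i < N \<Longrightarrow> u i = u' i) \<Longrightarrow> u \<in> kernel_field N rs \<longleftrightarrow> u' \<in> kernel_field N rs"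
  by (simp add: kernel_field_def)

lemma kernel_field_perp: "u \<in> kernel_field N rs \<Longrightarrow> v \<in> kernel_perp N rs \<Longrightarrow> (\<Sum>i<N. v i * u i) = 0"
  by (rule kernel_perp_field) (auto simp: kernel_field_def)

text \<open>A linear space is irreducible: on the line through \<open>a\<close> and \<open>b\<close>
  both functions are polynomials in one variable, and the first of them is not zero.\<close>

lemma kernel_field_irreducible:
  fixes F :: "(nat \<Rightarrow> 'k :: field_char_0) \<Rightarrow> 'k"
  assumes F: "polyfun N E F" and G: "polyfun N E' G"
    and FG: "\<And>u. u \<in> kernel_field n rs \<Longrightarrow> F u * G u = 0"
    and a: "a \<in> kernel_field n rs" "F a \<noteq> 0" and b: "b \<in> kernel_field n rs"
  shows "G b = 0"
proof -
  define v where "v = (\<lambda>i. b i + (- 1) * a i)"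
  have v: "v \<in> kernel_field n rs" unfolding v_def by (rule kernel_field_line) fact+
  obtain P where P: "\<forall>z. poly P z = F (\<lambda>i. a i + z * v i)" using polyfun_line_poly[OF F] by blast
  obtain Q where Q: "\<forall>z. poly Q z = G (\<lambda>i. a i + z * v i)" using polyfun_line_poly[OF G] by blast
  have "P * Q = 0" by (rule poly_eqI_infinite) (use P Q FG[OF kernel_field_line[OF a(1) v]] in simp)
  moreover have "P \<noteq> 0" using P[THEN spec, of 0] a(2) by auto
  ultimately have "Q = 0" by simp
  thus ?thesis using Q[THEN spec, of 1] by (simp add: v_def)
qed

lemma kernel_field_prod_nonzero:
  fixes F :: "'i \<Rightarrow> (nat \<Rightarrow> 'k :: field_char_0) \<Rightarrow> 'k"
  assumes "finite I" "\<And>i. i \<in> I \<Longrightarrow> polyfun N UNIV (F i)" "\<And>i. i \<in> I \<Longrightarrow> \<exists>u\<in>kernel_field n rs. F i u \<noteq> 0"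
  shows "\<exists>u\<in>kernel_field n rs. (\<Prod>i\<in>I. F i u) \<noteq> 0"
  using assms
proof (induction I rule: finite_induct)
  case empty
  have "(\<lambda>_. 0) \<in> kernel_field n rs" by (simp add: kernel_field_def)
  thus ?case by auto
next
  case (insert i I)
  obtain a where a: "a \<in> kernel_field n rs" "F i a \<noteq> 0" using insert.prems(2) by blast
  obtain b where b: "b \<in> kernel_field n rs" "(\<Prod>i\<in>I. F i b) \<noteq> 0" using insert by blast
  show ?case
  proof (rule ccontr)
    assume "\<not> ?case"
    hence "F i u * (\<Prod>i\<in>I. F i u) = 0" if "u \<in> kernel_field n rs" for u using that insert.hyps by auto
    from kernel_field_irreducible[OF insert.prems(1) polyfun_UNIV_prod this a b(1)] insert.prems(1) b(2)
    show False by blast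
  qed
qed

text \<open>Equal columns \<open>i\<close> and \<open>j\<close> put the difference of the two unit
  vectors into the kernel, and the corresponding binomial is the difference of two
  coordinates.\<close>

lemma torus_const:
  fixes t :: "nat \<Rightarrow> 'k :: field"
  assumes "t \<in> toric_cone N rs" "i < N" "j < N" "\<And>r. r \<in> set rs \<Longrightarrow> r i = r j"
  shows "t i = t j"
proof -
  define e :: "nat \<Rightarrow> nat \<Rightarrow> nat" where "e = (\<lambda>i l. if l = i then 1 else 0)"
  have "row_kernel N rs (exp_diff (e i) (e j))" unfolding row_kernel_def
  proof
    fix r assume r: "r \<in> set rs"
    have "(\<Sum>l<N. r l * exp_diff (e i) (e j) l) = (\<Sum>l<N. (if l = i then r i else 0) - (if l = j then r j else 0))"
      by (rule sum.cong) (auto simp: exp_diff_def e_def)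
    also have "\<dots> = 0" using assms(2,3) assms(4)[OF r] by (simp add: sum_subtractf sum.delta)
    finally show "(\<Sum>l<N. r l * exp_diff (e i) (e j) l) = 0" .
  qed
  hence "power_prod N (e i) t = power_prod N (e j) t" using assms(1) by (auto simp: toric_cone_def)
  thus ?thesis unfolding e_def using power_prod_unit[of i N 1 t] power_prod_unit[of j N 1 t] assms(2,3) by simp
qed

section \<open>Conormal vectors at torus points and equations of the dual\<close>

locale toric_rows =
  fixes N :: nat and rs :: "(nat \<Rightarrow> int) list" and K :: "'k :: field_char_0 itself"
  assumes N_pos: "N > 0" and rs_ne: "rs \<noteq> []" and hd_rs: "hd rs = (\<lambda>_. 1)" and indep_rs: "independent_rows K N rs"
begin

abbreviation "X \<equiv> toric_points N rs :: 'k vec set"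
abbreviation "X' \<equiv> dual_variety N X"

lemma indep: "independent_rows TYPE('k) N rs"
  using indep_rs by (simp add: independent_rows_def)

lemma ones: "(\<lambda>_. 1) \<in> set rs"
  using rs_ne hd_rs by (metis hd_in_set)

text \<open>Dividing \<open>u\<close> by \<open>t\<close> makes it orthogonal to the tangent space
  at \<open>t\<close>, which is \<open>t\<close> times the row span. The hyperplane then contains
  this tangent space, so the sum of the two is not everything.\<close>

lemma conormal_in_dual:
  assumes t: "t \<in> torus N rs" and u: "u \<in> (kernel_field N rs :: (nat \<Rightarrow> 'k) set)"
    and nz: "vec N (\<lambda>i. u i / t i) \<noteq> 0\<^sub>v N"
  shows "vec N (\<lambda>i. u i / t i) \<in> X'"
proof -
  define h where "h = vec N (\<lambda>i. u i / t i)"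
  define p where "p = vec N t"
  have t_nz: "t i \<noteq> 0" if "i < N" for i using t that by (auto simp: torus_def)
  have "power_prod N b (\<lambda>i. p $ i) = power_prod N b t" for b by (rule power_prod_cong) (simp add: p_def)
  hence p: "p \<in> carrier_vec N" "(\<lambda>i. p $ i) \<in> torus N rs"
    using t by (auto simp: p_def torus_def toric_cone_def)
  have reg: "regular_point N X p" by (rule torus_regular[OF N_pos rs_ne hd_rs indep p])
  have tang: "v \<in> hyperplane N h" if v: "v \<in> tangent_space N X p" for v
  proof -
    have v': "v \<in> carrier_vec N" "(\<lambda>i. v $ i / p $ i) \<in> kernel_perp N rs"
      using v unfolding tangent_space_torus[OF N_pos ones p] by auto
    have "(\<Sum>i<N. h $ i * v $ i) = (\<Sum>i<N. (v $ i / p $ i) * u i)"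
      by (rule sum.cong) (auto simp: h_def p_def)
    also have "\<dots> = 0" by (rule kernel_field_perp[OF u v'(2)])
    finally show ?thesis using v'(1) by (simp add: hyperplane_def)
  qed
  have "p \<in> hyperplane N h"
  proof -
    have "(\<Sum>i<N. h $ i * p $ i) = (\<Sum>i<N. u i)"
      by (rule sum.cong) (auto simp: h_def p_def t_nz)
    also have "\<dots> = 0" using u ones unfolding kernel_field_def by fastforce
    finally show ?thesis using p by (simp add: hyperplane_def)
  qed
  moreover have "{v + w | v w. v \<in> tangent_space N X p \<and> w \<in> hyperplane N h} \<noteq> carrier_vec N"
  proof
    assume eq: "{v + w | v w. v \<in> tangent_space N X p \<and> w \<in> hyperplane N h} = carrier_vec N"
    have "h \<in> carrier_vec N" by (simp add: h_def)
    have "h $ j = 0" if j: "j < N" for j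
    proof -
      have "unit_vec N j \<in> {v + w | v w. v \<in> tangent_space N X p \<and> w \<in> hyperplane N h}"
        unfolding eq by simp
      then obtain v w where vw: "unit_vec N j = v + w" "v \<in> hyperplane N h" "w \<in> hyperplane N h" using tang by blast
      have "h $ j = (\<Sum>i<N. if i = j then h $ i else 0)" using j by (simp add: sum.delta)
      also have "\<dots> = (\<Sum>i<N. h $ i * unit_vec N j $ i)" by (rule sum.cong) (use j in auto)
      also have "\<dots> = (\<Sum>i<N. h $ i * v $ i + h $ i * w $ i)"
        unfolding vw(1) by (rule sum.cong) (use vw in \<open>auto simp: hyperplane_def distrib_left\<close>)
      also have "\<dots> = 0" using vw by (simp add: hyperplane_def sum.distrib)
      finally show ?thesis .
    qed
    hence "h = 0\<^sub>v N" by (auto simp: h_def intro!: eq_vecI)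
    thus False using nz by (simp add: h_def)
  qed
  ultimately have "h \<in> {h \<in> carrier_vec N. h \<noteq> 0\<^sub>v N \<and> (\<exists>p. regular_point N X p \<and> meets_non_transversally N X h p)}"
    using nz reg unfolding meets_non_transversally_def by (auto simp: h_def)
  thus ?thesis unfolding dual_variety_def mem_proj_closure h_def[symmetric]
    by (auto simp: vanishing_def)
qed

text \<open>If \<open>h\<close> does not annihilate the tangent vector \<open>v\<close>, every
  vector is a multiple of \<open>v\<close> plus an element of the hyperplane, so the intersection is
  transversal.\<close>

lemma conormal_perp_tangent:
  assumes "h \<in> carrier_vec N" "meets_non_transversally N X h p" "v \<in> tangent_space N X p"
  shows "(\<Sum>i<N. h $ i * v $ i) = 0"
proof (rule ccontr)
  assume nz: "(\<Sum>i<N. h $ i * v $ i) \<noteq> 0"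
  have v: "v \<in> carrier_vec N" using assms(3) by (simp add: mem_tangent_space)
  have "carrier_vec N \<subseteq> {v + w | v w. v \<in> tangent_space N X p \<and> w \<in> hyperplane N h}"
  proof
    fix y :: "'k vec" assume y: "y \<in> carrier_vec N"
    define c where "c = (\<Sum>i<N. h $ i * y $ i) / (\<Sum>i<N. h $ i * v $ i)"
    have "c \<cdot>\<^sub>v v \<in> tangent_space N X p" unfolding mem_tangent_space
    proof (intro conjI allI impI)
      fix F assume F: "vanishing N X F"
      then obtain e where e: "polyfun N {e} F" unfolding vanishing_def by blast
      have "dir_deriv F (\<lambda>i. p $ i) (\<lambda>i. (c \<cdot>\<^sub>v v) $ i) = c * dir_deriv F (\<lambda>i. p $ i) (\<lambda>i. v $ i)"
        unfolding dir_deriv_linear[OF e, of _ "\<lambda>i. (c \<cdot>\<^sub>v v) $ i"] dir_deriv_linear[OF e, of _ "\<lambda>i. v $ i"] sum_distrib_left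
        by (rule sum.cong) (use v in auto)
      thus "dir_deriv F (\<lambda>i. p $ i) (\<lambda>i. (c \<cdot>\<^sub>v v) $ i) = 0"
        using assms(3) F by (simp add: mem_tangent_space)
    qed (use v in simp)
    moreover have "y - c \<cdot>\<^sub>v v \<in> hyperplane N h"
    proof -
      have "(\<Sum>i<N. h $ i * (y - c \<cdot>\<^sub>v v) $ i) = (\<Sum>i<N. h $ i * y $ i - c * (h $ i * v $ i))"
        by (rule sum.cong) (use v y in \<open>auto simp: algebra_simps\<close>)
      also have "\<dots> = (\<Sum>i<N. h $ i * y $ i) - c * (\<Sum>i<N. h $ i * v $ i)"
        by (simp only: sum_subtractf sum_distrib_left)
      also have "\<dots> = 0" using nz by (simp add: c_def)
      finally show ?thesis using v y by (simp add: hyperplane_def)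
    qed
    moreover have "y = c \<cdot>\<^sub>v v + (y - c \<cdot>\<^sub>v v)" using v y by (auto intro!: eq_vecI)
    ultimately show "y \<in> {v + w | v w. v \<in> tangent_space N X p \<and> w \<in> hyperplane N h}" by blast
  qed
  moreover have "{v + w | v w. v \<in> tangent_space N X p \<and> w \<in> hyperplane N h} \<subseteq> carrier_vec N"
    by (auto simp: mem_tangent_space hyperplane_def)
  ultimately show False using assms(2) unfolding meets_non_transversally_def by blast
qed

text \<open>A conormal vector at any point is a combination of gradients of equations of \<open>X\<close>; moving
  the base point of these gradients into the torus shows that it is a limit of conormal
  vectors there.\<close>

lemma dual_vanishing:
  assumes g: "polyfun N {e} g"
    and van: "\<And>t u. t \<in> torus N rs \<Longrightarrow> u \<in> (kernel_field N rs :: (nat \<Rightarrow> 'k) set) \<Longrightarrow> g (\<lambda>i. u i / t i) = 0"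
    and x: "x \<in> X'"
  shows "g (\<lambda>i. x $ i) = 0"
proof -
  define S where "S = {h \<in> carrier_vec N. h \<noteq> 0\<^sub>v N \<and> (\<exists>p. regular_point N X p \<and> meets_non_transversally N X h p)}"
  have "g (\<lambda>i. h $ i) = 0" if hS: "h \<in> S" for h
  proof -
    obtain p where h: "h \<in> carrier_vec N" and p: "regular_point N X p" "meets_non_transversally N X h p"
      using hS unfolding S_def by blast
    have pX: "p \<in> X" using p(1) by (simp add: regular_point_def)
    define grad where "grad = (\<lambda>(F :: (nat \<Rightarrow> 'k) \<Rightarrow> 'k) x i. dir_deriv F x (\<lambda>j. if j = i then 1 else 0))"
    define Gr where "Gr = (\<lambda>F. grad F (\<lambda>i. p $ i)) ` {F. vanishing N X F}"
    \<comment> \<open>Duality applies since a vector annihilated by all gradients is tangent at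
      \<open>p\<close>, hence annihilated by \<open>h\<close>.\<close>
    have "\<exists>ts. snd ` set ts \<subseteq> Gr \<and> (\<forall>i<N. h $ i = (\<Sum>(c, s)\<leftarrow>ts. c * s i))"
    proof (rule double_annihilator)
      fix v :: "nat \<Rightarrow> 'k" assume v: "\<And>s. s \<in> Gr \<Longrightarrow> (\<Sum>i<N. s i * v i) = 0"
      have "vec N v \<in> tangent_space N X p" unfolding mem_tangent_space
      proof (intro conjI allI impI)
        fix F assume F: "vanishing N X F"
        then obtain e' where e': "polyfun N {e'} F" unfolding vanishing_def by blast
        have "dir_deriv F (\<lambda>i. p $ i) (\<lambda>i. vec N v $ i) = dir_deriv F (\<lambda>i. p $ i) v"
          by (rule dir_deriv_cong[OF e']) auto
        also have "\<dots> = (\<Sum>i<N. grad F (\<lambda>i. p $ i) i * v i)"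
          unfolding grad_def by (rule dir_deriv_linear[OF e'])
        also have "\<dots> = 0" by (rule v) (use F in \<open>auto simp: Gr_def\<close>)
        finally show "dir_deriv F (\<lambda>i. p $ i) (\<lambda>i. vec N v $ i) = 0" .
      qed simp
      from conormal_perp_tangent[OF h p(2) this]
      show "(\<Sum>i<N. h $ i * v i) = 0" by simp
    qed
    then obtain ts where ts: "snd ` set ts \<subseteq> Gr" "\<And>i. i < N \<Longrightarrow> h $ i = (\<Sum>(c, s)\<leftarrow>ts. c * s i)" by blast
    have "\<forall>m\<in>set ts. \<exists>F. vanishing N X F \<and> snd m = grad F (\<lambda>i. p $ i)" using ts(1) unfolding Gr_def by blast
    then obtain f where f: "\<And>m. m \<in> set ts \<Longrightarrow> vanishing N X (f m)" "\<And>m. m \<in> set ts \<Longrightarrow> snd m = grad (f m) (\<lambda>i. p $ i)"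
      by metis
    define y where "y = (\<lambda>x i. \<Sum>m\<leftarrow>ts. fst m * grad (f m) x i)"
    have y_p: "h $ i = y (\<lambda>i. p $ i) i" if "i < N" for i
    proof -
      have "h $ i = (\<Sum>m\<leftarrow>ts. fst m * snd m i)" using ts(2)[OF that] by (simp add: case_prod_unfold)
      also have "\<dots> = y (\<lambda>i. p $ i) i"
        unfolding y_def by (rule arg_cong[of _ _ sum_list], rule map_cong) (auto simp: f(2))
      finally show ?thesis .
    qed
    have "g (y (\<lambda>i. p $ i)) = 0"
    proof (rule torus_dense[OF ones, of N UNIV "\<lambda>x. g (y x)"])
      show "polyfun N UNIV (\<lambda>x. g (y x))"
      proof (rule polyfun_UNIV_compose[OF polyfun_UNIV[OF g]])
        fix i
        have "\<exists>E. polyfun N E (f m)" if "m \<in> set ts" for m using f(1)[OF that] unfolding vanishing_def by blast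
        thus "polyfun N UNIV (\<lambda>x. y x i)" unfolding y_def grad_def
          by (intro polyfun_sum_list polyfun_cmult) (use polyfun_dir_deriv in blast)
      qed
      show "(\<lambda>i. p $ i) \<in> toric_cone N rs" using pX by (simp add: toric_points_def)
    next
      fix t :: "nat \<Rightarrow> 'k" assume t: "t \<in> torus N rs"
      have t_nz: "t i \<noteq> 0" if "i < N" for i using t that by (auto simp: torus_def)
      \<comment> \<open>At a torus point the same combination of gradients is orthogonal to the
        tangent directions \<open>t\<close> times a row, so it has the form \<open>u / t\<close>
        with \<open>u\<close> in the kernel.\<close>
      have "(\<lambda>i. t i * y t i) \<in> kernel_field N rs" unfolding kernel_field_def
      proof (intro CollectI ballI)
        fix r assume r: "r \<in> set rs"
        have "(\<Sum>i<N. of_int (r i) * (t i * y t i)) = (\<Sum>m\<leftarrow>ts. fst m * (\<Sum>i<N. grad (f m) t i * (t i * of_int (r i))))"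
          unfolding y_def
          by (induction ts) (auto simp: sum.distrib sum_distrib_left algebra_simps)
        also have "\<dots> = (\<Sum>m\<leftarrow>ts. 0)"
        proof (rule arg_cong[of _ _ sum_list], rule map_cong)
          fix m assume m: "m \<in> set ts"
          then obtain e' where e': "polyfun N {e'} (f m)" using f(1) unfolding vanishing_def by blast
          have "(\<Sum>i<N. grad (f m) t i * (t i * of_int (r i))) = dir_deriv (f m) t (\<lambda>i. t i * of_int (r i))"
            unfolding grad_def by (rule dir_deriv_linear[OF e', symmetric])
          also have "\<dots> = 0"
            by (rule torus_tangent[OF ones e' _ t row_in_kernel_perp[OF r]]) (rule vanishing_toric_points[OF N_pos f(1)[OF m]])
          finally show "fst m * (\<Sum>i<N. grad (f m) t i * (t i * of_int (r i))) = 0" by simp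
        qed simp
        finally show "(\<Sum>i<N. of_int (r i) * (t i * y t i)) = 0" by simp
      qed
      from van[OF t this] have "g (\<lambda>i. t i * y t i / t i) = 0" .
      moreover have "g (\<lambda>i. t i * y t i / t i) = g (y t)" by (rule polyfun_cong[OF g]) (use t_nz in auto)
      ultimately show "g (y t) = 0" by simp
    qed
    moreover have "g (\<lambda>i. h $ i) = g (y (\<lambda>i. p $ i))" by (rule polyfun_cong[OF g]) (rule y_p)
    ultimately show ?thesis by simp
  qed
  hence "vanishing N S g" using g unfolding vanishing_def by blast
  thus ?thesis using x unfolding dual_variety_def S_def[symmetric] mem_proj_closure by blast
qed

text \<open>The zero vector is not a projective point and is treated apart: a homogeneous function
  vanishing at one point of the dual also vanishes at \<open>0\<close>, by scaling with
  \<open>0\<close>. Nonemptiness of the dual enters here, since a nonzero constant vanishes on the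
  empty set.\<close>

lemma vanishing_dual_conormal:
  assumes "vanishing N X' F" "X' \<noteq> {}" "t \<in> torus N rs" "u \<in> (kernel_field N rs :: (nat \<Rightarrow> 'k) set)"
  shows "F (\<lambda>i. u i / t i) = 0"
proof -
  obtain e where e: "polyfun N {e} F" using assms unfolding vanishing_def by blast
  have eq: "F (\<lambda>i. u i / t i) = F (\<lambda>i. vec N (\<lambda>i. u i / t i) $ i)" by (rule polyfun_cong[OF e]) simp
  show ?thesis
  proof (cases "vec N (\<lambda>i. u i / t i) = 0\<^sub>v N")
    case True
    obtain x where "x \<in> X'" using assms(2) by blast
    hence "F (\<lambda>i. x $ i) = 0" using assms(1) by (auto simp: vanishing_def)
    hence "F (\<lambda>i. 0 * x $ i) = 0" by (subst hpolyfun_scale[OF e]) simp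
    moreover have "F (\<lambda>i. 0 * x $ i) = F (\<lambda>i. vec N (\<lambda>i. u i / t i) $ i)"
      unfolding True by (rule polyfun_cong[OF e]) simp
    ultimately show ?thesis using eq by simp
  next
    case False
    thus ?thesis using conormal_in_dual[OF assms(3,4)] assms(1) unfolding eq vanishing_def by blast
  qed
qed

text \<open>Conormal vectors stay conormal when \<open>u\<close> moves inside the kernel with
  \<open>t\<close> fixed, and when \<open>t\<close> is replaced by \<open>t / s\<close> with
  \<open>s\<close> in the torus. The first motion gives the tangent vectors \<open>w / t\<close>;
  the second, differentiated at \<open>s = 1\<close>, gives \<open>u * v / t\<close>.\<close>

lemma tangent_dual:
  fixes t u v w :: "nat \<Rightarrow> 'k"
  assumes t: "t \<in> torus N rs" and u: "u \<in> (kernel_field N rs :: (nat \<Rightarrow> 'k) set)" and ne: "X' \<noteq> {}"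
  defines "q \<equiv> vec N (\<lambda>i. u i / t i)"
  shows "w \<in> kernel_field N rs \<Longrightarrow> vec N (\<lambda>i. w i / t i) \<in> tangent_space N X' q"
    and "v \<in> kernel_perp N rs \<Longrightarrow> vec N (\<lambda>i. u i * v i / t i) \<in> tangent_space N X' q"
proof -
  assume w: "w \<in> kernel_field N rs"
  show "vec N (\<lambda>i. w i / t i) \<in> tangent_space N X' q" unfolding mem_tangent_space
  proof (intro conjI allI impI)
    fix F assume F: "vanishing N X' F"
    then obtain e where e: "polyfun N {e} F" unfolding vanishing_def by blast
    have "dir_deriv F (\<lambda>i. q $ i) (\<lambda>i. vec N (\<lambda>i. w i / t i) $ i) = dir_deriv F (\<lambda>i. u i / t i) (\<lambda>i. w i / t i)"
      by (rule dir_deriv_cong[OF e]) (auto simp: q_def)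
    also have "\<dots> = 0"
    proof (rule dir_deriv_eq_0[OF e])
      fix z :: 'k
      have "F (\<lambda>i. (u i + z * w i) / t i) = 0" by (rule vanishing_dual_conormal[OF F ne t kernel_field_line[OF u w]])
      thus "F (\<lambda>i. u i / t i + z * (w i / t i)) = 0" by (simp add: add_divide_distrib)
    qed
    finally show "dir_deriv F (\<lambda>i. q $ i) (\<lambda>i. vec N (\<lambda>i. w i / t i) $ i) = 0" .
  qed simp
next
  assume v: "v \<in> kernel_perp N rs"
  show "vec N (\<lambda>i. u i * v i / t i) \<in> tangent_space N X' q" unfolding mem_tangent_space
  proof (intro conjI allI impI)
    fix F assume F: "vanishing N X' F"
    then obtain e where e: "polyfun N {e} F" unfolding vanishing_def by blast
    have "dir_deriv F (\<lambda>i. q $ i) (\<lambda>i. vec N (\<lambda>i. u i * v i / t i) $ i) = dir_deriv F (\<lambda>i. u i / t i) (\<lambda>i. u i / t i * v i)"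
      by (rule dir_deriv_cong[OF e]) (auto simp: q_def)
    also have "\<dots> = dir_deriv (\<lambda>x. F (\<lambda>i. u i / t i * x i)) (\<lambda>_. 1) (\<lambda>i. 1 * v i)"
      unfolding dir_deriv_def by (simp add: distrib_left mult.left_commute)
    also have "\<dots> = 0"
    proof (rule torus_tangent[OF ones _ _ one_in_torus v])
      show "polyfun N {e} (\<lambda>x. F (\<lambda>i. u i / t i * x i))"
        by (rule hpolyfun_compose_linear[OF e]) (intro polyfun_cmult polyfun_var, auto)
      fix s :: "nat \<Rightarrow> 'k" assume s: "s \<in> torus N rs"
      have "F (\<lambda>i. u i / (t i * inverse (s i))) = 0"
        by (rule vanishing_dual_conormal[OF F ne torus_mult[OF t torus_inverse[OF s]] u])
      thus "F (\<lambda>i. u i / t i * s i) = 0" by (simp add: field_simps)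
    qed
    finally show "dir_deriv F (\<lambda>i. q $ i) (\<lambda>i. vec N (\<lambda>i. u i * v i / t i) $ i) = 0" .
  qed simp
qed

end

lemma mult_mat_vec_index:
  assumes "M \<in> carrier_mat N N" "v \<in> carrier_vec N" "i < N"
  shows "(M *\<^sub>v v) $ i = (\<Sum>j<N. M $$ (i, j) * v $ j)"
  using assms by (auto simp: scalar_prod_def atLeast0LessThan intro!: sum.cong)

lemma tangent_space_linear_image:
  fixes X :: "('k :: field_char_0) vec set"
  assumes M: "M \<in> carrier_mat N N" "B \<in> carrier_mat N N" "B * M = 1\<^sub>m N" "M * B = 1\<^sub>m N"
    and X: "X \<subseteq> carrier_vec N" and v: "v \<in> tangent_space N ((\<lambda>x. M *\<^sub>v x) ` X) q" and q: "q \<in> carrier_vec N"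
  shows "B *\<^sub>v v \<in> tangent_space N X (B *\<^sub>v q)"
  unfolding mem_tangent_space
proof (intro conjI allI impI)
  have vc: "v \<in> carrier_vec N" using v by (simp add: mem_tangent_space)
  thus "B *\<^sub>v v \<in> carrier_vec N" using M by simp
  fix F assume F: "vanishing N X F"
  then obtain e where e: "polyfun N {e} F" unfolding vanishing_def by blast
  define G where "G = (\<lambda>x. F (\<lambda>i. \<Sum>j<N. B $$ (i, j) * x j))"
  have "polyfun N {e} G" unfolding G_def
    by (rule hpolyfun_compose_linear[OF e]) (intro polyfun_sum polyfun_cmult polyfun_var, auto)
  moreover have "G (\<lambda>i. (M *\<^sub>v x) $ i) = 0" if x: "x \<in> X" for x
  proof -
    have xc: "x \<in> carrier_vec N" using x X by blast
    have "B *\<^sub>v (M *\<^sub>v x) = x"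
      by (metis M(1,2,3) assoc_mult_mat_vec one_mult_mat_vec xc)
    hence "G (\<lambda>i. (M *\<^sub>v x) $ i) = F (\<lambda>i. x $ i)" unfolding G_def
      using mult_mat_vec_index[OF M(2), of "M *\<^sub>v x"] M xc by (intro polyfun_cong[OF e]) auto
    thus ?thesis using F x by (auto simp: vanishing_def)
  qed
  ultimately have "vanishing N ((\<lambda>x. M *\<^sub>v x) ` X) G" unfolding vanishing_def by blast
  hence "dir_deriv G (\<lambda>i. q $ i) (\<lambda>i. v $ i) = 0" using v by (simp add: mem_tangent_space)
  hence "dir_deriv F (\<lambda>i. \<Sum>j<N. B $$ (i, j) * q $ j) (\<lambda>i. \<Sum>j<N. B $$ (i, j) * v $ j) = 0"
    unfolding G_def dir_deriv_compose_linear[OF e] .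
  also have "dir_deriv F (\<lambda>i. \<Sum>j<N. B $$ (i, j) * q $ j) (\<lambda>i. \<Sum>j<N. B $$ (i, j) * v $ j)
      = dir_deriv F (\<lambda>i. (B *\<^sub>v q) $ i) (\<lambda>i. (B *\<^sub>v v) $ i)"
    by (rule dir_deriv_cong[OF e]) (simp_all only: mult_mat_vec_index[OF M(2) q] mult_mat_vec_index[OF M(2) vc])
  finally show "dir_deriv F (\<lambda>i. (B *\<^sub>v q) $ i) (\<lambda>i. (B *\<^sub>v v) $ i) = 0" .
qed

subsection \<open>Self-dual toric varieties\<close>

text \<open>\<open>\<sigma>\<close> sends the index of a column listed with multiplicity to the
  index of its value among the \<open>n\<close> distinct columns, and \<open>\<rho>\<close> picks
  one copy of each. \<open>push\<close> sums over the copies, \<open>lift\<close> puts everything on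
  the chosen copy, and \<open>extra\<close> collects the other copies.\<close>

locale fibers =
  fixes N n :: nat and \<sigma> \<rho> :: "nat \<Rightarrow> nat"
  assumes \<sigma>: "i < N \<Longrightarrow> \<sigma> i < n"
    and \<rho>: "\<gamma> < n \<Longrightarrow> \<rho> \<gamma> < N" "\<gamma> < n \<Longrightarrow> \<sigma> (\<rho> \<gamma>) = \<gamma>"
begin

definition push :: "(nat \<Rightarrow> 'c :: comm_monoid_add) \<Rightarrow> nat \<Rightarrow> 'c" where
  "push u \<gamma> = (\<Sum>i<N. if \<sigma> i = \<gamma> then u i else 0)"

definition lift :: "(nat \<Rightarrow> 'c :: comm_monoid_add) \<Rightarrow> nat \<Rightarrow> 'c" where
  "lift u i = (if i = \<rho> (\<sigma> i) then u (\<sigma> i) else 0)"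

definition extra :: "nat set" where
  "extra = {i. i < N \<and> i \<noteq> \<rho> (\<sigma> i)}"

lemma finite_extra: "finite extra" by (simp add: extra_def)

lemma sum_push: "(\<Sum>i<N. f (\<sigma> i) * u i) = (\<Sum>\<gamma><n. f \<gamma> * push u \<gamma> :: 'c :: comm_ring_1)"
proof -
  have "(\<Sum>\<gamma><n. f \<gamma> * push u \<gamma>) = (\<Sum>\<gamma><n. \<Sum>i<N. if \<sigma> i = \<gamma> then f \<gamma> * u i else 0)"
    unfolding push_def sum_distrib_left by (intro sum.cong) auto
  also have "\<dots> = (\<Sum>i<N. \<Sum>\<gamma><n. if \<sigma> i = \<gamma> then f \<gamma> * u i else 0)" by (rule sum.swap)
  also have "\<dots> = (\<Sum>i<N. f (\<sigma> i) * u i)" by (rule sum.cong) (use \<sigma> in \<open>auto simp: sum.delta\<close>)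
  finally show ?thesis by simp
qed

lemma push_mult_fiber: "push (\<lambda>i. f (\<sigma> i) * u i) \<gamma> = f \<gamma> * (push u \<gamma> :: 'c :: comm_ring_1)"
  unfolding push_def sum_distrib_left by (rule sum.cong) auto

lemma push_add: "push (\<lambda>i. u i + v i) \<gamma> = push u \<gamma> + push v \<gamma>"
  unfolding push_def sum.distrib[symmetric] by (rule sum.cong) auto

lemma push_cmult: "push (\<lambda>i. c * u i) \<gamma> = c * (push u \<gamma> :: 'c :: comm_ring_1)"
  using push_mult_fiber[of "\<lambda>_. c"] .

lemma push_sum: "push (\<lambda>i. \<Sum>j\<in>I. u j i) \<gamma> = (\<Sum>j\<in>I. push (u j) \<gamma>)"
proof -
  have "push (\<lambda>i. \<Sum>j\<in>I. u j i) \<gamma> = (\<Sum>i<N. \<Sum>j\<in>I. if \<sigma> i = \<gamma> then u j i else 0)"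
    unfolding push_def by (rule sum.cong) auto
  thus ?thesis unfolding push_def by (simp add: sum.swap[of _ I])
qed

lemma push_cong: "(\<And>i. i < N \<Longrightarrow> u i = v i) \<Longrightarrow> push u \<gamma> = push v \<gamma>"
  unfolding push_def by (rule sum.cong) auto

lemma push_delta: "\<gamma> < n \<Longrightarrow> push (\<lambda>i. if \<sigma> i \<in> S \<and> i = \<rho> (\<sigma> i) then f (\<sigma> i) else 0) \<gamma> = (if \<gamma> \<in> S then f \<gamma> else 0)"
proof -
  assume \<gamma>: "\<gamma> < n"
  have "push (\<lambda>i. if \<sigma> i \<in> S \<and> i = \<rho> (\<sigma> i) then f (\<sigma> i) else 0) \<gamma> =
    (\<Sum>i<N. if i = \<rho> \<gamma> then (if \<gamma> \<in> S then f \<gamma> else 0) else 0)"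
    unfolding push_def by (rule sum.cong) (use \<rho>(2)[OF \<gamma>] in auto)
  thus ?thesis using \<rho>(1)[OF \<gamma>] by (simp add: sum.delta)
qed

lemma push_lift: "\<gamma> < n \<Longrightarrow> push (lift u) \<gamma> = u \<gamma>"
  using push_delta[of \<gamma> UNIV u] by (simp add: lift_def[abs_def])

lemma card_extra: "card extra = N - n"
proof -
  have inj: "inj_on \<rho> {..<n}" by (rule inj_onI) (metis \<rho>(2) lessThan_iff)
  have "{..<N} = extra \<union> \<rho> ` {..<n}" using \<sigma> \<rho> by (auto simp: extra_def)
  moreover have "extra \<inter> \<rho> ` {..<n} = {}" using \<rho> by (auto simp: extra_def)
  ultimately have "N = card extra + card (\<rho> ` {..<n})"
    using card_Un_disjoint[of extra "\<rho> ` {..<n}"] finite_extra by (metis card_lessThan finite_imageI finite_lessThan)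
  thus ?thesis using card_image[OF inj] by simp
qed

end

text \<open>Together the two assumptions say that the columns \<open>i\<close> and \<open>j\<close>
  of the rows coincide exactly when \<open>\<sigma> i = \<sigma> j\<close>.\<close>

locale toric_fibers = toric_rows N rs K + fibers N n \<sigma> \<rho>
  for N rs and K :: "'k :: field_char_0 itself" and n \<sigma> \<rho> +
  assumes row_const: "r \<in> set rs \<Longrightarrow> i < N \<Longrightarrow> r i = r (\<rho> (\<sigma> i))"
    and row_sep: "\<gamma> < n \<Longrightarrow> \<gamma>' < n \<Longrightarrow> (\<And>r. r \<in> set rs \<Longrightarrow> r (\<rho> \<gamma>) = r (\<rho> \<gamma>')) \<Longrightarrow> \<gamma> = \<gamma>'"
begin

definition rs' :: "(nat \<Rightarrow> int) list" where
  "rs' = map (\<lambda>r \<gamma>. r (\<rho> \<gamma>)) rs"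

definition free :: "nat set" where
  "free = {\<gamma>. \<gamma> < n \<and> (\<forall>v. row_kernel n rs' v \<longrightarrow> v \<gamma> = 0)}"

definition fiber_ind :: "nat \<Rightarrow> nat \<Rightarrow> 'k" where
  "fiber_ind \<gamma> i = (if \<sigma> i = \<gamma> then 1 else 0)"

definition extra_vec :: "nat \<Rightarrow> nat \<Rightarrow> 'k" where
  "extra_vec i l = (if l = i then 1 else 0) - (if l = \<rho> (\<sigma> i) then 1 else 0)"

lemma finite_free: "finite free" by (simp add: free_def)

lemma kernel_field_push: "u \<in> kernel_field N rs \<longleftrightarrow> push u \<in> (kernel_field n rs' :: (nat \<Rightarrow> 'k) set)"
proof -
  have "(\<Sum>i<N. of_int (r i) * u i) = (\<Sum>\<gamma><n. of_int (r (\<rho> \<gamma>)) * push u \<gamma>)" if "r \<in> set rs" for r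
    unfolding sum_push[symmetric] by (rule sum.cong) (use row_const[OF that] in auto)
  thus ?thesis unfolding kernel_field_def rs'_def by auto
qed

lemma row_kernel_push: "row_kernel N rs u \<longleftrightarrow> row_kernel n rs' (push u)"
proof -
  have "(\<Sum>i<N. r i * u i) = (\<Sum>\<gamma><n. r (\<rho> \<gamma>) * push u \<gamma>)" if "r \<in> set rs" for r
    unfolding sum_push[symmetric] by (rule sum.cong) (use row_const[OF that] in auto)
  thus ?thesis unfolding row_kernel_def rs'_def by auto
qed

lemma lift_kernel_field: "u \<in> kernel_field n rs' \<Longrightarrow> lift u \<in> (kernel_field N rs :: (nat \<Rightarrow> 'k) set)"
  unfolding kernel_field_push using kernel_field_cong[of n "push (lift u)" u rs'] by (simp add: push_lift)

lemma row_kernel_kernel_field: "row_kernel M qs v \<Longrightarrow> (\<lambda>i. of_int (v i)) \<in> (kernel_field M qs :: (nat \<Rightarrow> 'k) set)"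
  unfolding row_kernel_def kernel_field_def by (auto simp flip: of_int_mult of_int_sum)

lemma extra_vec_at_extra:
  assumes "i \<in> extra" "l \<in> extra"
  shows "extra_vec i l = (if l = i then 1 else 0)"
proof -
  have "l \<noteq> \<rho> (\<sigma> i)"
  proof
    assume "l = \<rho> (\<sigma> i)"
    moreover from this have "\<sigma> l = \<sigma> i" using assms \<rho> \<sigma> by (auto simp: extra_def)
    ultimately show False using assms by (simp add: extra_def)
  qed
  thus ?thesis by (simp add: extra_vec_def)
qed

lemma push_extra_vec:
  assumes "i \<in> extra"
  shows "push (extra_vec i) \<gamma> = 0"
proof -
  have i: "i < N" "\<rho> (\<sigma> i) < N" "\<sigma> (\<rho> (\<sigma> i)) = \<sigma> i" using assms \<rho> \<sigma> by (auto simp: extra_def)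
  have "push (extra_vec i) \<gamma> = (\<Sum>l<N. (if l = i then if \<sigma> i = \<gamma> then 1 else 0 else 0) - (if l = \<rho> (\<sigma> i) then if \<sigma> i = \<gamma> then 1 else 0 else 0))"
    unfolding push_def by (rule sum.cong) (use i in \<open>auto simp: extra_vec_def\<close>)
  also have "\<dots> = 0" using i by (simp add: sum_subtractf sum.delta)
  finally show ?thesis .
qed

text \<open>A vector with zero sum over each fiber is determined by its entries at the extra copies,
  since the chosen copy carries minus their sum; these entries are the coefficients.\<close>

lemma fiber_zero_combination:
  fixes c :: "nat \<Rightarrow> 'k"
  assumes "\<And>\<gamma>. \<gamma> < n \<Longrightarrow> push c \<gamma> = 0" "l < N"
  shows "c l = (\<Sum>i\<in>extra. c i * extra_vec i l)"
proof (cases "l \<in> extra")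
  case True
  have "(\<Sum>i\<in>extra. c i * extra_vec i l) = (\<Sum>i\<in>extra. if i = l then c l else 0)"
    by (rule sum.cong) (use extra_vec_at_extra True in auto)
  thus ?thesis using True finite_extra by (simp add: sum.delta)
next
  case False
  hence l: "l = \<rho> (\<sigma> l)" using assms(2) by (simp add: extra_def)
  have ex: "{..<N} = insert l ({..<N} - {l})" using assms(2) by auto
  have "0 = push c (\<sigma> l)" using assms \<sigma> by simp
  also have "\<dots> = c l + (\<Sum>i\<in>{..<N} - {l}. if \<sigma> i = \<sigma> l then c i else 0)"
    unfolding push_def using assms(2) by (subst ex, subst sum.insert) auto
  also have "(\<Sum>i\<in>{..<N} - {l}. if \<sigma> i = \<sigma> l then c i else 0) = (\<Sum>i\<in>extra. if \<sigma> i = \<sigma> l then c i else 0)"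
  proof (rule sum.mono_neutral_right)
    show "extra \<subseteq> {..<N} - {l}" using False by (auto simp: extra_def)
    show "\<forall>i\<in>{..<N} - {l} - extra. (if \<sigma> i = \<sigma> l then c i else 0) = 0"
    proof
      fix i assume i: "i \<in> {..<N} - {l} - extra"
      hence "i = \<rho> (\<sigma> i)" by (auto simp: extra_def)
      hence "\<sigma> i \<noteq> \<sigma> l" using l i by auto
      thus "(if \<sigma> i = \<sigma> l then c i else 0) = 0" by simp
    qed
  qed simp
  also have "\<dots> = - (\<Sum>i\<in>extra. c i * extra_vec i l)"
    unfolding sum_negf[symmetric]
  proof (rule sum.cong)
    fix i assume i: "i \<in> extra"
    have "l \<noteq> i" using i False by auto
    moreover have "l = \<rho> (\<sigma> i) \<longleftrightarrow> \<sigma> i = \<sigma> l"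
      using l \<rho>(2)[of "\<sigma> i"] \<sigma>[of i] i by (auto simp: extra_def)
    ultimately show "(if \<sigma> i = \<sigma> l then c i else 0) = - (c i * extra_vec i l)" by (simp add: extra_vec_def)
  qed simp
  finally show ?thesis by simp
qed

lemma fiber_ind_perp: "\<gamma> \<in> free \<Longrightarrow> fiber_ind \<gamma> \<in> kernel_perp N rs"
  unfolding kernel_perp_def
proof (intro CollectI allI impI)
  fix u assume \<gamma>: "\<gamma> \<in> free" and "row_kernel N rs u"
  hence "push u \<gamma> = 0" unfolding row_kernel_push free_def by blast
  moreover have "(\<Sum>i<N. of_int (u i) * fiber_ind \<gamma> i) = of_int (push u \<gamma>)"
    unfolding push_def of_int_sum by (rule sum.cong) (auto simp: fiber_ind_def)
  ultimately show "(\<Sum>i<N. of_int (u i) * fiber_ind \<gamma> i) = 0" by simp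
qed

text \<open>Freeness speaks of integer kernel vectors. It puts the indicator of the fiber into the
  row span, and this transfers it to the kernel over the field.\<close>

lemma push_free:
  assumes "u \<in> (kernel_field N rs :: (nat \<Rightarrow> 'k) set)" "\<gamma> \<in> free"
  shows "push u \<gamma> = 0"
proof -
  have "push u \<gamma> = (\<Sum>i<N. fiber_ind \<gamma> i * u i)"
    unfolding push_def by (rule sum.cong) (auto simp: fiber_ind_def)
  thus ?thesis using kernel_field_perp[OF assms(1) fiber_ind_perp[OF assms(2)]] by simp
qed

lemma torus_fiber: "t \<in> torus N rs \<Longrightarrow> i < N \<Longrightarrow> t i = t (\<rho> (\<sigma> i))"
  using \<rho> \<sigma> row_const by (intro torus_const[of t N rs]) (auto simp: torus_def)

text \<open>Distinct columns are distinct characters of the torus, hence linearly independent;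
  testing with the indicator of the class of the unit exponent at \<open>\<rho> \<gamma>\<close>
  picks out the fiber sum.\<close>

lemma linear_vanishing:
  fixes c :: "nat \<Rightarrow> 'k"
  assumes "\<And>t. t \<in> torus N rs \<Longrightarrow> (\<Sum>j<N. c j * t j) = 0" "\<gamma> < n"
  shows "push c \<gamma> = 0"
proof -
  define e :: "nat \<Rightarrow> nat \<Rightarrow> nat" where "e = (\<lambda>i l. if l = i then 1 else 0)"
  define ms where "ms = map (\<lambda>j. (c j, e j)) [0..<N]"
  define \<phi> :: "(nat \<Rightarrow> nat) \<Rightarrow> 'k" where "\<phi> = (\<lambda>b. if row_kernel N rs (exp_diff b (e (\<rho> \<gamma>))) then 1 else 0)"
  have row_e: "(\<Sum>l<N. r l * exp_diff (e i) (e j) l) = r i - r j" if "i < N" "j < N" for r i j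
  proof -
    have "(\<Sum>l<N. r l * exp_diff (e i) (e j) l) = (\<Sum>l<N. (if l = i then r i else 0) - (if l = j then r j else 0))"
      by (rule sum.cong) (auto simp: exp_diff_def e_def)
    thus ?thesis using that by (simp add: sum_subtractf sum.delta)
  qed
  have \<phi>_e: "\<phi> (e j) = fiber_ind \<gamma> j" if j: "j < N" for j
  proof -
    have "row_kernel N rs (exp_diff (e j) (e (\<rho> \<gamma>))) \<longleftrightarrow> (\<forall>r\<in>set rs. r j = r (\<rho> \<gamma>))"
      unfolding row_kernel_def using row_e[OF j \<rho>(1)[OF assms(2)]] by simp
    also have "\<dots> \<longleftrightarrow> (\<forall>r\<in>set rs. r (\<rho> (\<sigma> j)) = r (\<rho> \<gamma>))" 
    proof (rule ball_cong[OF refl])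
      fix r assume "r \<in> set rs"
      from row_const[OF this j] show "r j = r (\<rho> \<gamma>) \<longleftrightarrow> r (\<rho> (\<sigma> j)) = r (\<rho> \<gamma>)" by metis
    qed
    also have "\<dots> \<longleftrightarrow> \<sigma> j = \<gamma>" using row_sep[OF \<sigma>[OF j] assms(2)] by auto
    finally show ?thesis by (simp add: \<phi>_def fiber_ind_def)
  qed
  have "(\<Sum>(a, b)\<leftarrow>ms. a * \<phi> b) = 0"
  proof (rule class_sum[OF ones])
    fix t :: "nat \<Rightarrow> 'k" assume t: "t \<in> torus N rs"
    have "eval_terms N ms t = (\<Sum>j\<leftarrow>[0..<N]. c j * power_prod N (e j) t)"
      by (simp add: eval_terms_def ms_def o_def)
    also have "\<dots> = (\<Sum>j<N. c j * t j)"
      unfolding interv_sum_list_conv_sum_set_nat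
      by (rule sum.cong) (auto simp: e_def power_prod_unit[where n = 1, simplified])
    finally show "eval_terms N ms t = 0" using assms(1)[OF t] by simp
  next
    fix b b' assume bb: "row_kernel N rs (exp_diff b b')"
    have split: "(\<Sum>l<N. r l * exp_diff b x l) = (\<Sum>l<N. r l * exp_diff b b' l) + (\<Sum>l<N. r l * exp_diff b' x l)" for r x
      unfolding sum.distrib[symmetric] by (rule sum.cong) (auto simp: exp_diff_def simp flip: distrib_left)
    have "(\<Sum>l<N. r l * exp_diff b x l) = (\<Sum>l<N. r l * exp_diff b' x l)" if "r \<in> set rs" for r x
      using bb that unfolding split[of r x] row_kernel_def by simp
    hence "row_kernel N rs (exp_diff b x) \<longleftrightarrow> row_kernel N rs (exp_diff b' x)" for x
      unfolding row_kernel_def by (intro ball_cong refl) simp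
    thus "\<phi> b = \<phi> b'" by (simp add: \<phi>_def)
  qed
  hence "0 = (\<Sum>j\<leftarrow>[0..<N]. c j * \<phi> (e j))" by (simp add: ms_def o_def)
  also have "\<dots> = (\<Sum>j<N. c j * fiber_ind \<gamma> j)"
    unfolding interv_sum_list_conv_sum_set_nat by (rule sum.cong) (auto simp: \<phi>_e)
  also have "\<dots> = push c \<gamma>" unfolding push_def by (rule sum.cong) (auto simp: fiber_ind_def)
  finally show ?thesis by simp
qed

end

locale self_dual_fibers = toric_fibers N rs K n \<sigma> \<rho>
  for N rs n \<sigma> \<rho> and K :: "'b :: field_char_0 itself" +
  fixes M B :: "'b mat"
  assumes M: "M \<in> carrier_mat N N" and B: "B \<in> carrier_mat N N" and BM: "B * M = 1\<^sub>m N" and MB: "M * B = 1\<^sub>m N"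
    and image: "(\<lambda>v. M *\<^sub>v v) ` toric_points N rs = dual_variety N (toric_points N rs)"
begin

lemma B_M_vec: "x \<in> carrier_vec N \<Longrightarrow> B *\<^sub>v (M *\<^sub>v x) = x"
  by (metis B BM M assoc_mult_mat_vec one_mult_mat_vec)

lemma M_B_vec: "x \<in> carrier_vec N \<Longrightarrow> M *\<^sub>v (B *\<^sub>v x) = x"
  by (metis B MB M assoc_mult_mat_vec one_mult_mat_vec)

lemma X_carrier: "X \<subseteq> carrier_vec N"
  by (auto simp: toric_points_def)

lemma dual_nonempty: "X' \<noteq> {}"
  using image torus_point[OF N_pos one_in_torus, of rs] by blast

text \<open>On conormal vectors \<open>u / t\<close> the sum of the coordinates over a free fiber
  vanishes, because \<open>t\<close> is constant there and \<open>push u\<close> is zero. Composed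
  with \<open>M\<close>, these \<open>card free\<close> linear forms vanish on \<open>X\<close> and
  remain independent, while the linear forms vanishing on \<open>X\<close> are spanned by the
  \<open>N - n\<close> vectors \<open>extra_vec\<close>.\<close>

lemma card_free_le: "card free \<le> N - n"
proof -
  define c where "c = (\<lambda>\<gamma> j. \<Sum>i<N. fiber_ind \<gamma> i * M $$ (i, j))"
  have push_c: "push (c \<gamma>) \<gamma>' = 0" if \<gamma>: "\<gamma> \<in> free" and \<gamma>': "\<gamma>' < n" for \<gamma> \<gamma>'
  proof (rule linear_vanishing[OF _ \<gamma>'])
    fix t :: "nat \<Rightarrow> 'b" assume t: "t \<in> torus N rs"
    define g :: "(nat \<Rightarrow> 'b) \<Rightarrow> 'b" where "g = (\<lambda>x. \<Sum>i<N. fiber_ind \<gamma> i * x i)"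
    have "vec N t \<in> X" by (rule torus_point[OF N_pos t])
    hence "M *\<^sub>v vec N t \<in> X'" unfolding image[symmetric] by blast
    hence "g (\<lambda>i. (M *\<^sub>v vec N t) $ i) = 0"
    proof (rule dual_vanishing[rotated 2])
      show "polyfun N {1} g" unfolding g_def by (intro polyfun_sum polyfun_cmult polyfun_var) auto
    next
      fix s u :: "nat \<Rightarrow> 'b" assume su: "s \<in> torus N rs" "u \<in> kernel_field N rs"
      have "g (\<lambda>i. u i / s i) = (\<Sum>i<N. inverse (s (\<rho> \<gamma>)) * (if \<sigma> i = \<gamma> then u i else 0))"
        unfolding g_def by (rule sum.cong) (use torus_fiber[OF su(1)] in \<open>auto simp: fiber_ind_def divide_inverse\<close>)
      also have "\<dots> = inverse (s (\<rho> \<gamma>)) * push u \<gamma>" unfolding push_def sum_distrib_left ..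
      finally show "g (\<lambda>i. u i / s i) = 0" using push_free[OF su(2) \<gamma>] by simp
    qed
    moreover have "g (\<lambda>i. (M *\<^sub>v vec N t) $ i) = (\<Sum>j<N. c \<gamma> j * t j)"
    proof -
      have "g (\<lambda>i. (M *\<^sub>v vec N t) $ i) = (\<Sum>i<N. \<Sum>j<N. fiber_ind \<gamma> i * M $$ (i, j) * t j)"
        unfolding g_def by (rule sum.cong) (auto simp: mult_mat_vec_index[OF M] sum_distrib_left mult.assoc)
      also have "\<dots> = (\<Sum>j<N. c \<gamma> j * t j)"
        unfolding c_def sum_distrib_right by (rule sum.swap)
      finally show ?thesis .
    qed
    ultimately show "(\<Sum>j<N. c \<gamma> j * t j) = 0" by simp
  qed
  have "card free \<le> card extra"
  proof (rule family_card_le[where X = "{..<N}" and a = c and b = extra_vec])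
    fix \<gamma> assume "\<gamma> \<in> free"
    thus "\<exists>g. \<forall>x\<in>{..<N}. c \<gamma> x = (\<Sum>j\<in>extra. g j * extra_vec j x)"
      using fiber_zero_combination[OF push_c] by blast
  next
    fix k assume rel: "\<And>x. x \<in> {..<N} \<Longrightarrow> (\<Sum>\<gamma>\<in>free. k \<gamma> * c \<gamma> x) = 0"
    \<comment> \<open>\<open>f\<close> is the combination of the forms before composition with
      \<open>M\<close>. The relation says \<open>f M = 0\<close>, and multiplying by the inverse
      \<open>B\<close> gives \<open>f = 0\<close>.\<close>
    define f where "f = (\<lambda>i. \<Sum>\<gamma>\<in>free. k \<gamma> * fiber_ind \<gamma> i)"
    have fM: "(\<Sum>i<N. f i * M $$ (i, j)) = 0" if "j < N" for j
    proof -
      have "(\<Sum>i<N. f i * M $$ (i, j)) = (\<Sum>i<N. \<Sum>\<gamma>\<in>free. k \<gamma> * (fiber_ind \<gamma> i * M $$ (i, j)))"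
        unfolding f_def sum_distrib_right by (simp add: mult.assoc)
      also have "\<dots> = (\<Sum>\<gamma>\<in>free. k \<gamma> * c \<gamma> j)"
        unfolding c_def sum_distrib_left by (rule sum.swap)
      finally show ?thesis using rel that by simp
    qed
    have f0: "f l = 0" if l: "l < N" for l
    proof -
      have "f l = (\<Sum>i<N. f i * (1\<^sub>m N :: 'b mat) $$ (i, l))"
        using l by (simp add: if_distrib[of "\<lambda>x. _ * x"] sum.delta' cong: if_cong)
      also have "\<dots> = (\<Sum>i<N. f i * (\<Sum>j<N. M $$ (i, j) * B $$ (j, l)))"
        unfolding MB[symmetric]
        by (rule sum.cong) (use M B l in \<open>auto simp: scalar_prod_def atLeast0LessThan\<close>)
      also have "\<dots> = (\<Sum>j<N. (\<Sum>i<N. f i * M $$ (i, j)) * B $$ (j, l))"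
        unfolding sum_distrib_left sum_distrib_right by (subst sum.swap) (simp add: mult.assoc)
      also have "\<dots> = 0" by (rule sum.neutral) (use fM in auto)
      finally show ?thesis .
    qed
    show "\<forall>\<gamma>\<in>free. k \<gamma> = 0"
    proof
      fix \<gamma> assume \<gamma>: "\<gamma> \<in> free"
      hence "\<gamma> < n" by (simp add: free_def)
      have "f (\<rho> \<gamma>) = (\<Sum>\<gamma>'\<in>free. if \<gamma>' = \<gamma> then k \<gamma> else 0)"
        unfolding f_def by (rule sum.cong) (use \<rho>(2)[OF \<open>\<gamma> < n\<close>] in \<open>auto simp: fiber_ind_def\<close>)
      also have "\<dots> = k \<gamma>" using \<gamma> finite_free by (simp add: sum.delta)
      finally show "k \<gamma> = 0" using f0 \<rho>(1)[OF \<open>\<gamma> < n\<close>] by simp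
    qed
  qed (use finite_free finite_extra in auto)
  thus ?thesis by (simp add: card_extra)
qed

text \<open>Nonzero exactly when all coordinates of \<open>B\<close> applied to \<open>x\<close> are
  nonzero, so that a point of the dual corresponds to a torus point of \<open>X\<close>.\<close>

definition chart :: "(nat \<Rightarrow> 'b) \<Rightarrow> 'b" where
  "chart x = (\<Prod>i<N. \<Sum>j<N. B $$ (i, j) * x j)"

lemma polyfun_chart: "polyfun N {N} chart"
proof -
  have "polyfun N {\<Sum>i<N. 1} (\<lambda>x. \<Prod>i<N. \<Sum>j<N. B $$ (i, j) * x j)"
    by (rule hpolyfun_prod) (auto intro!: polyfun_sum polyfun_cmult polyfun_var)
  thus ?thesis by (simp add: chart_def[abs_def])
qed

text \<open>Otherwise \<open>chart\<close> would vanish on the whole dual by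
  \<open>dual_vanishing\<close>, but it takes the value \<open>1\<close> at the image of
  \<open>(1, ..., 1)\<close> under \<open>M\<close>.\<close>

lemma exists_generic_conormal:
  obtains t u where "t \<in> torus N rs" "u \<in> kernel_field N rs" "chart (\<lambda>i. u i / t i) \<noteq> 0"
proof (rule ccontr)
  assume "\<not> thesis"
  hence *: "\<And>t u. t \<in> torus N rs \<Longrightarrow> u \<in> kernel_field N rs \<Longrightarrow> chart (\<lambda>i. u i / t i) = 0" using that by blast
  define x where "x = M *\<^sub>v vec N (\<lambda>_. 1)"
  have "x \<in> X'" unfolding x_def image[symmetric] using torus_point[OF N_pos one_in_torus] by blast
  from dual_vanishing[OF polyfun_chart * this] have "chart (\<lambda>i. x $ i) = 0" by blast
  moreover have "(\<Sum>j<N. B $$ (i, j) * x $ j) = 1" if "i < N" for i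
  proof -
    have "(\<Sum>j<N. B $$ (i, j) * x $ j) = (B *\<^sub>v x) $ i"
      by (rule mult_mat_vec_index[symmetric, OF B _ that]) (use M in \<open>simp add: x_def\<close>)
    also have "\<dots> = 1" unfolding x_def using B_M_vec[of "vec N (\<lambda>_. 1)"] that by simp
    finally show ?thesis .
  qed
  ultimately show False by (simp add: chart_def)
qed

text \<open>Applying \<open>B\<close> moves the tangent space of the dual at \<open>q\<close> into
  the tangent space of \<open>X\<close> at a torus point, which is that point times the row span.
  Applying \<open>M\<close> again yields \<open>length rs\<close> vectors; the factor
  \<open>t i\<close> only turns tangent vectors \<open>x / t\<close> into \<open>x\<close>.\<close>

lemma tangent_span:
  fixes t u x :: "nat \<Rightarrow> 'b"
  assumes t: "t \<in> torus N rs" and u: "u \<in> kernel_field N rs" and ch: "chart (\<lambda>i. u i / t i) \<noteq> 0"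
  defines "q \<equiv> vec N (\<lambda>i. u i / t i)"
  assumes x: "vec N (\<lambda>i. x i / t i) \<in> tangent_space N X' q"
  shows "\<exists>c. \<forall>i<N. x i = (\<Sum>k<length rs. c k * (t i * (\<Sum>j<N. M $$ (i, j) * ((B *\<^sub>v q) $ j * of_int ((rs ! k) j)))))"
proof -
  have qc: "q \<in> carrier_vec N" by (simp add: q_def)
  have coord: "(B *\<^sub>v q) $ i = (\<Sum>j<N. B $$ (i, j) * (u j / t j))" if "i < N" for i
    unfolding mult_mat_vec_index[OF B qc that] by (rule sum.cong) (auto simp: q_def)
  have p_nz: "(B *\<^sub>v q) $ i \<noteq> 0" if "i < N" for i
  proof -
    have "(\<Sum>j<N. B $$ (i, j) * (u j / t j)) \<noteq> 0" using ch that unfolding chart_def by auto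
    thus ?thesis using coord[OF that] by simp
  qed
  have "q \<noteq> 0\<^sub>v N"
  proof
    assume "q = 0\<^sub>v N"
    hence "(B *\<^sub>v q) $ 0 = 0" using mult_mat_vec_index[OF B qc N_pos] N_pos by simp
    thus False using p_nz[OF N_pos] by simp
  qed
  hence "q \<in> X'" using conormal_in_dual[OF t u] by (simp add: q_def)
  then obtain y where y: "y \<in> X" "q = M *\<^sub>v y" unfolding image[symmetric] by blast
  have Bq: "B *\<^sub>v q = y" using y B_M_vec X_carrier by blast
  have p: "B *\<^sub>v q \<in> carrier_vec N" "(\<lambda>i. (B *\<^sub>v q) $ i) \<in> torus N rs"
    using B qc p_nz y(1) unfolding torus_def Bq toric_points_def by auto
  define v where "v = vec N (\<lambda>i. x i / t i)"
  have "B *\<^sub>v v \<in> tangent_space N X (B *\<^sub>v q)"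
    by (rule tangent_space_linear_image[OF M B BM MB X_carrier _ qc]) (use x in \<open>simp add: image v_def\<close>)
  hence "(\<lambda>i. (B *\<^sub>v v) $ i / (B *\<^sub>v q) $ i) \<in> kernel_perp N rs"
    unfolding tangent_space_torus[OF N_pos ones p] by simp
  then obtain c where c: "\<And>i. i < N \<Longrightarrow> (B *\<^sub>v v) $ i / (B *\<^sub>v q) $ i = (\<Sum>k<length rs. c k * of_int ((rs ! k) i))"
    unfolding kernel_perp_eq_row_span by blast
  have "x i = (\<Sum>k<length rs. c k * (t i * (\<Sum>j<N. M $$ (i, j) * ((B *\<^sub>v q) $ j * of_int ((rs ! k) j)))))" if i: "i < N" for i
  proof -
    have vc: "v \<in> carrier_vec N" "B *\<^sub>v v \<in> carrier_vec N" using B by (auto simp: v_def)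
    have "x i = t i * v $ i" using t i by (auto simp: v_def torus_def)
    also have "v $ i = (\<Sum>j<N. M $$ (i, j) * (B *\<^sub>v v) $ j)"
      using mult_mat_vec_index[OF M vc(2) i] M_B_vec[OF vc(1)] by simp
    also have "\<dots> = (\<Sum>j<N. \<Sum>k<length rs. c k * (M $$ (i, j) * ((B *\<^sub>v q) $ j * of_int ((rs ! k) j))))"
    proof (rule sum.cong)
      fix j assume j: "j \<in> {..<N}"
      have "(B *\<^sub>v v) $ j = (B *\<^sub>v q) $ j * (\<Sum>k<length rs. c k * of_int ((rs ! k) j))"
        using c[of j] p_nz[of j] j by (simp add: field_simps)
      thus "M $$ (i, j) * (B *\<^sub>v v) $ j = (\<Sum>k<length rs. c k * (M $$ (i, j) * ((B *\<^sub>v q) $ j * of_int ((rs ! k) j))))"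
        by (simp add: sum_distrib_left mult_ac)
    qed simp
    also have "\<dots> = (\<Sum>k<length rs. c k * (\<Sum>j<N. M $$ (i, j) * ((B *\<^sub>v q) $ j * of_int ((rs ! k) j))))"
      by (subst sum.swap) (simp add: sum_distrib_left)
    finally show ?thesis by (simp add: sum_distrib_left mult_ac)
  qed
  thus ?thesis by blast
qed

text \<open>The affine tangent space of \<open>X'\<close> at \<open>q = u / t\<close> has dimension \<open>length rs\<close>, and contains the
  conormal space and the tangent space of the torus orbit of \<open>q\<close>. Comparing dimensions leaves
  no room for the conormal space outside that of the orbit, except for the fibers.\<close>

lemma generic_conormal_span:
  fixes t u :: "nat \<Rightarrow> 'b"
  assumes t: "t \<in> torus N rs" and u: "u \<in> kernel_field N rs" and ch: "chart (\<lambda>i. u i / t i) \<noteq> 0"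
    and supp: "\<And>\<gamma>. \<gamma> < n \<Longrightarrow> \<gamma> \<notin> free \<Longrightarrow> push u \<gamma> \<noteq> 0"
  shows "N - n \<le> card free"
    and "w \<in> kernel_field N rs \<Longrightarrow> \<exists>c. \<forall>\<gamma><n. \<gamma> \<notin> free \<longrightarrow>
      push w \<gamma> = (\<Sum>k<length rs. c k * of_int ((rs ! k) (\<rho> \<gamma>))) * push u \<gamma>"
proof -
  define d where "d = length rs"
  define q where "q = vec N (\<lambda>i. u i / t i)"
  define bM where "bM = (\<lambda>k i. t i * (\<Sum>j<N. M $$ (i, j) * ((B *\<^sub>v q) $ j * of_int ((rs ! k) j))))"
  define un where "un = (\<lambda>\<gamma> i. if i = \<rho> \<gamma> then 1 else 0 :: 'b)"
  define b where "b = case_sum bM un"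
  define Jb where "Jb = {..<d} <+> free"
  define sp where "sp = (\<lambda>x. \<exists>g. \<forall>i\<in>{..<N}. x i = (\<Sum>j\<in>Jb. g j * b j i))"
  \<comment> \<open>\<open>push u\<close> is zero at free indices, so the orbit directions alone
    could be dependent. Adding \<open>1\<close> at the chosen copy of each free fiber makes
    \<open>push u'\<close> nowhere zero; the unit vectors \<open>un\<close> in the spanning family
    pay for this change.\<close>
  define u' where "u' = (\<lambda>i. u i + (if \<sigma> i \<in> free \<and> i = \<rho> (\<sigma> i) then 1 else 0))"
  define a where "a = case_sum extra_vec (\<lambda>k i. u' i * of_int ((rs ! k) i))"
  define I where "I = extra <+> {..<d}"
  have sum_Jb: "(\<Sum>j\<in>Jb. g j * b j i) = (\<Sum>k<d. g (Inl k) * bM k i) + (\<Sum>\<gamma>\<in>free. g (Inr \<gamma>) * un \<gamma> i)" for g i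
    unfolding Jb_def using finite_free by (subst sum.Plus) (auto simp: b_def)
  have sum_I: "(\<Sum>j\<in>I. c j * a j i) = (\<Sum>j\<in>extra. c (Inl j) * extra_vec j i) + (\<Sum>k<d. c (Inr k) * (u' i * of_int ((rs ! k) i)))" for c i
    unfolding I_def using finite_extra by (subst sum.Plus) (auto simp: a_def)
  \<comment> \<open>The independent family has \<open>(N - n) + d\<close> members and the spanning
    one \<open>d + card free\<close>, so the comparison is between \<open>N - n\<close> and
    \<open>card free\<close>.\<close>
  have cardI: "card I = (N - n) + d" and cardJ: "card Jb = d + card free"
    unfolding I_def Jb_def using finite_extra finite_free by (simp_all add: card_Plus card_extra)
  have fin: "finite I" "finite Jb" using finite_extra finite_free by (auto simp: I_def Jb_def)
  have sp_tangent: "sp x" if tang: "vec N (\<lambda>i. x i / t i) \<in> tangent_space N X' q" for x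
  proof -
    obtain c where c: "\<forall>i<N. x i = (\<Sum>k<d. c k * bM k i)"
      using tangent_span[OF t u ch tang[unfolded q_def]] unfolding bM_def d_def q_def by blast
    have "\<forall>i\<in>{..<N}. x i = (\<Sum>j\<in>Jb. case_sum c (\<lambda>_. 0) j * b j i)"
      unfolding sum_Jb using c by simp
    thus ?thesis unfolding sp_def by blast
  qed
  have sp_kernel: "sp w" if "w \<in> kernel_field N rs" for w
    by (rule sp_tangent) (use tangent_dual(1)[OF t u dual_nonempty that] in \<open>simp add: q_def\<close>)
  have sp_a: "sp (a i)" if "i \<in> I" for i
  proof (cases i)
    case (Inl j)
    hence j: "j \<in> extra" using that by (auto simp: I_def)
    have "extra_vec j \<in> kernel_field N rs"
      unfolding kernel_field_push using push_extra_vec[OF j] by (simp add: kernel_field_def)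
    from sp_kernel[OF this] show ?thesis by (simp add: a_def Inl)
  next
    case (Inr k)
    hence k: "k < d" using that by (auto simp: I_def)
    have "rs ! k \<in> set rs" using k by (simp add: d_def)
    have "sp (\<lambda>i. u i * of_int ((rs ! k) i))"
      by (rule sp_tangent) (use tangent_dual(2)[OF t u dual_nonempty row_in_kernel_perp[OF \<open>rs ! k \<in> set rs\<close>]] in \<open>simp add: q_def\<close>)
    then obtain g where g: "\<forall>i\<in>{..<N}. u i * of_int ((rs ! k) i) = (\<Sum>j\<in>Jb. g j * b j i)" unfolding sp_def by blast
    define h where "h = (\<lambda>j. g j + case_sum (\<lambda>_. 0) (\<lambda>\<gamma>. of_int ((rs ! k) (\<rho> \<gamma>))) j)"
    have "a i l = (\<Sum>j\<in>Jb. h j * b j l)" if l: "l < N" for l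
    proof -
      have "(\<Sum>j\<in>Jb. h j * b j l) = (\<Sum>j\<in>Jb. g j * b j l) + (\<Sum>\<gamma>\<in>free. of_int ((rs ! k) (\<rho> \<gamma>)) * un \<gamma> l)"
        unfolding sum_Jb by (simp add: h_def distrib_right sum.distrib)
      also have "(\<Sum>\<gamma>\<in>free. of_int ((rs ! k) (\<rho> \<gamma>)) * un \<gamma> l) = (\<Sum>\<gamma>\<in>free. if \<gamma> = \<sigma> l then (if l = \<rho> (\<sigma> l) then of_int ((rs ! k) l) else 0) else 0)"
      proof (rule sum.cong)
        fix \<gamma> assume "\<gamma> \<in> free"
        hence "\<sigma> (\<rho> \<gamma>) = \<gamma>" using \<rho> by (auto simp: free_def)
        thus "of_int ((rs ! k) (\<rho> \<gamma>)) * un \<gamma> l = (if \<gamma> = \<sigma> l then if l = \<rho> (\<sigma> l) then of_int ((rs ! k) l) else 0 else 0)"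
          by (auto simp: un_def)
      qed simp
      also have "\<dots> = (if \<sigma> l \<in> free \<and> l = \<rho> (\<sigma> l) then of_int ((rs ! k) l) else 0)"
        using finite_free by (simp add: sum.delta)
      finally have "(\<Sum>j\<in>Jb. h j * b j l) = u l * of_int ((rs ! k) l) + (if \<sigma> l \<in> free \<and> l = \<rho> (\<sigma> l) then of_int ((rs ! k) l) else 0)"
        using g l by simp
      thus ?thesis by (simp add: a_def Inr u'_def distrib_right)
    qed
    thus ?thesis unfolding sp_def by blast
  qed
  have push_u': "push u' \<gamma> = (if \<gamma> \<in> free then 1 else push u \<gamma>)" if "\<gamma> < n" for \<gamma>
    unfolding u'_def push_add push_delta[OF that, of free "\<lambda>_. 1"] using push_free[OF u] by auto
  have push_u'_nz: "push u' \<gamma> \<noteq> 0" if "\<gamma> < n" for \<gamma>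
    using supp[OF that] push_u'[OF that] by auto
  \<comment> \<open>\<open>push\<close> kills the vectors \<open>extra_vec\<close>, and rows are
    constant on fibers, so only a combination of rows times \<open>push u'\<close> remains.\<close>
  have push_comb: "push (\<lambda>i. \<Sum>j\<in>I. c j * a j i) \<gamma> = (\<Sum>k<d. c (Inr k) * of_int ((rs ! k) (\<rho> \<gamma>))) * push u' \<gamma>"
    if \<gamma>: "\<gamma> < n" for c \<gamma>
  proof -
    have "push (\<lambda>i. \<Sum>j\<in>extra. c (Inl j) * extra_vec j i) \<gamma> = 0"
      unfolding push_sum push_cmult by (rule sum.neutral) (auto simp: push_extra_vec)
    moreover have "push (\<lambda>i. \<Sum>k<d. c (Inr k) * (u' i * of_int ((rs ! k) i))) \<gamma>
      = push (\<lambda>i. (\<Sum>k<d. c (Inr k) * of_int ((rs ! k) (\<rho> (\<sigma> i)))) * u' i) \<gamma>"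
    proof (rule push_cong)
      fix i assume i: "i < N"
      have "(rs ! k) i = (rs ! k) (\<rho> (\<sigma> i))" if "k < d" for k
        by (rule row_const[OF _ i]) (use that in \<open>simp add: d_def\<close>)
      thus "(\<Sum>k<d. c (Inr k) * (u' i * of_int ((rs ! k) i))) = (\<Sum>k<d. c (Inr k) * of_int ((rs ! k) (\<rho> (\<sigma> i)))) * u' i"
        unfolding sum_distrib_right by (intro sum.cong) (auto simp: mult_ac)
    qed
    ultimately show ?thesis unfolding sum_I push_add
      using push_mult_fiber[of "\<lambda>\<gamma>. \<Sum>k<d. c (Inr k) * of_int ((rs ! k) (\<rho> \<gamma>))" u' \<gamma>] by simp
  qed
  have indepI: "\<forall>i\<in>I. c i = 0" if rel: "\<And>l. l \<in> {..<N} \<Longrightarrow> (\<Sum>i\<in>I. c i * a i l) = 0" for c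
  proof -
    have "push (\<lambda>l. \<Sum>i\<in>I. c i * a i l) \<gamma> = push (\<lambda>_. 0) \<gamma>" for \<gamma>
      by (rule push_cong) (use rel in auto)
    hence "push (\<lambda>l. \<Sum>i\<in>I. c i * a i l) \<gamma> = 0" for \<gamma> by (simp add: push_def)
    hence r0: "(\<Sum>k<d. c (Inr k) * of_int ((rs ! k) (\<rho> \<gamma>))) = 0" if "\<gamma> < n" for \<gamma>
      using push_comb[OF that, of c] push_u'_nz[OF that] by auto
    have "(\<Sum>k<length rs. c (Inr k) * of_int ((rs ! k) i)) = 0" if i: "i < N" for i
    proof -
      have "(\<Sum>k<length rs. c (Inr k) * of_int ((rs ! k) i)) = (\<Sum>k<d. c (Inr k) * of_int ((rs ! k) (\<rho> (\<sigma> i))))"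
        unfolding d_def by (rule sum.cong) (use row_const[OF _ i] in auto)
      thus ?thesis using r0 \<sigma>[OF i] by simp
    qed
    hence "\<forall>i<N. (\<Sum>k<length rs. c (Inr k) * of_int ((rs ! k) i)) = 0" by blast
    hence cr: "\<forall>k<d. c (Inr k) = 0" unfolding d_def
      by (rule indep[unfolded independent_rows_def, THEN spec, THEN mp])
    have cl: "c (Inl j) = 0" if j: "j \<in> extra" for j
    proof -
      have "j < N" using j by (simp add: extra_def)
      hence "0 = (\<Sum>i\<in>extra. c (Inl i) * extra_vec i j)" using rel[of j] cr unfolding sum_I by simp
      also have "\<dots> = (\<Sum>i\<in>extra. if i = j then c (Inl j) else 0)"
        by (rule sum.cong) (use extra_vec_at_extra[OF _ j] in auto)
      also have "\<dots> = c (Inl j)" using j finite_extra by (simp add: sum.delta)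
      finally show ?thesis by simp
    qed
    show ?thesis using cr cl by (auto simp: I_def)
  qed
  have "card I \<le> card Jb"
  proof (rule family_card_le[OF fin, where X = "{..<N}" and a = a and b = b])
    fix i assume "i \<in> I"
    from sp_a[OF this] show "\<exists>g. \<forall>x\<in>{..<N}. a i x = (\<Sum>j\<in>Jb. g j * b j x)" unfolding sp_def .
  qed (rule indepI)
  thus "N - n \<le> card free" unfolding cardI cardJ by simp
  assume w: "w \<in> kernel_field N rs"
  \<comment> \<open>By \<open>card_free_le\<close> the spanning family has no more members than the
    independent one, so the independent family spans as well and \<open>w\<close> is a combination
    of it.\<close>
  have "\<exists>c. \<forall>l\<in>{..<N}. w l = (\<Sum>i\<in>I. c i * a i l)"
  proof (rule family_spans[OF fin, where X = "{..<N}" and a = a and b = b])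
    show "card Jb \<le> card I" unfolding cardI cardJ using card_free_le by simp
    fix i assume "i \<in> I"
    from sp_a[OF this] show "\<exists>g. \<forall>x\<in>{..<N}. a i x = (\<Sum>j\<in>Jb. g j * b j x)" unfolding sp_def .
  next
    show "\<exists>g. \<forall>x\<in>{..<N}. w x = (\<Sum>j\<in>Jb. g j * b j x)" using sp_kernel[OF w] unfolding sp_def .
  qed (rule indepI)
  then obtain c where c: "\<And>l. l < N \<Longrightarrow> w l = (\<Sum>i\<in>I. c i * a i l)" by auto
  have "push w \<gamma> = (\<Sum>k<length rs. c (Inr k) * of_int ((rs ! k) (\<rho> \<gamma>))) * push u \<gamma>"
    if "\<gamma> < n" "\<gamma> \<notin> free" for \<gamma>
  proof -
    have "push w \<gamma> = push (\<lambda>l. \<Sum>i\<in>I. c i * a i l) \<gamma>" by (rule push_cong) (rule c)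
    thus ?thesis unfolding push_comb[OF that(1)] push_u'[OF that(1)] using that(2) by (simp add: d_def)
  qed
  thus "\<exists>c. \<forall>\<gamma><n. \<gamma> \<notin> free \<longrightarrow> push w \<gamma> = (\<Sum>k<length rs. c k * of_int ((rs ! k) (\<rho> \<gamma>))) * push u \<gamma>"
    by (intro exI[of _ "\<lambda>k. c (Inr k)"]) auto
qed

section \<open>Generic conormal vectors and the logarithmic derivative\<close>

lemma push_nonzero_nonfree:
  assumes "\<gamma> < n" "\<gamma> \<notin> free"
  shows "\<exists>u\<in>(kernel_field N rs :: (nat \<Rightarrow> 'b) set). push u \<gamma> \<noteq> 0"
proof -
  obtain v where v: "row_kernel n rs' v" "v \<gamma> \<noteq> 0" using assms by (auto simp: free_def)
  have "lift (\<lambda>i. of_int (v i)) \<in> (kernel_field N rs :: (nat \<Rightarrow> 'b) set)"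
    by (rule lift_kernel_field[OF row_kernel_kernel_field[OF v(1)]])
  thus ?thesis using push_lift[OF assms(1), of "\<lambda>i. of_int (v i) :: 'b"] v(2) by (intro bexI) auto
qed

lemma polyfun_push: "polyfun N UNIV (\<lambda>u :: nat \<Rightarrow> 'b. push u \<gamma>)"
proof -
  have "(\<lambda>u :: nat \<Rightarrow> 'b. push u \<gamma>) = (\<lambda>u. \<Sum>i<N. (if \<sigma> i = \<gamma> then 1 else 0) * u i)"
    unfolding push_def by (auto intro!: sum.cong)
  moreover have "polyfun N UNIV (\<lambda>u :: nat \<Rightarrow> 'b. \<Sum>i<N. (if \<sigma> i = \<gamma> then 1 else 0) * u i)"
    by (intro polyfun_sum polyfun_cmult polyfun_var) auto
  ultimately show ?thesis by (simp only:)
qed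

text \<open>Its nonvanishing collects the genericity hypotheses of
  \<open>generic_conormal_span\<close>; for fixed \<open>t\<close> it is polynomial in
  \<open>u\<close>.\<close>

definition generic :: "(nat \<Rightarrow> 'b) \<Rightarrow> (nat \<Rightarrow> 'b) \<Rightarrow> 'b" where
  "generic t u = chart (\<lambda>i. u i / t i) * (\<Prod>\<gamma>\<in>{..<n} - free. push u \<gamma>)"

lemma polyfun_generic: "polyfun N UNIV (generic t)"
proof -
  have "polyfun N UNIV (\<lambda>u. chart (\<lambda>i. inverse (t i) * u i))"
    by (rule polyfun_UNIV_compose[OF polyfun_UNIV[OF polyfun_chart]]) (intro polyfun_cmult polyfun_var, auto)
  hence "polyfun N UNIV (\<lambda>u. chart (\<lambda>i. u i / t i))" by (simp add: divide_inverse mult.commute)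
  thus ?thesis unfolding generic_def[abs_def]
    by (intro polyfun_UNIV_mult polyfun_UNIV_prod polyfun_push)
qed

text \<open>With \<open>t\<close> fixed, both factors are polynomials in \<open>u\<close> that are
  nonzero somewhere on the linear space of kernel vectors, hence so is their product.\<close>

lemma exists_generic:
  obtains t u where "t \<in> torus N rs" "u \<in> kernel_field N rs" "generic t u \<noteq> 0"
proof -
  obtain t u where tu: "t \<in> torus N rs" "u \<in> kernel_field N rs" "chart (\<lambda>i. u i / t i) \<noteq> 0"
    using exists_generic_conormal by blast
  obtain u2 where u2: "u2 \<in> kernel_field N rs" "(\<Prod>\<gamma>\<in>{..<n} - free. push u2 \<gamma> :: 'b) \<noteq> 0"
    using kernel_field_prod_nonzero[of "{..<n} - free" N "\<lambda>\<gamma> u. push u \<gamma>" N rs] polyfun_push push_nonzero_nonfree by auto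
  have P: "polyfun N UNIV (\<lambda>u. chart (\<lambda>i. u i / t i))"
  proof -
    have "polyfun N UNIV (\<lambda>u. chart (\<lambda>i. inverse (t i) * u i))"
      by (rule polyfun_UNIV_compose[OF polyfun_UNIV[OF polyfun_chart]]) (intro polyfun_cmult polyfun_var, auto)
    thus ?thesis by (simp add: divide_inverse mult.commute)
  qed
  have Q: "polyfun N UNIV (\<lambda>u. \<Prod>\<gamma>\<in>{..<n} - free. push u \<gamma> :: 'b)"
    by (intro polyfun_UNIV_prod polyfun_push)
  have "\<exists>u\<in>kernel_field N rs. generic t u \<noteq> 0"
  proof (rule ccontr)
    assume "\<not> ?thesis"
    hence "chart (\<lambda>i. u i / t i) * (\<Prod>\<gamma>\<in>{..<n} - free. push u \<gamma>) = 0" if "u \<in> kernel_field N rs" for u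
      using that by (auto simp: generic_def)
    from kernel_field_irreducible[OF P Q this tu(2,3) u2(1)] u2(2) show False by blast
  qed
  thus ?thesis using that tu(1) by blast
qed

lemma card_free: "card free = N - n"
proof -
  obtain t u where tu: "t \<in> torus N rs" "u \<in> kernel_field N rs" "generic t u \<noteq> 0" by (rule exists_generic)
  have "push u \<gamma> \<noteq> 0" if "\<gamma> < n" "\<gamma> \<notin> free" for \<gamma> using tu(3) that by (auto simp: generic_def)
  thus ?thesis using generic_conormal_span(1)[OF tu(1,2)] tu(3) card_free_le by (fastforce simp: generic_def)
qed

text \<open>Divided by the product of all \<open>u \<gamma>\<close>, the left side is the derivative
  of the logarithm of \<open>u ^ v\<close> in direction \<open>w\<close>. For generic
  \<open>u\<close> the quotient \<open>w / u\<close> is a combination of rows on the nonfree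
  indices, which \<open>v\<close> annihilates, being zero at the free ones. With denominators
  cleared the identity is polynomial and extends to all \<open>u\<close>.\<close>

lemma logarithmic_identity:
  fixes w u :: "nat \<Rightarrow> 'b"
  assumes v: "row_kernel n rs' v" and w: "w \<in> kernel_field n rs'" and u: "u \<in> kernel_field n rs'"
  shows "(\<Sum>\<gamma>\<in>{..<n} - free. of_int (v \<gamma>) * w \<gamma> * (\<Prod>\<gamma>'\<in>{..<n} - free - {\<gamma>}. u \<gamma>')) = 0"
proof -
  obtain t u0 where tu: "t \<in> torus N rs" "u0 \<in> kernel_field N rs" "generic t u0 \<noteq> 0" by (rule exists_generic)
  define P where "P = (\<lambda>x :: nat \<Rightarrow> 'b. \<Sum>\<gamma>\<in>{..<n} - free. (of_int (v \<gamma>) * w \<gamma>) * (\<Prod>\<gamma>'\<in>{..<n} - free - {\<gamma>}. push x \<gamma>'))"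
  have "P (lift u) = 0"
  proof (rule kernel_field_irreducible[OF polyfun_generic[of t] _ _ tu(2,3) lift_kernel_field[OF u]])
    show "polyfun N UNIV P" unfolding P_def
      by (intro polyfun_sum polyfun_cmult polyfun_UNIV_prod polyfun_push)
    fix x :: "nat \<Rightarrow> 'b" assume x: "x \<in> kernel_field N rs"
    show "generic t x * P x = 0"
    proof (cases "generic t x = 0")
      case False
      hence ch: "chart (\<lambda>i. x i / t i) \<noteq> 0" and nz: "\<And>\<gamma>. \<gamma> < n \<Longrightarrow> \<gamma> \<notin> free \<Longrightarrow> push x \<gamma> \<noteq> 0"
        by (auto simp: generic_def)
      obtain c where c: "\<And>\<gamma>. \<gamma> < n \<Longrightarrow> \<gamma> \<notin> free \<Longrightarrow> push (lift w) \<gamma> = (\<Sum>k<length rs. c k * of_int ((rs ! k) (\<rho> \<gamma>))) * push x \<gamma>"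
        using generic_conormal_span(2)[OF tu(1) x ch nz lift_kernel_field[OF w]] by blast
      have "P x = (\<Sum>\<gamma>\<in>{..<n} - free. (of_int (v \<gamma>) * (\<Sum>k<length rs. c k * of_int ((rs ! k) (\<rho> \<gamma>)))) * (\<Prod>\<gamma>'\<in>{..<n} - free. push x \<gamma>'))"
        unfolding P_def
      proof (rule sum.cong)
        fix \<gamma> assume \<gamma>: "\<gamma> \<in> {..<n} - free"
        have "(\<Prod>\<gamma>'\<in>{..<n} - free. push x \<gamma>') = push x \<gamma> * (\<Prod>\<gamma>'\<in>{..<n} - free - {\<gamma>}. push x \<gamma>')"
          by (rule prod.remove) (use \<gamma> in auto)
        thus "of_int (v \<gamma>) * w \<gamma> * (\<Prod>\<gamma>'\<in>{..<n} - free - {\<gamma>}. push x \<gamma>') =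
          (of_int (v \<gamma>) * (\<Sum>k<length rs. c k * of_int ((rs ! k) (\<rho> \<gamma>)))) * (\<Prod>\<gamma>'\<in>{..<n} - free. push x \<gamma>')"
          using c[of \<gamma>] push_lift[of \<gamma> w] \<gamma> by (simp add: mult_ac)
      qed simp
      also have "\<dots> = (\<Sum>\<gamma>\<in>{..<n} - free. of_int (v \<gamma>) * (\<Sum>k<length rs. c k * of_int ((rs ! k) (\<rho> \<gamma>)))) * (\<Prod>\<gamma>'\<in>{..<n} - free. push x \<gamma>')"
        by (rule sum_distrib_right[symmetric])
      also have "(\<Sum>\<gamma>\<in>{..<n} - free. of_int (v \<gamma>) * (\<Sum>k<length rs. c k * of_int ((rs ! k) (\<rho> \<gamma>)))) =
        (\<Sum>\<gamma><n. of_int (v \<gamma>) * (\<Sum>k<length rs. c k * of_int ((rs ! k) (\<rho> \<gamma>))))"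
        by (rule sum.mono_neutral_left) (use v in \<open>auto simp: free_def\<close>)
      also have "\<dots> = (\<Sum>\<gamma><n. \<Sum>k<length rs. c k * of_int ((rs ! k) (\<rho> \<gamma>) * v \<gamma>))"
        by (simp add: sum_distrib_left mult_ac)
      also have "\<dots> = (\<Sum>k<length rs. c k * of_int (\<Sum>\<gamma><n. (rs ! k) (\<rho> \<gamma>) * v \<gamma>))"
        by (subst sum.swap) (simp add: sum_distrib_left)
      also have "\<dots> = 0" using v by (auto simp: row_kernel_def rs'_def)
      finally show ?thesis by simp
    qed simp
  qed
  moreover have "P (lift u) = (\<Sum>\<gamma>\<in>{..<n} - free. of_int (v \<gamma>) * w \<gamma> * (\<Prod>\<gamma>'\<in>{..<n} - free - {\<gamma>}. u \<gamma>'))"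
    unfolding P_def by (intro sum.cong prod.cong arg_cong2[of _ _ _ _ "(*)"]) (auto simp: push_lift)
  ultimately show ?thesis by simp
qed

end

subsection \<open>Proportionality classes of coordinates\<close>

lemma row_kernel_comb: "row_kernel n qs x \<Longrightarrow> row_kernel n qs y \<Longrightarrow> row_kernel n qs (\<lambda>i. a * x i + z * y i)"
  by (auto simp: row_kernel_def distrib_left sum.distrib mult.left_commute[of _ a] mult.left_commute[of _ z]
      simp flip: sum_distrib_left)

text \<open>A multiple \<open>z\<close> of a kernel vector nonzero at the new index is added; only
  finitely many integers \<open>z\<close> make one of the coordinates vanish.\<close>

lemma exists_full_support_row_kernel:
  assumes "finite \<Gamma>" "\<And>\<gamma>. \<gamma> \<in> \<Gamma> \<Longrightarrow> \<exists>x. row_kernel n qs x \<and> x \<gamma> \<noteq> 0"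
  shows "\<exists>x. row_kernel n qs x \<and> (\<forall>\<gamma>\<in>\<Gamma>. x \<gamma> \<noteq> 0)"
  using assms
proof (induction \<Gamma> rule: finite_induct)
  case empty
  show ?case by (rule exI[of _ "\<lambda>_. 0"]) (simp add: row_kernel_def)
next
  case (insert \<gamma> \<Gamma>)
  obtain x where x: "row_kernel n qs x" "\<forall>\<gamma>\<in>\<Gamma>. x \<gamma> \<noteq> 0" using insert by auto
  obtain y where y: "row_kernel n qs y" "y \<gamma> \<noteq> 0" using insert.prems by auto
  have "finite {z :: int. x \<delta> + z * y \<delta> = 0}" if "\<delta> \<in> insert \<gamma> \<Gamma>" for \<delta>
  proof (cases "y \<delta> = 0")
    case True
    hence "x \<delta> \<noteq> 0" using that x y by auto
    thus ?thesis using True by simp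
  next
    case False
    have "{z :: int. x \<delta> + z * y \<delta> = 0} \<subseteq> {- x \<delta> div y \<delta>}"
    proof
      fix z assume "z \<in> {z. x \<delta> + z * y \<delta> = 0}"
      hence "- x \<delta> = z * y \<delta>" by simp
      thus "z \<in> {- x \<delta> div y \<delta>}" using False by simp
    qed
    thus ?thesis by (rule finite_subset) simp
  qed
  hence "finite (\<Union>\<delta>\<in>insert \<gamma> \<Gamma>. {z :: int. x \<delta> + z * y \<delta> = 0})" using insert.hyps by blast
  then obtain z where z: "z \<notin> (\<Union>\<delta>\<in>insert \<gamma> \<Gamma>. {z :: int. x \<delta> + z * y \<delta> = 0})"
    using ex_new_if_finite[OF infinite_UNIV_int] by blast
  have "row_kernel n qs (\<lambda>i. 1 * x i + z * y i)" by (rule row_kernel_comb[OF x(1) y(1)])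
  thus ?case using z by (intro exI[of _ "\<lambda>i. 1 * x i + z * y i"]) auto
qed

text \<open>Two coordinates are proportional on the kernel iff their Gale duals lie on a common line.\<close>

definition proportional :: "nat \<Rightarrow> (nat \<Rightarrow> int) list \<Rightarrow> nat \<Rightarrow> nat \<Rightarrow> bool" where
  "proportional n qs \<gamma> \<delta> \<longleftrightarrow> (\<forall>u v. row_kernel n qs u \<longrightarrow> row_kernel n qs v \<longrightarrow> u \<gamma> * v \<delta> = v \<gamma> * u \<delta>)"

text \<open>The identity says that \<open>\<Sum> v\<^sub>\<gamma> w\<^sub>\<gamma> / u\<^sub>\<gamma>\<close> vanishes. Letting \<open>u\<close> tend to a point at which
  exactly the coordinates proportional to the given one vanish, its residue is the class sum.\<close>

lemma class_sum_zero:
  fixes K :: "'k :: field_char_0 itself"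
  assumes ident: "\<And>v w u. row_kernel n qs v \<Longrightarrow> w \<in> kernel_field n qs \<Longrightarrow> u \<in> kernel_field n qs \<Longrightarrow>
      (\<Sum>\<gamma>\<in>\<Gamma>. of_int (v \<gamma>) * w \<gamma> * (\<Prod>\<gamma>'\<in>\<Gamma> - {\<gamma>}. u \<gamma>')) = (0 :: 'k)"
    and fin: "finite \<Gamma>" and sub: "\<Gamma> \<subseteq> {..<n}" and nonfree: "\<And>\<gamma>. \<gamma> \<in> \<Gamma> \<Longrightarrow> \<exists>x. row_kernel n qs x \<and> x \<gamma> \<noteq> 0"
    and g0: "g0 \<in> \<Gamma>" and v: "row_kernel n qs v"
  shows "(\<Sum>\<gamma> | \<gamma> \<in> \<Gamma> \<and> proportional n qs \<gamma> g0. v \<gamma>) = 0"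
proof -
  define Cl where "Cl = {\<gamma> \<in> \<Gamma>. proportional n qs \<gamma> g0}"
  define R where "R = \<Gamma> - Cl"
  have fins: "finite Cl" "finite R" using fin by (auto simp: Cl_def R_def)
  obtain b where b: "row_kernel n qs b" "\<forall>\<gamma>\<in>\<Gamma>. b \<gamma> \<noteq> 0"
    using exists_full_support_row_kernel[OF fin nonfree] by blast
  \<comment> \<open>The unit row at \<open>g0\<close> cuts out the kernel vectors vanishing there;
    at every index not proportional to \<open>g0\<close> one of them is nonzero.\<close>
  define qs' where "qs' = (\<lambda>i. if i = g0 then 1 else 0) # qs"
  have qs': "row_kernel n qs' x \<longleftrightarrow> x g0 = 0 \<and> row_kernel n qs x" for x
  proof -
    have "(\<Sum>i<n. (if i = g0 then 1 else 0) * x i) = (\<Sum>i<n. if i = g0 then x i else 0)" by (rule sum.cong) auto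
    also have "\<dots> = x g0" using g0 sub by (auto simp: sum.delta)
    finally show ?thesis by (simp add: row_kernel_def qs'_def)
  qed
  have "\<exists>x. row_kernel n qs' x \<and> x \<gamma> \<noteq> 0" if \<gamma>: "\<gamma> \<in> R" for \<gamma>
  proof -
    have "\<not> proportional n qs \<gamma> g0" using \<gamma> by (auto simp: R_def Cl_def)
    then obtain x y where xy: "row_kernel n qs x" "row_kernel n qs y" "x \<gamma> * y g0 \<noteq> y \<gamma> * x g0"
      unfolding proportional_def by blast
    have "row_kernel n qs (\<lambda>i. y g0 * x i + (- x g0) * y i)" by (rule row_kernel_comb[OF xy(1,2)])
    thus ?thesis using xy(3) by (intro exI[of _ "\<lambda>i. y g0 * x i + (- x g0) * y i"]) (auto simp: qs' mult.commute)
  qed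
  from exists_full_support_row_kernel[OF fins(2) this]
  obtain a where a: "row_kernel n qs a" "a g0 = 0" "\<forall>\<gamma>\<in>R. a \<gamma> \<noteq> 0" unfolding qs' by blast
  have a0: "a \<gamma> = 0" if "\<gamma> \<in> Cl" for \<gamma>
  proof -
    have "a \<gamma> * b g0 = b \<gamma> * a g0" using that a(1) b(1) unfolding Cl_def proportional_def by blast
    thus ?thesis using a(2) b(2) g0 by simp
  qed
  define l where "l = (\<lambda>\<gamma>. [:of_int (a \<gamma>), of_int (b \<gamma>) :: 'k:])"
  \<comment> \<open>The identity at \<open>u = a + z b\<close> with \<open>w = b\<close>, multiplied
    by \<open>z\<close> and divided by the product of \<open>u\<close> over the class. On the class
    \<open>u = z b\<close>, so the factor \<open>z * b \<gamma>\<close> completes the product there;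
    the constant coefficient is the class sum times the product of \<open>a\<close> over the
    remaining indices.\<close>
  define P where "P = Polynomial.smult (of_int (\<Sum>\<gamma>\<in>Cl. v \<gamma>)) (\<Prod>\<gamma>\<in>R. l \<gamma>) +
    [:0, 1:] * (\<Sum>\<gamma>\<in>R. Polynomial.smult (of_int (v \<gamma> * b \<gamma>)) (\<Prod>\<gamma>'\<in>R - {\<gamma>}. l \<gamma>'))"
  have "poly P z = 0" if z: "z \<noteq> 0" for z
  proof -
    define u where "u = (\<lambda>\<gamma>. of_int (a \<gamma>) + z * of_int (b \<gamma>) :: 'k)"
    define \<beta> where "\<beta> = (\<Prod>\<gamma>\<in>Cl. u \<gamma>)"
    have uCl: "u \<gamma> = z * of_int (b \<gamma>)" if "\<gamma> \<in> Cl" for \<gamma> using a0[OF that] by (simp add: u_def)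
    have \<beta>: "\<beta> \<noteq> 0" unfolding \<beta>_def using uCl b(2) z fins by (auto simp: Cl_def)
    have ul: "u \<gamma> = poly (l \<gamma>) z" for \<gamma> by (simp add: u_def l_def)
    have ker: "(\<lambda>i. of_int (b i)) \<in> (kernel_field n qs :: (nat \<Rightarrow> 'k) set)" "(\<lambda>i. of_int (a i)) \<in> (kernel_field n qs :: (nat \<Rightarrow> 'k) set)"
      using a(1) b(1) by (auto simp: row_kernel_def kernel_field_def simp flip: of_int_mult of_int_sum)
    have un: "\<Gamma> = Cl \<union> R" "Cl \<inter> R = {}" by (auto simp: Cl_def R_def)
    have "0 = z * (\<Sum>\<gamma>\<in>\<Gamma>. of_int (v \<gamma>) * of_int (b \<gamma>) * (\<Prod>\<gamma>'\<in>\<Gamma> - {\<gamma>}. u \<gamma>'))"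
      using ident[OF v ker(1) kernel_field_line[OF ker(2,1), of z]] unfolding u_def by simp
    also have "\<dots> = (\<Sum>\<gamma>\<in>\<Gamma>. z * (of_int (v \<gamma>) * of_int (b \<gamma>) * (\<Prod>\<gamma>'\<in>\<Gamma> - {\<gamma>}. u \<gamma>')))"
      by (rule sum_distrib_left)
    also have "\<dots> = (\<Sum>\<gamma>\<in>Cl. z * (of_int (v \<gamma>) * of_int (b \<gamma>) * (\<Prod>\<gamma>'\<in>\<Gamma> - {\<gamma>}. u \<gamma>'))) +
        (\<Sum>\<gamma>\<in>R. z * (of_int (v \<gamma>) * of_int (b \<gamma>) * (\<Prod>\<gamma>'\<in>\<Gamma> - {\<gamma>}. u \<gamma>')))"
      unfolding un(1) by (rule sum.union_disjoint[OF fins un(2)])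
    also have "(\<Sum>\<gamma>\<in>Cl. z * (of_int (v \<gamma>) * of_int (b \<gamma>) * (\<Prod>\<gamma>'\<in>\<Gamma> - {\<gamma>}. u \<gamma>'))) = (\<Sum>\<gamma>\<in>Cl. of_int (v \<gamma>) * (\<beta> * (\<Prod>\<gamma>\<in>R. u \<gamma>)))"
    proof (rule sum.cong)
      fix \<gamma> assume \<gamma>: "\<gamma> \<in> Cl"
      have "\<beta> * (\<Prod>\<gamma>\<in>R. u \<gamma>) = (\<Prod>\<gamma>\<in>\<Gamma>. u \<gamma>)"
        unfolding \<beta>_def un(1) by (rule prod.union_disjoint[OF fins un(2), symmetric])
      also have "\<dots> = u \<gamma> * (\<Prod>\<gamma>'\<in>\<Gamma> - {\<gamma>}. u \<gamma>')" by (rule prod.remove[OF fin]) (use \<gamma> in \<open>auto simp: Cl_def\<close>)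
      finally show "z * (of_int (v \<gamma>) * of_int (b \<gamma>) * (\<Prod>\<gamma>'\<in>\<Gamma> - {\<gamma>}. u \<gamma>')) = of_int (v \<gamma>) * (\<beta> * (\<Prod>\<gamma>\<in>R. u \<gamma>))"
        unfolding uCl[OF \<gamma>] by (simp add: mult_ac)
    qed simp
    also have "\<dots> = \<beta> * (of_int (\<Sum>\<gamma>\<in>Cl. v \<gamma>) * (\<Prod>\<gamma>\<in>R. u \<gamma>))"
      by (simp add: sum_distrib_right sum_distrib_left mult_ac)
    also have "(\<Sum>\<gamma>\<in>R. z * (of_int (v \<gamma>) * of_int (b \<gamma>) * (\<Prod>\<gamma>'\<in>\<Gamma> - {\<gamma>}. u \<gamma>'))) =
        (\<Sum>\<gamma>\<in>R. \<beta> * (z * (of_int (v \<gamma> * b \<gamma>) * (\<Prod>\<gamma>'\<in>R - {\<gamma>}. u \<gamma>'))))"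
    proof (rule sum.cong)
      fix \<gamma> assume \<gamma>: "\<gamma> \<in> R"
      have "\<Gamma> - {\<gamma>} = Cl \<union> (R - {\<gamma>})" using \<gamma> un by auto
      moreover have "Cl \<inter> (R - {\<gamma>}) = {}" using un by auto
      ultimately have "(\<Prod>\<gamma>'\<in>\<Gamma> - {\<gamma>}. u \<gamma>') = \<beta> * (\<Prod>\<gamma>'\<in>R - {\<gamma>}. u \<gamma>')"
        unfolding \<beta>_def using fins by (simp add: prod.union_disjoint)
      thus "z * (of_int (v \<gamma>) * of_int (b \<gamma>) * (\<Prod>\<gamma>'\<in>\<Gamma> - {\<gamma>}. u \<gamma>')) =
          \<beta> * (z * (of_int (v \<gamma> * b \<gamma>) * (\<Prod>\<gamma>'\<in>R - {\<gamma>}. u \<gamma>')))"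
        by (simp add: mult_ac)
    qed simp
    also have "\<dots> = \<beta> * (z * (\<Sum>\<gamma>\<in>R. of_int (v \<gamma> * b \<gamma>) * (\<Prod>\<gamma>'\<in>R - {\<gamma>}. u \<gamma>')))"
      by (simp only: sum_distrib_left)
    finally have "\<beta> * poly P z = 0"
      by (simp add: P_def poly_prod poly_sum ul distrib_left)
    thus ?thesis using \<beta> by simp
  qed
  hence "P = 0" by (intro poly_eqI_infinite) simp
  hence "poly P 0 = 0" by simp
  hence "of_int (\<Sum>\<gamma>\<in>Cl. v \<gamma>) * (\<Prod>\<gamma>\<in>R. of_int (a \<gamma>) :: 'k) = 0"
    by (simp add: P_def poly_prod l_def del: of_int_sum)
  moreover have "(\<Prod>\<gamma>\<in>R. of_int (a \<gamma>) :: 'k) \<noteq> 0" using a(3) fins by simp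
  ultimately have "of_int (\<Sum>\<gamma>\<in>Cl. v \<gamma>) = (0 :: 'k)" by simp
  thus ?thesis unfolding Cl_def by (simp only: of_int_eq_0_iff)
qed

subsection \<open>Primitive vectors\<close>

lemma bezout_family:
  fixes p :: nat
  shows "\<exists>\<mu>. (\<Sum>j<p. \<mu> j * f j) = Gcd (f ` {..<p} :: int set)"
proof (induction p)
  case (Suc p)
  then obtain \<mu> where \<mu>: "(\<Sum>j<p. \<mu> j * f j) = Gcd (f ` {..<p})" by blast
  obtain x y where xy: "x * f p + y * Gcd (f ` {..<p}) = gcd (f p) (Gcd (f ` {..<p}))"
    using bezout_int by blast
  have "(\<Sum>j<Suc p. (if j = p then x else y * \<mu> j) * f j) = x * f p + y * (\<Sum>j<p. \<mu> j * f j)"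
    by (simp add: sum_distrib_left mult.assoc)
  also have "\<dots> = Gcd (f ` {..<Suc p})" using xy \<mu> by (simp add: lessThan_Suc)
  finally show ?case by (intro exI[of _ "\<lambda>j. if j = p then x else y * \<mu> j"])
qed simp

text \<open>The divisor is the gcd with the sign of \<open>f 0\<close>, which makes the first entry
  positive; the vector \<open>l\<close> comes from Bezout and also proves primitivity.\<close>

lemma exists_primitive_vec:
  fixes f :: "nat \<Rightarrow> int"
  assumes "p > 0" "\<And>j. j < p \<Longrightarrow> f j \<noteq> 0"
  obtains c l :: "int vec" and d where "dim_vec c = p" "dim_vec l = p" "primitive_vec c" "full_support c" "0 < c $ 0"
    "(\<Sum>j<p. l $ j * c $ j) = 1" "d \<noteq> 0" "\<And>j. j < p \<Longrightarrow> f j = d * c $ j"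
proof -
  define D where "D = Gcd (f ` {..<p})"
  define s where "s = sgn (f 0)"
  have f0: "f 0 \<noteq> 0" using assms by simp
  have D: "D > 0"
  proof -
    have "D \<noteq> 0" unfolding D_def Gcd_0_iff using assms by force
    moreover have "D \<ge> 0" unfolding D_def by simp
    ultimately show ?thesis by linarith
  qed
  have s: "s \<noteq> 0" "s * s = 1" using f0 by (auto simp: s_def sgn_if)
  define d where "d = s * D"
  define c where "c = vec p (\<lambda>j. f j div d)"
  have dvd: "d dvd f j" if "j < p" for j
  proof -
    have "D dvd f j" unfolding D_def by (rule Gcd_dvd) (use that in auto)
    thus ?thesis unfolding d_def using s(2) by (metis dvd_def dvd_trans mult.assoc mult.commute mult_1)
  qed
  have fd: "f j = d * c $ j" if "j < p" for j using dvd[OF that] that by (simp add: c_def)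
  obtain \<mu> where "(\<Sum>j<p. \<mu> j * f j) = D" using bezout_family[of \<mu>] bezout_family[where f = f and p = p] unfolding D_def by blast
  hence "(\<Sum>j<p. \<mu> j * (d * c $ j)) = D" using fd by simp
  moreover have "(\<Sum>j<p. \<mu> j * (d * c $ j)) = D * (\<Sum>j<p. s * \<mu> j * c $ j)"
    unfolding d_def sum_distrib_left by (simp add: mult_ac)
  ultimately have "D * (\<Sum>j<p. s * \<mu> j * c $ j) = D * 1" by simp
  hence one: "(\<Sum>j<p. s * \<mu> j * c $ j) = 1" using D by (simp del: mult_1_right)
  define l where "l = vec p (\<lambda>j. s * \<mu> j)"
  have one': "(\<Sum>j<p. l $ j * c $ j) = 1" using one by (simp add: l_def)
  have dims: "dim_vec c = p" "dim_vec l = p" by (auto simp: c_def l_def)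
  have "Gcd (vec_set c) dvd (\<Sum>j<p. l $ j * c $ j)"
    by (rule dvd_sum) (auto intro!: dvd_mult Gcd_dvd simp: vec_set_def dims)
  hence "is_unit (Gcd (vec_set c))" unfolding one' .
  hence "primitive_vec c" unfolding primitive_vec_def by simp
  moreover have "full_support c" unfolding full_support_def using fd assms(2) dims by fastforce
  moreover have "0 < c $ 0"
  proof -
    have "D * c $ 0 = s * f 0" using fd[OF assms(1)] s(2) unfolding d_def by (simp add: algebra_simps)
    also have "\<dots> > 0" using f0 by (auto simp: s_def sgn_if)
    finally show ?thesis using D by (simp add: zero_less_mult_iff)
  qed
  moreover have "d \<noteq> 0" using s D by (simp add: d_def)
  ultimately show ?thesis using that[of c l d] dims one' fd by blast
qed

text \<open>Pairing with the Bezout vector \<open>l\<close> produces the factor as an integer;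
  proportionality alone would give a rational one.\<close>

lemma multiple_of_primitive:
  fixes v :: "nat \<Rightarrow> int"
  assumes "(\<Sum>j<p. l j * c j) = (1 :: int)" "\<And>i j. i < p \<Longrightarrow> j < p \<Longrightarrow> c i * v j = c j * v i" "j < p"
  shows "v j = (\<Sum>i<p. l i * v i) * c j"
proof -
  have "(\<Sum>i<p. l i * v i) * c j = (\<Sum>i<p. l i * c i * v j)"
    unfolding sum_distrib_right by (rule sum.cong) (use assms(2)[OF _ assms(3)] in \<open>auto simp: mult.assoc mult.commute[of "v _"]\<close>)
  also have "\<dots> = v j" using assms(1) by (simp flip: sum_distrib_right)
  finally show ?thesis by simp
qed

subsection \<open>The kernel of a generalized Lawrence matrix\<close>

text \<open>A block consists of \<open>b\<close>, \<open>c\<close>, the vector of its \<lambda>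
  values and the list of original indices of its columns, so that kernels can be stated for
  functions on these indices.\<close>

type_synonym block = "int vec \<times> int vec \<times> int vec \<times> nat list"

abbreviation blk_b :: "block \<Rightarrow> int vec" where "blk_b B \<equiv> fst B"
abbreviation blk_c :: "block \<Rightarrow> int vec" where "blk_c B \<equiv> fst (snd B)"
abbreviation blk_l :: "block \<Rightarrow> int vec" where "blk_l B \<equiv> fst (snd (snd B))"
abbreviation blk_g :: "block \<Rightarrow> nat list" where "blk_g B \<equiv> snd (snd (snd B))"

definition list_vec :: "(nat \<Rightarrow> int) \<Rightarrow> nat list \<Rightarrow> int vec" where
  "list_vec v g = vec (length g) (\<lambda>p. v (g ! p))"

lemma list_vec_append: "list_vec v (g @ h) = list_vec v g @\<^sub>v list_vec v h"
  by (rule eq_vecI) (auto simp: list_vec_def nth_append)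

lemma list_vec_carrier: "list_vec v g \<in> carrier_vec (length g)"
  by (simp add: list_vec_def)

lemma glm_C_kernel:
  assumes "dim_vec c = length g" "length g \<ge> 1"
  shows "glm_C c *\<^sub>v list_vec v g = 0\<^sub>v (dim_row (glm_C c)) \<longleftrightarrow>
    (\<forall>r < length g - 1. c $ 0 * v (g ! (r + 1)) = c $ (r + 1) * v (g ! 0))"
proof -
  have "(glm_C c *\<^sub>v list_vec v g) $ r = c $ 0 * v (g ! (r + 1)) - c $ (r + 1) * v (g ! 0)" if r: "r < length g - 1" for r
  proof -
    have "(glm_C c *\<^sub>v list_vec v g) $ r = (\<Sum>j<length g. (if j = 0 then - (c $ (r + 1)) else if j = r + 1 then c $ 0 else 0) * v (g ! j))"
      using r assms by (auto simp: glm_C_def list_vec_def scalar_prod_def atLeast0LessThan intro!: sum.cong)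
    also have "\<dots> = (\<Sum>j<length g. (if j = 0 then - (c $ (r + 1)) * v (g ! 0) else 0) + (if j = r + 1 then c $ 0 * v (g ! (r + 1)) else 0))"
      by (rule sum.cong) auto
    also have "\<dots> = - (c $ (r + 1)) * v (g ! 0) + c $ 0 * v (g ! (r + 1))"
      unfolding sum.distrib using r assms by (subst (1 2) sum.delta) auto
    finally show ?thesis by simp
  qed
  moreover have "dim_row (glm_C c) = length g - 1" using assms by (simp add: glm_C_def)
  ultimately show ?thesis by (auto simp: vec_eq_iff)
qed

lemma diag_block_kernel:
  assumes "\<And>B. B \<in> set bl \<Longrightarrow> dim_vec (blk_c B) = length (blk_g B) \<and> length (blk_g B) \<ge> 1"
  defines "D \<equiv> diag_block_mat (map (\<lambda>B. glm_C (blk_c B)) bl)"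
  shows "dim_col D = length (concat (map blk_g bl))" (is ?dim)
    and "D *\<^sub>v list_vec v (concat (map blk_g bl)) = 0\<^sub>v (dim_row D) \<longleftrightarrow>
      (\<forall>B\<in>set bl. \<forall>r < length (blk_g B) - 1. blk_c B $ 0 * v (blk_g B ! (r + 1)) = blk_c B $ (r + 1) * v (blk_g B ! 0))"
      (is ?ker)
proof -
  have "?dim \<and> ?ker" using assms(1) unfolding D_def
  proof (induction bl)
    case Nil
    show ?case by (auto simp: list_vec_def)
  next
    case (Cons B bl)
    define D' where "D' = diag_block_mat (map (\<lambda>B. glm_C (blk_c B)) bl)"
    define G where "G = glm_C (blk_c B)"
    have IH: "dim_col D' = length (concat (map blk_g bl))"
      "D' *\<^sub>v list_vec v (concat (map blk_g bl)) = 0\<^sub>v (dim_row D') \<longleftrightarrow>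
      (\<forall>B\<in>set bl. \<forall>r < length (blk_g B) - 1. blk_c B $ 0 * v (blk_g B ! (r + 1)) = blk_c B $ (r + 1) * v (blk_g B ! 0))"
      using Cons unfolding D'_def by auto
    have B: "dim_vec (blk_c B) = length (blk_g B)" "length (blk_g B) \<ge> 1" using Cons.prems by auto
    have dG: "dim_col G = length (blk_g B)" using B by (simp add: G_def glm_C_def)
    have eq: "diag_block_mat (map (\<lambda>B. glm_C (blk_c B)) (B # bl)) =
      four_block_mat G (0\<^sub>m (dim_row G) (dim_col D')) (0\<^sub>m (dim_row D') (dim_col G)) D'"
      by (simp add: G_def D'_def Let_def)
    have "four_block_mat G (0\<^sub>m (dim_row G) (dim_col D')) (0\<^sub>m (dim_row D') (dim_col G)) D' *\<^sub>v
        (list_vec v (blk_g B) @\<^sub>v list_vec v (concat (map blk_g bl))) =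
      (G *\<^sub>v list_vec v (blk_g B) + 0\<^sub>m (dim_row G) (dim_col D') *\<^sub>v list_vec v (concat (map blk_g bl))) @\<^sub>v
      (0\<^sub>m (dim_row D') (dim_col G) *\<^sub>v list_vec v (blk_g B) + D' *\<^sub>v list_vec v (concat (map blk_g bl)))"
      unfolding IH(1) dG
    proof (rule four_block_mat_mult_vec)
      show "G \<in> carrier_mat (dim_row G) (length (blk_g B))" using dG by (rule carrier_matI[OF refl])
      show "D' \<in> carrier_mat (dim_row D') (length (concat (map blk_g bl)))" using IH(1) by (rule carrier_matI[OF refl])
    qed (rule zero_carrier_mat list_vec_carrier)+
    also have "\<dots> = (G *\<^sub>v list_vec v (blk_g B)) @\<^sub>v (D' *\<^sub>v list_vec v (concat (map blk_g bl)))"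
    proof (intro arg_cong2[of _ _ _ _ "(@\<^sub>v)"])
      show "G *\<^sub>v list_vec v (blk_g B) + 0\<^sub>m (dim_row G) (dim_col D') *\<^sub>v list_vec v (concat (map blk_g bl)) = G *\<^sub>v list_vec v (blk_g B)"
        by (rule eq_vecI) (auto simp: list_vec_def IH(1) scalar_prod_def)
      show "0\<^sub>m (dim_row D') (dim_col G) *\<^sub>v list_vec v (blk_g B) + D' *\<^sub>v list_vec v (concat (map blk_g bl)) = D' *\<^sub>v list_vec v (concat (map blk_g bl))"
        by (rule eq_vecI) (auto simp: list_vec_def dG scalar_prod_def)
    qed
    finally have mult: "diag_block_mat (map (\<lambda>B. glm_C (blk_c B)) (B # bl)) *\<^sub>v list_vec v (concat (map blk_g (B # bl))) =
      (G *\<^sub>v list_vec v (blk_g B)) @\<^sub>v (D' *\<^sub>v list_vec v (concat (map blk_g bl)))"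
      unfolding eq by (simp add: list_vec_append)
    have zero: "0\<^sub>v (dim_row G + dim_row D') = (0\<^sub>v (dim_row G) @\<^sub>v 0\<^sub>v (dim_row D') :: int vec)"
      by (rule eq_vecI) auto
    have dims: "dim_row (diag_block_mat (map (\<lambda>B. glm_C (blk_c B)) (B # bl))) = dim_row G + dim_row D'"
      "dim_col (diag_block_mat (map (\<lambda>B. glm_C (blk_c B)) (B # bl))) = dim_col G + dim_col D'"
      unfolding eq by simp_all
    have "diag_block_mat (map (\<lambda>B. glm_C (blk_c B)) (B # bl)) *\<^sub>v list_vec v (concat (map blk_g (B # bl))) = 0\<^sub>v (dim_row G + dim_row D') \<longleftrightarrow>
      G *\<^sub>v list_vec v (blk_g B) = 0\<^sub>v (dim_row G) \<and> D' *\<^sub>v list_vec v (concat (map blk_g bl)) = 0\<^sub>v (dim_row D')"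
      unfolding mult zero
    proof (rule append_vec_eq)
      show "G *\<^sub>v list_vec v (blk_g B) \<in> carrier_vec (dim_row G)" by (rule carrier_vecI) simp
    qed simp
    thus ?case using IH(2) glm_C_kernel[OF B, of v] dims dG IH(1) unfolding G_def by simp
  qed
  thus ?dim ?ker by auto
qed

lemma mat_of_cols_list_vec:
  assumes "length ws = length g" "x < d"
  shows "(mat_of_cols d ws *\<^sub>v list_vec v g) $ x = (\<Sum>(w, i)\<leftarrow>zip ws g. w $ x * v i)"
proof -
  have "(mat_of_cols d ws *\<^sub>v list_vec v g) $ x = (\<Sum>p<length ws. ws ! p $ x * v (g ! p))"
    using assms by (auto simp: list_vec_def scalar_prod_def atLeast0LessThan mat_of_cols_index intro!: sum.cong)
  also have "\<dots> = (\<Sum>(w, i)\<leftarrow>zip ws g. w $ x * v i)"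
    using assms(1) by (simp add: sum_list_sum_nth atLeast0LessThan case_prod_unfold)
  finally show ?thesis .
qed

lemma glm_top:
  assumes "\<And>B. B \<in> set bl \<Longrightarrow> blk_b B \<in> carrier_vec d \<and> dim_vec (blk_l B) = length (blk_g B)" "x < d"
  defines "ws \<equiv> concat (map (\<lambda>B. glm_A_cols (blk_b B) (blk_l B)) bl)"
  shows "length ws = length (concat (map blk_g bl))" (is ?len)
    and "(mat_of_cols d ws *\<^sub>v list_vec v (concat (map blk_g bl))) $ x =
      (\<Sum>B\<leftarrow>bl. (\<Sum>j<length (blk_g B). blk_l B $ j * v (blk_g B ! j)) * blk_b B $ x)" (is ?sum)
proof -
  have len1: "length (glm_A_cols (blk_b B) (blk_l B)) = length (blk_g B)" if "B \<in> set bl" for B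
    using assms(1)[OF that] by (simp add: glm_A_cols_def)
  show ?len unfolding ws_def length_concat map_map o_def
    by (rule arg_cong[of _ _ sum_list], rule map_cong) (auto simp: len1)
  have "(\<Sum>(w, i)\<leftarrow>zip ws (concat (map blk_g bl)). w $ x * v i) =
      (\<Sum>B\<leftarrow>bl. (\<Sum>j<length (blk_g B). blk_l B $ j * v (blk_g B ! j)) * blk_b B $ x)"
    using assms(1) unfolding ws_def
  proof (induction bl)
    case (Cons B bl)
    have B: "blk_b B \<in> carrier_vec d" "dim_vec (blk_l B) = length (blk_g B)" using Cons.prems by auto
    have len: "length (glm_A_cols (blk_b B) (blk_l B)) = length (blk_g B)" using B by (simp add: glm_A_cols_def)
    have "(\<Sum>(w, i)\<leftarrow>zip (glm_A_cols (blk_b B) (blk_l B)) (blk_g B). w $ x * v i) =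
      (\<Sum>j<length (blk_g B). blk_l B $ j * v (blk_g B ! j)) * blk_b B $ x"
      using B assms(2) len
      by (auto simp: sum_list_sum_nth atLeast0LessThan case_prod_unfold sum_distrib_right glm_A_cols_def intro!: sum.cong)
    thus ?case using Cons by (simp add: zip_append[OF len])
  qed simp
  thus ?sum using mat_of_cols_list_vec[OF \<open>?len\<close> assms(2), of v] by simp
qed

text \<open>The block rows say that \<open>v\<close> is proportional to \<open>c\<close> on each
  block; for such \<open>v\<close> the pairing with the \<lambda> values is the factor of
  proportionality, so the top rows give a relation among the vectors \<open>b\<close>.\<close>

lemma glm_kernel:
  assumes "\<And>B. B \<in> set bl \<Longrightarrow> blk_b B \<in> carrier_vec d \<and> dim_vec (blk_l B) = length (blk_g B) \<and>
      dim_vec (blk_c B) = length (blk_g B) \<and> length (blk_g B) \<ge> 1"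
  defines "G \<equiv> glm d (map blk_b bl) (map blk_c bl) (map blk_l bl)"
  shows "dim_col G = length (concat (map blk_g bl))"
    and "G *\<^sub>v list_vec v (concat (map blk_g bl)) = 0\<^sub>v (dim_row G) \<longleftrightarrow>
      (\<forall>x<d. (\<Sum>B\<leftarrow>bl. (\<Sum>j<length (blk_g B). blk_l B $ j * v (blk_g B ! j)) * blk_b B $ x) = 0) \<and>
      (\<forall>B\<in>set bl. \<forall>r < length (blk_g B) - 1. blk_c B $ 0 * v (blk_g B ! (r + 1)) = blk_c B $ (r + 1) * v (blk_g B ! 0))"
proof -
  define ws where "ws = concat (map (\<lambda>B. glm_A_cols (blk_b B) (blk_l B)) bl)"
  define T where "T = mat_of_cols d ws"
  define D where "D = diag_block_mat (map (\<lambda>B. glm_C (blk_c B)) bl)"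
  define n where "n = length (concat (map blk_g bl))"
  have blocks: "dim_vec (blk_c B) = length (blk_g B) \<and> length (blk_g B) \<ge> 1"
    "blk_b B \<in> carrier_vec d \<and> dim_vec (blk_l B) = length (blk_g B)" if "B \<in> set bl" for B
    using assms(1)[OF that] by simp_all
  have map2: "map2 glm_A_cols (map blk_b bl) (map blk_l bl) = map (\<lambda>B. glm_A_cols (blk_b B) (blk_l B)) bl"
    by (induction bl) auto
  have G: "G = T @\<^sub>r D" unfolding G_def glm_def map2 T_def D_def ws_def by (simp add: o_def)
  have len: "length ws = n"
    unfolding ws_def n_def length_concat map_map o_def
    by (rule arg_cong[of _ _ sum_list], rule map_cong) (simp_all add: glm_A_cols_def blocks(2))
  have T: "T \<in> carrier_mat d n" by (rule carrier_matI) (simp_all add: T_def len)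
  have "dim_col D = n" unfolding D_def n_def by (rule diag_block_kernel(1)[OF blocks(1)])
  hence D: "D \<in> carrier_mat (dim_row D) n" by (rule carrier_matI[OF refl])
  have Gc: "G \<in> carrier_mat (d + dim_row D) n" unfolding G by (rule carrier_append_rows[OF T D])
  show "dim_col G = length (concat (map blk_g bl))" using carrier_matD(2)[OF Gc] unfolding n_def .
  define V where "V = list_vec v (concat (map blk_g bl))"
  have V: "V \<in> carrier_vec n" by (simp add: V_def n_def list_vec_carrier)
  have "G *\<^sub>v V = (T *\<^sub>v V) @\<^sub>v (D *\<^sub>v V)" unfolding G by (rule mat_mult_append[OF T D V])
  moreover have "0\<^sub>v (dim_row G) = (0\<^sub>v d @\<^sub>v 0\<^sub>v (dim_row D) :: int vec)"
    unfolding carrier_matD(1)[OF Gc] by (rule eq_vecI) simp_all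
  ultimately have "G *\<^sub>v V = 0\<^sub>v (dim_row G) \<longleftrightarrow> T *\<^sub>v V = 0\<^sub>v d \<and> D *\<^sub>v V = 0\<^sub>v (dim_row D)"
    using append_vec_eq[OF mult_mat_vec_carrier[OF T V] zero_carrier_vec] by simp
  also have "T *\<^sub>v V = 0\<^sub>v d \<longleftrightarrow> (\<forall>x<d. (T *\<^sub>v V) $ x = 0)"
    using carrier_matD(1)[OF T] by (simp add: vec_eq_iff)
  also have "\<dots> \<longleftrightarrow> (\<forall>x<d. (\<Sum>B\<leftarrow>bl. (\<Sum>j<length (blk_g B). blk_l B $ j * v (blk_g B ! j)) * blk_b B $ x) = 0)"
  proof -
    have "(T *\<^sub>v V) $ x = (\<Sum>B\<leftarrow>bl. (\<Sum>j<length (blk_g B). blk_l B $ j * v (blk_g B ! j)) * blk_b B $ x)"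
      if "x < d" for x
      unfolding T_def ws_def V_def by (rule glm_top(2)[OF blocks(2) that])
    thus ?thesis by simp
  qed
  also have "D *\<^sub>v V = 0\<^sub>v (dim_row D) \<longleftrightarrow>
      (\<forall>B\<in>set bl. \<forall>r < length (blk_g B) - 1. blk_c B $ 0 * v (blk_g B ! (r + 1)) = blk_c B $ (r + 1) * v (blk_g B ! 0))"
    unfolding D_def V_def by (rule diag_block_kernel(2)[OF blocks(1)])
  finally show "G *\<^sub>v list_vec v (concat (map blk_g bl)) = 0\<^sub>v (dim_row G) \<longleftrightarrow>
      (\<forall>x<d. (\<Sum>B\<leftarrow>bl. (\<Sum>j<length (blk_g B). blk_l B $ j * v (blk_g B ! j)) * blk_b B $ x) = 0) \<and>
      (\<forall>B\<in>set bl. \<forall>r < length (blk_g B) - 1. blk_c B $ 0 * v (blk_g B ! (r + 1)) = blk_c B $ (r + 1) * v (blk_g B ! 0))"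
    unfolding V_def .
qed

subsection \<open>Construction of the generalized Lawrence matrix\<close>

lemma proportional_sym: "proportional n qs \<gamma> \<delta> \<Longrightarrow> proportional n qs \<delta> \<gamma>"
  unfolding proportional_def by (metis mult.commute)

text \<open>The kernel vector \<open>b\<close> with \<open>b \<delta> \<noteq> 0\<close> is
  essential: a coordinate that vanishes on the whole kernel is proportional to every other.\<close>

lemma proportional_trans:
  assumes "proportional n qs \<gamma> \<delta>" "proportional n qs \<delta> \<epsilon>" "row_kernel n qs b" "b \<delta> \<noteq> 0"
  shows "proportional n qs \<gamma> \<epsilon>"
  unfolding proportional_def
proof (intro allI impI)
  fix u v assume uv: "row_kernel n qs u" "row_kernel n qs v"
  have 1: "u \<gamma> * b \<delta> = b \<gamma> * u \<delta>" "v \<gamma> * b \<delta> = b \<gamma> * v \<delta>"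
    using assms(1,3) uv unfolding proportional_def by blast+
  have 2: "u \<delta> * b \<epsilon> = b \<delta> * u \<epsilon>" "v \<delta> * b \<epsilon> = b \<delta> * v \<epsilon>"
    using assms(2,3) uv unfolding proportional_def by blast+
  have "b \<delta> * b \<delta> * (u \<gamma> * v \<epsilon>) = (u \<gamma> * b \<delta>) * (b \<delta> * v \<epsilon>)" by (simp add: mult_ac)
  also have "\<dots> = (b \<gamma> * u \<delta>) * (v \<delta> * b \<epsilon>)" using 1 2 by simp
  also have "\<dots> = (b \<gamma> * v \<delta>) * (u \<delta> * b \<epsilon>)" by (simp add: mult_ac)
  also have "\<dots> = (v \<gamma> * b \<delta>) * (b \<delta> * u \<epsilon>)" using 1 2 by simp
  also have "\<dots> = b \<delta> * b \<delta> * (v \<gamma> * u \<epsilon>)" by (simp add: mult_ac)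
  finally show "u \<gamma> * v \<epsilon> = v \<gamma> * u \<epsilon>" using assms(4) by simp
qed

lemma sum_concat:
  fixes f :: "nat \<Rightarrow> 'c :: comm_monoid_add"
  assumes "distinct (concat gs)"
  shows "(\<Sum>g\<leftarrow>gs. \<Sum>j<length g. f (g ! j)) = sum f (set (concat gs))"
proof -
  have "(\<Sum>j<length g. f (g ! j)) = sum_list (map f g)" for g
    by (simp add: sum_list_sum_nth atLeast0LessThan)
  hence "(\<Sum>g\<leftarrow>gs. \<Sum>j<length g. f (g ! j)) = (\<Sum>g\<leftarrow>gs. sum_list (map f g))" by simp
  also have "\<dots> = sum_list (map f (concat gs))" by (induction gs) auto
  also have "\<dots> = sum f (set (concat gs))" by (rule sum_list_distinct_conv_sum_set[OF assms])
  finally show ?thesis .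
qed

lemma class_partition:
  assumes fin: "finite \<Gamma>" and b: "row_kernel n qs b" "\<And>\<gamma>. \<gamma> \<in> \<Gamma> \<Longrightarrow> b \<gamma> \<noteq> 0"
  shows "\<exists>gs. distinct (concat gs) \<and> set (concat gs) = \<Gamma> \<and>
    (\<forall>g\<in>set gs. g \<noteq> [] \<and> (\<forall>\<gamma>\<in>set g. set g = {\<delta> \<in> \<Gamma>. proportional n qs \<delta> \<gamma>}))"
proof -
  define cls where "cls = (\<lambda>\<gamma>. {\<delta> \<in> \<Gamma>. proportional n qs \<delta> \<gamma>})"
  obtain Ls where Ls: "set Ls = cls ` \<Gamma>" "distinct Ls" using finite_distinct_list[of "cls ` \<Gamma>"] fin by auto
  have fin_cls: "finite (cls \<gamma>)" for \<gamma> using fin by (simp add: cls_def)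
  have cls_eq: "cls \<gamma> = cls \<delta>" if "\<gamma> \<in> \<Gamma>" "\<delta> \<in> cls \<gamma>" for \<gamma> \<delta>
  proof -
    have p: "\<delta> \<in> \<Gamma>" "proportional n qs \<delta> \<gamma>" using that(2) by (auto simp: cls_def)
    have "proportional n qs \<epsilon> \<gamma> \<longleftrightarrow> proportional n qs \<epsilon> \<delta>" for \<epsilon>
      using proportional_trans[OF _ proportional_sym[OF p(2)] b(1) b(2)[OF that(1)], of \<epsilon>]
        proportional_trans[OF _ p(2) b(1) b(2)[OF p(1)], of \<epsilon>] by metis
    thus ?thesis unfolding cls_def by simp
  qed
  define gs where "gs = map sorted_list_of_set Ls"
  have set_g: "set (sorted_list_of_set s) = s" if "s \<in> set Ls" for s using that Ls fin_cls by auto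
  have set_concat: "set (concat gs) = \<Gamma>"
  proof -
    have "set (concat gs) = \<Union>(set Ls)" unfolding gs_def using set_g by auto
    also have "\<dots> = \<Gamma>" unfolding Ls cls_def by (auto simp: proportional_def mult.commute)
    finally show ?thesis .
  qed
  have disj: "s \<inter> t = {}" if st: "s \<in> set Ls" "t \<in> set Ls" "s \<noteq> t" for s t
  proof (rule ccontr)
    assume "s \<inter> t \<noteq> {}"
    then obtain \<delta> where "\<delta> \<in> s" "\<delta> \<in> t" by blast
    moreover obtain \<gamma> where "\<gamma> \<in> \<Gamma>" "s = cls \<gamma>" using st(1) Ls(1) by auto
    moreover obtain \<epsilon> where "\<epsilon> \<in> \<Gamma>" "t = cls \<epsilon>" using st(2) Ls(1) by auto
    ultimately have "s = t" using cls_eq by metis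
    thus False using st by simp
  qed
  show ?thesis
  proof (intro exI[of _ gs] conjI ballI)
    show "distinct (concat gs)"
    proof (rule distinct_concat)
      have "inj_on sorted_list_of_set (set Ls)" by (rule inj_onI) (metis set_g)
      thus "distinct gs" unfolding gs_def by (simp add: distinct_map Ls(2))
    next
      fix ys assume "ys \<in> set gs" thus "distinct ys" by (auto simp: gs_def)
    next
      fix ys zs assume "ys \<in> set gs" "zs \<in> set gs" "ys \<noteq> zs"
      then obtain s t where "s \<in> set Ls" "t \<in> set Ls" "ys = sorted_list_of_set s" "zs = sorted_list_of_set t" "s \<noteq> t"
        unfolding gs_def by auto
      thus "set ys \<inter> set zs = {}" using set_g disj by simp
    qed
    show "set (concat gs) = \<Gamma>" by (rule set_concat)
  next
    fix g assume "g \<in> set gs"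
    then obtain s where s: "s \<in> set Ls" "g = sorted_list_of_set s" unfolding gs_def by auto
    then obtain \<gamma> where \<gamma>: "\<gamma> \<in> \<Gamma>" "s = cls \<gamma>" using Ls by blast
    hence "\<gamma> \<in> s" by (simp add: cls_def proportional_def mult.commute)
    thus "g \<noteq> []" using set_g[OF s(1)] s(2) by auto
    fix \<gamma>' assume "\<gamma>' \<in> set g"
    thus "set g = {\<delta> \<in> \<Gamma>. proportional n qs \<delta> \<gamma>'}"
      using cls_eq[OF \<gamma>(1), of \<gamma>'] set_g[OF s(1)] s(2) \<gamma>(2) unfolding cls_def by simp
  qed
qed

lemma mat_kernel_mat_of_cols:
  "u \<in> mat_kernel (mat_of_cols R ys) \<longleftrightarrow>
    u \<in> carrier_vec (length ys) \<and> (\<forall>l<R. (\<Sum>i<length ys. ys ! i $ l * u $ i) = (0 :: int))"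
proof -
  have "(mat_of_cols R ys *\<^sub>v u) $ l = (\<Sum>i<length ys. ys ! i $ l * u $ i)"
    if "l < R" "u \<in> carrier_vec (length ys)" for l
    using that by (auto simp: scalar_prod_def atLeast0LessThan mat_of_cols_index intro!: sum.cong)
  thus ?thesis unfolding mat_kernel_def by (auto simp: vec_eq_iff)
qed

text \<open>One kernel vector \<open>b\<close> with full support off the free indices determines the
  direction of every class, and dividing out its gcd there gives the primitive vector. Every kernel
  vector is an integer multiple of it on the class. The free indices form one further block, on
  which kernel vectors vanish.\<close>

lemma build_glm:
  fixes es :: "int vec list" and m :: nat and qs :: "(nat \<Rightarrow> int) list"
  defines "n \<equiv> length es"
  defines "free \<equiv> {\<gamma>. \<gamma> < n \<and> (\<forall>v. row_kernel n qs v \<longrightarrow> v \<gamma> = 0)}"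
  defines "\<Gamma> \<equiv> {..<n} - free"
  defines "k \<equiv> card free"
  assumes ker: "\<And>v. row_kernel n qs v \<longleftrightarrow> (\<forall>l<m. (\<Sum>\<gamma><n. es ! \<gamma> $ l * v \<gamma>) = 0)"
    and sums: "\<forall>g0\<in>\<Gamma>. \<forall>v. row_kernel n qs v \<longrightarrow> (\<Sum>\<gamma> | \<gamma> \<in> \<Gamma> \<and> proportional n qs \<gamma> g0. v \<gamma>) = 0"
  shows "\<exists>bs c0 cs C' ord. set bs \<subseteq> carrier_vec (m + 1) \<and> (\<forall>b\<in>set bs. b $ 0 = 0) \<and>
    non_pyramidal (mat_of_cols (m + 1) bs) \<and> dim_vec c0 = k \<and> (0 < k \<longrightarrow> c0 $ 0 = 1) \<and>
    (\<forall>c\<in>set cs. (\<Sum>j<dim_vec c. c $ j) = 0) \<and>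
    is_GLM (m + 1) (if k = 0 then bs else unit_vec (m + 1) 0 # bs) (if k = 0 then cs else c0 # cs) C' \<and>
    distinct ord \<and> set ord = {..<n} \<and> dim_col C' = n \<and>
    (\<forall>v. C' *\<^sub>v list_vec v ord = 0\<^sub>v (dim_row C') \<longleftrightarrow> row_kernel n qs v)"
proof -
  have finG: "finite \<Gamma>" and finF: "finite free" by (auto simp: \<Gamma>_def free_def)
  have "\<exists>x. row_kernel n qs x \<and> x \<gamma> \<noteq> 0" if "\<gamma> \<in> \<Gamma>" for \<gamma>
    using that by (auto simp: \<Gamma>_def free_def)
  from exists_full_support_row_kernel[OF finG this]
  obtain b where b: "row_kernel n qs b" "\<And>\<gamma>. \<gamma> \<in> \<Gamma> \<Longrightarrow> b \<gamma> \<noteq> 0" by blast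
  obtain gs where gs: "distinct (concat gs)" "set (concat gs) = \<Gamma>" "\<And>g. g \<in> set gs \<Longrightarrow> g \<noteq> []"
    "\<And>g \<gamma>. g \<in> set gs \<Longrightarrow> \<gamma> \<in> set g \<Longrightarrow> set g = {\<delta> \<in> \<Gamma>. proportional n qs \<delta> \<gamma>}"
    using class_partition[OF finG b] by auto
  have g_sub: "set g \<subseteq> \<Gamma>" "distinct g" if "g \<in> set gs" for g
    using gs(1,2) that by (auto simp: distinct_concat_iff)
  have gprop: "v (g ! i) * w (g ! j) = w (g ! i) * v (g ! j)"
    if "g \<in> set gs" "i < length g" "j < length g" "row_kernel n qs v" "row_kernel n qs w" for g i j v w
  proof -
    have "g ! i \<in> {\<delta> \<in> \<Gamma>. proportional n qs \<delta> (g ! j)}"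
      unfolding gs(4)[OF that(1) nth_mem[OF that(3)], symmetric] by (rule nth_mem[OF that(2)])
    thus ?thesis using that(4,5) unfolding proportional_def by blast
  qed
  define Q where "Q = (\<lambda>g (c :: int vec, l :: int vec, d). dim_vec c = length g \<and> dim_vec l = length g \<and>
      (primitive_vec c \<and> full_support c \<and> 0 < c $ 0) \<and> (\<Sum>j<length g. l $ j * c $ j) = 1 \<and> d \<noteq> 0 \<and>
      (\<forall>j<length g. b (g ! j) = d * c $ j))"
  have "\<forall>g\<in>set gs. \<exists>t. Q g t"
  proof
    fix g assume g: "g \<in> set gs"
    show "\<exists>t. Q g t"
    proof (rule exists_primitive_vec[of "length g" "\<lambda>j. b (g ! j)"])
      show "length g > 0" using gs(3)[OF g] by simp
      show "b (g ! j) \<noteq> 0" if "j < length g" for j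
        by (rule b(2)) (use nth_mem[OF that] g_sub(1)[OF g] in blast)
    next
      fix c l :: "int vec" and d
      assume "dim_vec c = length g" "dim_vec l = length g" "primitive_vec c" "full_support c" "0 < c $ 0"
        "(\<Sum>j<length g. l $ j * c $ j) = 1" "d \<noteq> 0" "\<And>j. j < length g \<Longrightarrow> b (g ! j) = d * c $ j"
      hence "Q g (c, l, d)" by (simp add: Q_def)
      thus "\<exists>t. Q g t" by (rule exI)
    qed
  qed
  then obtain f where f: "\<forall>g\<in>set gs. Q g (f g)" by (rule bchoice[THEN exE])
  define cf lf df where "cf = (\<lambda>g. fst (f g))" and "lf = (\<lambda>g. fst (snd (f g)))" and "df = (\<lambda>g. snd (snd (f g)))"
  have Qf: "Q g (cf g, lf g, df g)" if "g \<in> set gs" for g using f that by (simp add: cf_def lf_def df_def)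
  have cf: "dim_vec (cf g) = length g" and lf: "dim_vec (lf g) = length g"
    and prim: "primitive_vec (cf g) \<and> full_support (cf g) \<and> 0 < cf g $ 0"
    and one: "(\<Sum>j<length g. lf g $ j * cf g $ j) = 1" and df1: "df g \<noteq> 0"
    and df2: "j < length g \<Longrightarrow> b (g ! j) = df g * cf g $ j" if "g \<in> set gs" for g j
    using Qf[OF that] unfolding Q_def by simp_all
  note df = df1 df2
  \<comment> \<open>Up to the nonzero factor \<open>df g\<close> this is the class sum of
    \<open>b\<close>, which is zero by hypothesis.\<close>
  have cf_sum: "(\<Sum>j<length g. cf g $ j) = 0" if g: "g \<in> set gs" for g
  proof -
    have g0: "g ! 0 \<in> set g" using gs(3)[OF g] by simp
    have "df g * (\<Sum>j<length g. cf g $ j) = (\<Sum>j<length g. b (g ! j))"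
      unfolding sum_distrib_left by (rule sum.cong) (use df(2)[OF g] in auto)
    also have "\<dots> = sum_list (map b g)" by (simp add: sum_list_sum_nth atLeast0LessThan)
    also have "\<dots> = sum b (set g)" by (rule sum_list_distinct_conv_sum_set[OF g_sub(2)[OF g]])
    also have "\<dots> = 0" unfolding gs(4)[OF g g0] by (rule sums[rule_format, OF _ b(1)]) (use g0 g_sub(1)[OF g] in auto)
    finally show ?thesis using df(1)[OF g] by simp
  qed
  define fs where "fs = sorted_list_of_set free"
  have fs: "distinct fs" "set fs = free" "length fs = k" using finF by (auto simp: fs_def k_def)
  \<comment> \<open>The columns of the class combined with the coefficients \<open>cf g\<close>: a
    kernel vector equal to a multiple of \<open>cf g\<close> on the class contributes that multiple
    of \<open>bv g\<close>. Coordinate \<open>0\<close> is reserved for the first unit vector of the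
    free block, hence dimension \<open>m + 1\<close>.\<close>
  define bv where "bv = (\<lambda>g. vec (m + 1) (\<lambda>x. if x = 0 then 0 else \<Sum>j<length g. cf g $ j * es ! (g ! j) $ (x - 1)))"
  define c0 :: "int vec" where "c0 = vec k (\<lambda>_. 1)"
  \<comment> \<open>For the vector \<open>c0\<close> of ones the first unit vector is an admissible
    choice of the \<lambda> values. Without free indices the block would have no columns and is left
    out.\<close>
  define bl0 :: "block list" where "bl0 = (if k = 0 then [] else [(unit_vec (m + 1) 0, c0, unit_vec k 0, fs)])"
  define bl where "bl = bl0 @ map (\<lambda>g. (bv g, cf g, lf g, g)) gs"
  define bs where "bs = map bv gs"
  define cs where "cs = map cf gs"
  define C' where "C' = glm (m + 1) (map blk_b bl) (map blk_c bl) (map blk_l bl)"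
  define ord where "ord = concat (map blk_g bl)"
  have ord: "ord = fs @ concat gs" using fs(3) by (auto simp: ord_def bl_def bl0_def o_def)
  have set_ord: "set ord = {..<n}" "distinct ord"
    unfolding ord using fs gs(1,2) by (auto simp: \<Gamma>_def free_def)
  have blocks: "blk_b B \<in> carrier_vec (m + 1) \<and> dim_vec (blk_l B) = length (blk_g B) \<and>
      dim_vec (blk_c B) = length (blk_g B) \<and> length (blk_g B) \<ge> 1" if "B \<in> set bl" for B
  proof -
    have "length g \<ge> 1" if "g \<in> set gs" for g using gs(3)[OF that] by (cases g) auto
    thus ?thesis using that fs(3) cf lf by (auto simp: bl_def bl0_def bv_def c0_def Suc_le_eq split: if_splits)
  qed
  have bmap: "map blk_b bl = (if k = 0 then bs else unit_vec (m + 1) 0 # bs)"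
    and cmap: "map blk_c bl = (if k = 0 then cs else c0 # cs)"
    by (auto simp: bl_def bl0_def bs_def cs_def)
  \<comment> \<open>The top rows of the matrix paired with \<open>v\<close>. Row \<open>0\<close>
    sees at most the first free index; the others are the rows of the configuration once
    \<open>v\<close> vanishes on the free indices and is a multiple of \<open>cf g\<close> on each
    class.\<close>
  define T where "T = (\<lambda>v x. \<Sum>B\<leftarrow>bl. (\<Sum>j<length (blk_g B). blk_l B $ j * v (blk_g B ! j)) * blk_b B $ x)"
  define tg where "tg = (\<lambda>v g. \<Sum>j<length g. lf g $ j * v (g ! j))"
  have T0: "T v 0 = (if k = 0 then 0 else v (fs ! 0))" for v
  proof -
    have "(\<Sum>g\<leftarrow>gs. (\<Sum>j<length g. lf g $ j * v (g ! j)) * bv g $ 0) = 0"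
      by (simp add: bv_def)
    moreover have "(\<Sum>j<k. unit_vec k 0 $ j * v (fs ! j)) = v (fs ! 0)" if "k \<noteq> 0"
    proof -
      have "(\<Sum>j<k. unit_vec k 0 $ j * v (fs ! j)) = (\<Sum>j<k. if j = 0 then v (fs ! 0) else 0)"
        by (rule sum.cong) auto
      thus ?thesis using that by (simp add: sum.delta)
    qed
    ultimately show ?thesis using fs(3) by (simp add: T_def bl_def bl0_def o_def)
  qed
  have Tx: "T v (Suc x) = (\<Sum>g\<leftarrow>gs. tg v g * (\<Sum>j<length g. cf g $ j * es ! (g ! j) $ x))" if "x < m" for v x
  proof -
    have "(\<Sum>g\<leftarrow>gs. (\<Sum>j<length g. lf g $ j * v (g ! j)) * bv g $ Suc x) = (\<Sum>g\<leftarrow>gs. tg v g * (\<Sum>j<length g. cf g $ j * es ! (g ! j) $ x))"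
      using that by (simp add: bv_def tg_def)
    thus ?thesis using that by (simp add: T_def bl_def bl0_def o_def)
  qed
  have T_val: "T v (Suc x) = (\<Sum>\<gamma><n. es ! \<gamma> $ x * v \<gamma>)"
    if x: "x < m" and v0: "\<And>\<gamma>. \<gamma> \<in> free \<Longrightarrow> v \<gamma> = 0"
      and vc: "\<And>g j. g \<in> set gs \<Longrightarrow> j < length g \<Longrightarrow> v (g ! j) = tg v g * cf g $ j" for v x
  proof -
    have "T v (Suc x) = (\<Sum>g\<leftarrow>gs. \<Sum>j<length g. es ! (g ! j) $ x * v (g ! j))"
      unfolding Tx[OF x]
    proof (rule arg_cong[of _ _ sum_list], rule map_cong)
      fix g assume g: "g \<in> set gs"
      show "tg v g * (\<Sum>j<length g. cf g $ j * es ! (g ! j) $ x) = (\<Sum>j<length g. es ! (g ! j) $ x * v (g ! j))"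
        unfolding sum_distrib_left
      proof (rule sum.cong)
        fix j assume "j \<in> {..<length g}"
        thus "tg v g * (cf g $ j * es ! (g ! j) $ x) = es ! (g ! j) $ x * v (g ! j)"
          using vc[OF g, of j] by simp
      qed simp
    qed simp
    also have "\<dots> = (\<Sum>\<gamma>\<in>\<Gamma>. es ! \<gamma> $ x * v \<gamma>)"
      using sum_concat[OF gs(1), of "\<lambda>\<gamma>. es ! \<gamma> $ x * v \<gamma>"] gs(2) by simp
    also have "\<dots> = (\<Sum>\<gamma><n. es ! \<gamma> $ x * v \<gamma>)"
      by (rule sum.mono_neutral_left) (auto simp: \<Gamma>_def v0)
    finally show ?thesis .
  qed
  have cross: "v (g ! j) = tg v g * cf g $ j"
    if g: "g \<in> set gs" and j: "j < length g"
      and eq: "\<And>r. r < length g - 1 \<Longrightarrow> cf g $ 0 * v (g ! (r + 1)) = cf g $ (r + 1) * v (g ! 0)" for v g j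
  proof -
    have c0: "cf g $ 0 \<noteq> 0" using prim[OF g] by simp
    have eq': "cf g $ 0 * v (g ! i) = cf g $ i * v (g ! 0)" if "i < length g" for i
      using eq[of "i - 1"] that by (cases i) auto
    show ?thesis unfolding tg_def
    proof (rule multiple_of_primitive[OF one[OF g] _ j])
      fix i j assume "i < length g" "j < length g"
      have "cf g $ 0 * (cf g $ i * v (g ! j)) = cf g $ i * (cf g $ 0 * v (g ! j))" by (simp add: mult_ac)
      also have "\<dots> = cf g $ j * (cf g $ 0 * v (g ! i))"
        using eq'[OF \<open>i < length g\<close>] eq'[OF \<open>j < length g\<close>] by (simp add: mult_ac)
      finally show "cf g $ i * v (g ! j) = cf g $ j * v (g ! i)" using c0 by (simp add: mult_ac)
    qed
  qed
  have row_cross: "cf g $ i * v (g ! j) = cf g $ j * v (g ! i)"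
    if g: "g \<in> set gs" and ij: "i < length g" "j < length g" and v: "row_kernel n qs v" for v g i j
  proof -
    have "b (g ! i) * v (g ! j) = v (g ! i) * b (g ! j)" by (rule gprop[OF g ij b(1) v])
    hence "df g * (cf g $ i * v (g ! j)) = df g * (cf g $ j * v (g ! i))"
      unfolding df(2)[OF g ij(1)] df(2)[OF g ij(2)] by (simp add: mult_ac)
    thus ?thesis using df(1)[OF g] by simp
  qed
  have row_mult: "v (g ! j) = tg v g * cf g $ j"
    if "g \<in> set gs" "j < length g" "row_kernel n qs v" for v g j
    unfolding tg_def by (rule multiple_of_primitive[OF one[OF that(1)] _ that(2)]) (rule row_cross[OF that(1) _ _ that(3)])
  have row_T: "T v x = 0" if v: "row_kernel n qs v" and x: "x < m + 1" for v x
  proof (cases x)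
    case 0
    have "v (fs ! 0) = 0" if "k \<noteq> 0"
    proof -
      have "fs ! 0 \<in> free" using fs that by (metis nth_mem neq0_conv)
      thus ?thesis using v by (simp add: free_def)
    qed
    thus ?thesis using 0 T0[of v] by simp
  next
    case (Suc y)
    hence "T v x = (\<Sum>\<gamma><n. es ! \<gamma> $ y * v \<gamma>)"
      using T_val[of y v] row_mult[OF _ _ v] v x by (auto simp: free_def)
    thus ?thesis using v x Suc unfolding ker by auto
  qed
  have kernel: "C' *\<^sub>v list_vec v ord = 0\<^sub>v (dim_row C') \<longleftrightarrow> row_kernel n qs v" for v
  proof -
    have "C' *\<^sub>v list_vec v ord = 0\<^sub>v (dim_row C') \<longleftrightarrow> (\<forall>x<m + 1. T v x = 0) \<and>
      (\<forall>B\<in>set bl. \<forall>r < length (blk_g B) - 1. blk_c B $ 0 * v (blk_g B ! (r + 1)) = blk_c B $ (r + 1) * v (blk_g B ! 0))"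
      unfolding C'_def ord_def T_def by (rule glm_kernel(2)[OF blocks])
    also have "\<dots> \<longleftrightarrow> row_kernel n qs v"
    proof (intro iffI conjI)
      assume *: "(\<forall>x<m + 1. T v x = 0) \<and>
        (\<forall>B\<in>set bl. \<forall>r < length (blk_g B) - 1. blk_c B $ 0 * v (blk_g B ! (r + 1)) = blk_c B $ (r + 1) * v (blk_g B ! 0))"
      have "v (g ! j) = tg v g * cf g $ j" if g: "g \<in> set gs" and j: "j < length g" for g j
      proof (rule cross[OF g j])
        fix r assume r: "r < length g - 1"
        have "(bv g, cf g, lf g, g) \<in> set bl" using g by (auto simp: bl_def)
        from bspec[OF conjunct2[OF *] this] r
        show "cf g $ 0 * v (g ! (r + 1)) = cf g $ (r + 1) * v (g ! 0)" by simp
      qed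
      \<comment> \<open>The lower rows of the free block make \<open>v\<close> constant on the free
        indices, and row \<open>0\<close> makes its first value there zero.\<close>
      moreover have "v \<gamma> = 0" if \<gamma>: "\<gamma> \<in> free" for \<gamma>
      proof -
        have k: "k \<noteq> 0" using \<gamma> finF by (auto simp: k_def)
        hence v0: "v (fs ! 0) = 0" using * T0[of v] by auto
        obtain i where i: "i < k" "\<gamma> = fs ! i" using \<gamma> fs by (metis in_set_conv_nth)
        have "(unit_vec (m + 1) 0, c0, unit_vec k 0, fs) \<in> set bl" using k by (simp add: bl_def bl0_def)
        from bspec[OF conjunct2[OF *] this]
        have "v (fs ! (r + 1)) = v (fs ! 0)" if "r < k - 1" for r using that fs(3) by (simp add: c0_def)
        from this[of "i - 1"] show ?thesis using v0 i by (cases i) auto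
      qed
      ultimately have "T v (Suc x) = (\<Sum>\<gamma><n. es ! \<gamma> $ x * v \<gamma>)" if "x < m" for x
        using T_val[OF that, of v] by blast
      thus "row_kernel n qs v" unfolding ker using * by auto
    next
      assume v: "row_kernel n qs v"
      show "\<forall>x<m + 1. T v x = 0" using row_T[OF v] by blast
      show "\<forall>B\<in>set bl. \<forall>r < length (blk_g B) - 1. blk_c B $ 0 * v (blk_g B ! (r + 1)) = blk_c B $ (r + 1) * v (blk_g B ! 0)"
      proof (intro ballI allI impI)
        fix B r assume B: "B \<in> set bl" and r: "r < length (blk_g B) - 1"
        show "blk_c B $ 0 * v (blk_g B ! (r + 1)) = blk_c B $ (r + 1) * v (blk_g B ! 0)"
        proof (cases "B \<in> set bl0")
          case True
          hence g: "blk_g B = fs" by (auto simp: bl0_def split: if_splits)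
          have "v (fs ! i) = 0" if "i < length fs" for i
            using nth_mem[OF that] fs(2) v by (auto simp: free_def)
          moreover have "0 < length fs" "r + 1 < length fs" using r unfolding g by linarith+
          ultimately have "v (fs ! 0) = 0" "v (fs ! (r + 1)) = 0" by blast+
          thus ?thesis unfolding g by (simp only: mult_zero_right)
        next
          case False
          then obtain g where g: "g \<in> set gs" "B = (bv g, cf g, lf g, g)" using B by (auto simp: bl_def)
          have "0 < length g" "r + 1 < length g" using r unfolding g(2) snd_conv by linarith+
          from row_cross[OF g(1) this v] show ?thesis unfolding g(2) fst_conv snd_conv .
        qed
      qed
    qed
    finally show ?thesis .
  qed
  have np: "non_pyramidal (mat_of_cols (m + 1) bs)"
    unfolding non_pyramidal_def free_column_def
  proof
    assume "\<exists>i. i < dim_col (mat_of_cols (m + 1) bs) \<and> (\<forall>u\<in>mat_kernel (mat_of_cols (m + 1) bs). u $ i = 0)"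
    then obtain i where i: "i < length gs" "\<And>u. u \<in> mat_kernel (mat_of_cols (m + 1) bs) \<Longrightarrow> u $ i = 0"
      by (auto simp: bs_def)
    \<comment> \<open>The factors \<open>df\<close> of the full-support vector \<open>b\<close> on
      its classes form a kernel vector of the columns \<open>bv\<close> without zero
      entries.\<close>
    define u where "u = vec (length gs) (\<lambda>i. df (gs ! i))"
    have tg_b: "tg b g = df g" if g: "g \<in> set gs" for g
    proof -
      have "tg b g = df g * (\<Sum>j<length g. lf g $ j * cf g $ j)"
        unfolding tg_def sum_distrib_left by (rule sum.cong) (use df(2)[OF g] in auto)
      thus ?thesis using one[OF g] by simp
    qed
    have "(\<Sum>i<length bs. bs ! i $ l * u $ i) = 0" if l: "l < m + 1" for l
    proof (cases l)
      case 0
      thus ?thesis by (auto simp: bs_def bv_def intro!: sum.neutral)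
    next
      case (Suc x)
      have "(\<Sum>i<length bs. bs ! i $ l * u $ i) = (\<Sum>i<length gs. tg b (gs ! i) * (\<Sum>j<length (gs ! i). cf (gs ! i) $ j * es ! (gs ! i ! j) $ x))"
        by (rule sum.cong) (use l Suc in \<open>auto simp: bs_def bv_def u_def tg_b\<close>)
      also have "\<dots> = T b l" using Tx[of x b] l Suc by (simp add: sum_list_sum_nth atLeast0LessThan)
      finally show ?thesis using row_T[OF b(1) l] by simp
    qed
    hence "u \<in> mat_kernel (mat_of_cols (m + 1) bs)" unfolding mat_kernel_mat_of_cols by (auto simp: u_def bs_def)
    from i(2)[OF this] show False using i(1) df(1) by (simp add: u_def)
  qed
  have glm: "is_GLM (m + 1) (if k = 0 then bs else unit_vec (m + 1) 0 # bs) (if k = 0 then cs else c0 # cs) C'"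
    unfolding is_GLM_def bmap[symmetric] cmap[symmetric]
  proof (intro conjI)
    show "set (map blk_b bl) \<subseteq> carrier_vec (m + 1)" using blocks by auto
    show "\<forall>c\<in>set (map blk_c bl). 1 \<le> dim_vec c \<and> primitive_vec c \<and> full_support c \<and> 0 < c $ 0"
    proof
      fix c assume "c \<in> set (map blk_c bl)"
      then obtain B where B: "B \<in> set bl" "c = blk_c B" by auto
      have "1 \<le> dim_vec c" using blocks[OF B(1)] B(2) by simp
      moreover have "primitive_vec c \<and> full_support c \<and> 0 < c $ 0"
      proof (cases "B \<in> set bl0")
        case True
        hence k: "k \<noteq> 0" and c: "c = c0" using B(2) by (auto simp: bl0_def split: if_splits)
        have "vec_set c0 = {1}" using k by (auto simp: vec_set_def c0_def)
        thus ?thesis using k unfolding c by (simp add: primitive_vec_def full_support_def c0_def)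
      next
        case False
        then obtain g where g: "g \<in> set gs" "B = (bv g, cf g, lf g, g)" using B by (auto simp: bl_def)
        thus ?thesis using prim[OF g(1)] B(2) by simp
      qed
      ultimately show "1 \<le> dim_vec c \<and> primitive_vec c \<and> full_support c \<and> 0 < c $ 0" by blast
    qed
    have len1: "(\<Sum>j<dim_vec (blk_c B). blk_l B $ j * blk_c B $ j) = 1" if B: "B \<in> set bl" for B
    proof (cases "B \<in> set bl0")
      case True
      hence k: "k \<noteq> 0" and c: "blk_c B = c0" "blk_l B = unit_vec k 0" by (auto simp: bl0_def split: if_splits)
      have "(\<Sum>j<dim_vec c0. unit_vec k 0 $ j * c0 $ j) = (\<Sum>j<k. if j = 0 then 1 else 0)"
        by (rule sum.cong) (auto simp: c0_def)
      thus ?thesis using k unfolding c by (simp add: sum.delta)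
    next
      case False
      then obtain g where g: "g \<in> set gs" "B = (bv g, cf g, lf g, g)" using B by (auto simp: bl_def)
      thus ?thesis using one[OF g(1)] cf[OF g(1)] by simp
    qed
    show "\<exists>ls. length ls = length (map blk_c bl) \<and>
      (\<forall>i<length (map blk_c bl). dim_vec (ls ! i) = dim_vec (map blk_c bl ! i) \<and>
         (\<Sum>j<dim_vec (map blk_c bl ! i). ls ! i $ j * map blk_c bl ! i $ j) = 1) \<and>
      C' = glm (m + 1) (map blk_b bl) (map blk_c bl) ls"
      by (rule exI[of _ "map blk_l bl"]) (use blocks len1 in \<open>simp add: C'_def\<close>)
  qed simp
  have "dim_col C' = length ord" unfolding C'_def ord_def by (rule glm_kernel(1)[OF blocks])
  also have "\<dots> = n" using distinct_card[OF set_ord(2)] set_ord(1) by simp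
  finally have dimC: "dim_col C' = n" .
  have bs: "set bs \<subseteq> carrier_vec (m + 1)" "\<forall>b\<in>set bs. b $ 0 = 0" by (auto simp: bs_def bv_def)
  have c0: "dim_vec c0 = k" "0 < k \<longrightarrow> c0 $ 0 = 1" by (auto simp: c0_def)
  have cs: "\<forall>c\<in>set cs. (\<Sum>j<dim_vec c. c $ j) = 0" using cf_sum cf by (auto simp: cs_def)
  show ?thesis
    by (rule exI[of _ bs], rule exI[of _ c0], rule exI[of _ cs], rule exI[of _ C'], rule exI[of _ ord])
       (intro conjI allI bs c0 cs np glm set_ord dimC kernel)
qed

subsection \<open>Passing between configurations and rows\<close>

lemma independent_rows_append:
  fixes q :: "nat \<Rightarrow> int"
  assumes ind: "independent_rows TYPE('k :: field_char_0) N rs"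
    and q: "(\<lambda>i. of_int (q i) :: 'k) \<notin> kernel_perp N rs"
  shows "independent_rows TYPE('k) N (rs @ [q])"
  unfolding independent_rows_def
proof (rule allI, rule impI)
  fix c :: "nat \<Rightarrow> 'k"
  assume rel: "\<forall>i<N. (\<Sum>k<length (rs @ [q]). c k * of_int (((rs @ [q]) ! k) i)) = 0"
  have rel': "(\<Sum>k<length rs. c k * of_int ((rs ! k) i)) + c (length rs) * of_int (q i) = 0" if "i < N" for i
  proof -
    have "(\<Sum>k<length rs. c k * of_int ((rs ! k) i)) = (\<Sum>k<length rs. c k * of_int (((rs @ [q]) ! k) i))"
      by (rule sum.cong) (auto simp: nth_append)
    thus ?thesis using rel that by simp
  qed
  have c0: "c (length rs) = 0"
  proof (rule ccontr)
    assume nz: "c (length rs) \<noteq> 0"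
    have "of_int (q i) = (\<Sum>k<length rs. (- c k / c (length rs)) * of_int ((rs ! k) i))" if "i < N" for i
    proof -
      have "(\<Sum>k<length rs. (- c k / c (length rs)) * of_int ((rs ! k) i)) = - (\<Sum>k<length rs. c k * of_int ((rs ! k) i)) / c (length rs)"
        by (simp add: sum_divide_distrib sum_negf)
      also have "(\<Sum>k<length rs. c k * of_int ((rs ! k) i)) = - (c (length rs) * of_int (q i))"
        using rel'[OF that] by (simp add: eq_neg_iff_add_eq_0)
      finally show ?thesis using nz by simp
    qed
    hence "\<exists>c. \<forall>i<N. (of_int (q i) :: 'k) = (\<Sum>k<length rs. c k * of_int ((rs ! k) i))"
      by (intro exI[of _ "\<lambda>k. - c k / c (length rs)"]) simp
    thus False using q unfolding kernel_perp_eq_row_span by blast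
  qed
  hence "\<forall>i<N. (\<Sum>k<length rs. c k * of_int ((rs ! k) i)) = 0" using rel' by simp
  hence "\<forall>k<length rs. c k = 0"
    by (rule ind[unfolded independent_rows_def, THEN spec, THEN mp])
  thus "\<forall>k<length (rs @ [q]). c k = 0" using c0 by (auto simp: less_Suc_eq)
qed

text \<open>Starting from the row of ones, a row is kept only if it lies outside the span of those
  kept before; a discarded row does not change the kernel.\<close>

lemma select_rows:
  assumes "N > 0"
  shows "\<exists>rs. rs \<noteq> [] \<and> hd rs = (\<lambda>_. 1) \<and> independent_rows TYPE('k :: field_char_0) N rs \<and>
    set rs \<subseteq> insert (\<lambda>_. 1) (set qs) \<and> (\<forall>u. row_kernel N rs u \<longleftrightarrow> row_kernel N ((\<lambda>_. 1) # qs) u)"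
proof (induction qs)
  case Nil
  have "independent_rows TYPE('k) N [\<lambda>_. 1]" using assms by (auto simp: independent_rows_def)
  thus ?case by (intro exI[of _ "[\<lambda>_. 1]"]) simp
next
  case (Cons q qs)
  then obtain rs where rs: "rs \<noteq> []" "hd rs = (\<lambda>_. 1)" "independent_rows TYPE('k) N rs"
    "set rs \<subseteq> insert (\<lambda>_. 1) (set qs)" "\<And>u. row_kernel N rs u \<longleftrightarrow> row_kernel N ((\<lambda>_. 1) # qs) u" by blast
  show ?case
  proof (cases "(\<lambda>i. of_int (q i) :: 'k) \<in> kernel_perp N rs")
    case True
    have "(\<Sum>i<N. q i * u i) = 0" if "row_kernel N rs u" for u
    proof -
      have "(\<Sum>i<N. of_int (u i) * of_int (q i) :: 'k) = 0" using True that unfolding kernel_perp_def by blast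
      hence "(of_int (\<Sum>i<N. q i * u i) :: 'k) = 0" by (simp add: mult.commute)
      thus ?thesis by (simp only: of_int_eq_0_iff)
    qed
    moreover have "row_kernel N ((\<lambda>_. 1) # q # qs) u \<longleftrightarrow> (\<Sum>i<N. q i * u i) = 0 \<and> row_kernel N ((\<lambda>_. 1) # qs) u" for u
      by (auto simp: row_kernel_def)
    ultimately show ?thesis using rs by (intro exI[of _ rs]) auto
  next
    case False
    have "row_kernel N (rs @ [q]) u \<longleftrightarrow> row_kernel N ((\<lambda>_. 1) # q # qs) u" for u
    proof -
      have "row_kernel N (rs @ [q]) u \<longleftrightarrow> (\<Sum>i<N. q i * u i) = 0 \<and> row_kernel N rs u" by (auto simp: row_kernel_def)
      thus ?thesis unfolding rs(5) by (auto simp: row_kernel_def)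
    qed
    thus ?thesis using rs independent_rows_append[OF rs(3) False] by (intro exI[of _ "rs @ [q]"]) auto
  qed
qed

lemma ones_in_row_span_iff:
  "ones_in_row_span (mat_of_cols R ys) \<longleftrightarrow> (\<exists>r. \<forall>y\<in>set ys. (\<Sum>l<R. r l * rat_of_int (y $ l)) = 1)"
proof -
  define A where "A = map_mat rat_of_int (mat_of_cols R ys)"
  define n where "n = length ys"
  have A: "A \<in> carrier_mat R n" by (rule carrier_matI) (simp_all add: A_def n_def)
  have At: "(A\<^sup>T *\<^sub>v y) $ i = (\<Sum>l<R. y $ l * rat_of_int (ys ! i $ l))" if "i < n" "y \<in> carrier_vec R" for y i
    using that by (auto simp: A_def n_def scalar_prod_def atLeast0LessThan mat_of_cols_index mult.commute intro!: sum.cong)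
  have "ones_in_row_span (mat_of_cols R ys) \<longleftrightarrow> (\<exists>y\<in>carrier_vec R. A\<^sup>T *\<^sub>v y = vec n (\<lambda>_. 1))"
    unfolding ones_in_row_span_def mat_of_cols_carrier A_def[symmetric] n_def[symmetric] vec_space.row_space_eq[OF A]
    using A by auto
  also have "\<dots> \<longleftrightarrow> (\<exists>y\<in>carrier_vec R. \<forall>i<n. (\<Sum>l<R. y $ l * rat_of_int (ys ! i $ l)) = 1)"
  proof (rule bex_cong[OF refl])
    fix y :: "rat vec" assume y: "y \<in> carrier_vec R"
    have "dim_vec (A\<^sup>T *\<^sub>v y) = n" using A by simp
    thus "A\<^sup>T *\<^sub>v y = vec n (\<lambda>_. 1) \<longleftrightarrow> (\<forall>i<n. (\<Sum>l<R. y $ l * rat_of_int (ys ! i $ l)) = 1)"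
      using At[OF _ y] by (simp add: vec_eq_iff)
  qed
  also have "\<dots> \<longleftrightarrow> (\<exists>r. \<forall>i<n. (\<Sum>l<R. r l * rat_of_int (ys ! i $ l)) = 1)"
  proof
    assume "\<exists>r. \<forall>i<n. (\<Sum>l<R. r l * rat_of_int (ys ! i $ l)) = 1"
    then obtain r where "\<forall>i<n. (\<Sum>l<R. r l * rat_of_int (ys ! i $ l)) = 1" by blast
    thus "\<exists>y\<in>carrier_vec R. \<forall>i<n. (\<Sum>l<R. y $ l * rat_of_int (ys ! i $ l)) = 1"
      by (intro bexI[of _ "vec R r"]) auto
  qed blast
  also have "\<dots> \<longleftrightarrow> (\<exists>r. \<forall>y\<in>set ys. (\<Sum>l<R. r l * rat_of_int (y $ l)) = 1)"
    by (simp add: n_def all_set_conv_all_nth)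
  finally show ?thesis .
qed

text \<open>By duality over the rationals the condition depends only on the kernel, so it passes to
  any configuration with the same kernel.\<close>

lemma ones_in_row_span_iff_kernel:
  "ones_in_row_span (mat_of_cols R ys) \<longleftrightarrow> (\<forall>u\<in>mat_kernel (mat_of_cols R ys). (\<Sum>i<length ys. u $ i) = 0)"
proof
  assume "ones_in_row_span (mat_of_cols R ys)"
  then obtain r where r: "\<And>y. y \<in> set ys \<Longrightarrow> (\<Sum>l<R. r l * rat_of_int (y $ l)) = 1"
    unfolding ones_in_row_span_iff by blast
  show "\<forall>u\<in>mat_kernel (mat_of_cols R ys). (\<Sum>i<length ys. u $ i) = 0"
  proof
    fix u assume "u \<in> mat_kernel (mat_of_cols R ys)"
    hence u: "\<And>l. l < R \<Longrightarrow> (\<Sum>i<length ys. ys ! i $ l * u $ i) = 0" by (simp add: mat_kernel_mat_of_cols)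
    have "rat_of_int (\<Sum>i<length ys. u $ i) = (\<Sum>i<length ys. (\<Sum>l<R. r l * rat_of_int (ys ! i $ l)) * rat_of_int (u $ i))"
      unfolding of_int_sum by (rule sum.cong) (auto simp: r)
    also have "\<dots> = (\<Sum>i<length ys. \<Sum>l<R. r l * rat_of_int (ys ! i $ l * u $ i))"
      by (simp add: sum_distrib_right mult.assoc)
    also have "\<dots> = (\<Sum>l<R. r l * rat_of_int (\<Sum>i<length ys. ys ! i $ l * u $ i))"
      by (subst sum.swap) (simp add: sum_distrib_left)
    also have "\<dots> = 0" using u by simp
    finally show "(\<Sum>i<length ys. u $ i) = 0" by (simp only: of_int_eq_0_iff)
  qed
next
  assume van: "\<forall>u\<in>mat_kernel (mat_of_cols R ys). (\<Sum>i<length ys. u $ i) = 0"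
  define rs where "rs = map (\<lambda>l i. ys ! i $ l) [0..<R]"
  have rs: "length rs = R" "\<And>k i. k < R \<Longrightarrow> (rs ! k) i = ys ! i $ k" by (auto simp: rs_def)
  have "(\<lambda>_. 1) \<in> (kernel_perp (length ys) rs :: (nat \<Rightarrow> rat) set)" unfolding kernel_perp_def
  proof (intro CollectI allI impI)
    fix u assume u: "row_kernel (length ys) rs u"
    have "vec (length ys) u \<in> mat_kernel (mat_of_cols R ys)"
      unfolding mat_kernel_mat_of_cols using u by (auto simp: row_kernel_def rs_def)
    with van have "(\<Sum>i<length ys. u i) = 0" by fastforce
    hence "rat_of_int (\<Sum>i<length ys. u i) = 0" by simp
    thus "(\<Sum>i<length ys. of_int (u i) * 1) = (0 :: rat)" by simp
  qed
  then obtain c where "\<forall>i<length ys. (1 :: rat) = (\<Sum>k<R. c k * of_int (ys ! i $ k))"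
    unfolding kernel_perp_eq_row_span rs(1) using rs(2) by auto
  thus "ones_in_row_span (mat_of_cols R ys)"
    unfolding ones_in_row_span_iff all_set_conv_all_nth by (intro exI[of _ c]) simp
qed

lemma toric_variety_cong:
  "dim_col A = dim_col B \<Longrightarrow> mat_kernel A = mat_kernel B \<Longrightarrow> toric_variety A = toric_variety B"
  by (simp add: toric_variety_def toric_ideal_def)

text \<open>Brings a configuration into the form of \<open>self_dual_fibers\<close> and translates
  the conclusions back: the chosen rows \<open>rs\<close> start with the row of ones and have the
  kernel of the configuration, so \<open>rs'\<close> and \<open>qs\<close> have equal kernels. The
  empty configuration is treated apart because the locale assumes \<open>N > 0\<close>.\<close>

lemma self_dual_configuration:
  fixes xs es :: "int vec list"
  assumes fib: "fibers (length xs) (length es) \<sigma> \<rho>"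
    and es: "distinct es" "set es \<subseteq> carrier_vec m"
    and xs: "\<And>i. i < length xs \<Longrightarrow> es ! (\<sigma> i) = xs ! i"
    and ones: "ones_in_row_span (mat_of_cols m xs)"
    and sd: "self_dual (length xs)
           (toric_variety (mat_of_cols m xs) :: 'k :: field_char_0 vec set)"
  defines "qs \<equiv> map (\<lambda>l \<gamma>. es ! \<gamma> $ l) [0..<m]"
  defines "free \<equiv> {\<gamma>. \<gamma> < length es \<and> (\<forall>v. row_kernel (length es) qs v \<longrightarrow> v \<gamma> = 0)}"
  shows "card free = length xs - length es"
    and "\<forall>g0\<in>{..<length es} - free. \<forall>v. row_kernel (length es) qs v \<longrightarrow>
      (\<Sum>\<gamma> | \<gamma> \<in> {..<length es} - free \<and> proportional (length es) qs \<gamma> g0. v \<gamma>) = 0"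
proof -
  define N n where "N = length xs" and "n = length es"
  interpret F: fibers N n \<sigma> \<rho> using fib by (simp add: N_def n_def)
  have "card free = N - n \<and> (\<forall>g0\<in>{..<n} - free. \<forall>v. row_kernel n qs v \<longrightarrow>
      (\<Sum>\<gamma> | \<gamma> \<in> {..<n} - free \<and> proportional n qs \<gamma> g0. v \<gamma>) = 0)"
  proof (cases "N = 0")
    case True
    hence "n = 0" using F.\<rho>(1) by (metis gr_zeroI less_nat_zero_code)
    thus ?thesis using True by (simp add: free_def n_def[symmetric])
  next
    case False
    hence N: "N > 0" by simp
    obtain rs where rs: "rs \<noteq> []" "hd rs = (\<lambda>_. 1)" "independent_rows TYPE('k) N rs"
      "set rs \<subseteq> insert (\<lambda>_. 1) (set (map (\<lambda>l i. xs ! i $ l) [0..<m]))"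
      "\<And>u. row_kernel N rs u \<longleftrightarrow> row_kernel N ((\<lambda>_. 1) # map (\<lambda>l i. xs ! i $ l) [0..<m]) u"
      using select_rows[OF N, where 'k = 'k and qs = "map (\<lambda>l i. xs ! i $ l) [0..<m]"] by blast
    have rowN: "row_kernel N rs u \<longleftrightarrow> (\<forall>l<m. (\<Sum>i<N. xs ! i $ l * u i) = 0)" for u
    proof -
      have "(\<Sum>i<N. u i) = 0" if "\<forall>l<m. (\<Sum>i<N. xs ! i $ l * u i) = 0"
      proof -
        have "vec N u \<in> mat_kernel (mat_of_cols m xs)"
          unfolding mat_kernel_mat_of_cols using that by (simp add: N_def)
        hence "(\<Sum>i<N. vec N u $ i) = 0" using ones unfolding ones_in_row_span_iff_kernel N_def by blast
        thus ?thesis by simp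
      qed
      thus ?thesis unfolding rs(5) by (auto simp: row_kernel_def)
    qed
    have X: "toric_variety (mat_of_cols m xs) = (toric_points N rs :: 'k vec set)"
      by (rule toric_variety_eq_points) (auto simp: N_def rowN[unfolded N_def] mat_kernel_mat_of_cols)
    obtain M :: "'k mat" where M: "M \<in> carrier_mat N N" "invertible_mat M"
      "(\<lambda>v. M *\<^sub>v v) ` toric_points N rs = dual_variety N (toric_points N rs)"
      using sd unfolding self_dual_def embedded_isomorphic_def X N_def[symmetric] by blast
    obtain B where B: "M * B = 1\<^sub>m (dim_row M)" "B * M = 1\<^sub>m (dim_row B)"
      using M(2) unfolding invertible_mat_def inverts_mat_def by blast
    have dimM: "dim_row M = N" "dim_col M = N" using M(1) by (rule carrier_matD)+
    have dimB: "dim_col B = N" "dim_row B = N"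
      using arg_cong[OF B(1), of dim_col] arg_cong[OF B(2), of dim_col] dimM by simp_all
    interpret S: self_dual_fibers N rs n \<sigma> \<rho> "TYPE('k)" M B
    proof unfold_locales
      show "r i = r (\<rho> (\<sigma> i))" if "r \<in> set rs" "i < N" for r i
      proof -
        have "xs ! \<rho> (\<sigma> i) = xs ! i"
          using xs F.\<rho> F.\<sigma> that(2) unfolding N_def by metis
        thus ?thesis using that(1) rs(4) by auto
      qed
      show "\<gamma> = \<gamma>'" if g: "\<gamma> < n" "\<gamma>' < n" and eq: "\<And>r. r \<in> set rs \<Longrightarrow> r (\<rho> \<gamma>) = r (\<rho> \<gamma>')" for \<gamma> \<gamma>'
      proof -
        \<comment> \<open>Equal entries in all chosen rows put the difference of the two unit
          vectors into the kernel of \<open>rs\<close>, which is that of the configuration; hence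
          the two columns agree.\<close>
        define u where "u = (\<lambda>i. (if i = \<rho> \<gamma> then 1 else 0) - (if i = \<rho> \<gamma>' then 1 else 0) :: int)"
        have sum_u: "(\<Sum>i<N. f i * u i) = f (\<rho> \<gamma>) - f (\<rho> \<gamma>')" for f
        proof -
          have "(\<Sum>i<N. f i * u i) = (\<Sum>i<N. (if i = \<rho> \<gamma> then f (\<rho> \<gamma>) else 0) - (if i = \<rho> \<gamma>' then f (\<rho> \<gamma>') else 0))"
            by (rule sum.cong) (auto simp: u_def)
          thus ?thesis using F.\<rho>(1) g by (simp add: sum_subtractf sum.delta)
        qed
        have "row_kernel N rs u" unfolding row_kernel_def using eq by (simp add: sum_u)
        hence "xs ! \<rho> \<gamma> $ l = xs ! \<rho> \<gamma>' $ l" if "l < m" for l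
          using that unfolding rowN by (simp add: sum_u)
        moreover have "es ! \<gamma> = xs ! \<rho> \<gamma>" "es ! \<gamma>' = xs ! \<rho> \<gamma>'"
          using xs F.\<rho> g unfolding N_def by metis+
        moreover have "es ! \<gamma> \<in> carrier_vec m" "es ! \<gamma>' \<in> carrier_vec m" using es(2) g unfolding n_def by auto
        ultimately have "es ! \<gamma> = es ! \<gamma>'" by (intro eq_vecI) auto
        thus ?thesis using es(1) g unfolding n_def by (simp add: nth_eq_iff_index_eq)
      qed
      show "B \<in> carrier_mat N N" by (rule carrier_matI) (rule dimB)+
      show "B * M = 1\<^sub>m N" "M * B = 1\<^sub>m N" using B dimB dimM by simp_all
    qed (fact N rs(1,2,3) M(1,3))+
    have rk: "row_kernel n S.rs' v \<longleftrightarrow> row_kernel n qs v" for v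
    proof -
      have "row_kernel n S.rs' v \<longleftrightarrow> row_kernel n S.rs' (F.push (F.lift v))"
        by (rule row_kernel_cong) (simp add: F.push_lift)
      also have "\<dots> \<longleftrightarrow> (\<forall>l<m. (\<Sum>i<N. xs ! i $ l * F.lift v i) = 0)"
        unfolding S.row_kernel_push[symmetric] rowN ..
      also have "\<dots> \<longleftrightarrow> (\<forall>l<m. (\<Sum>\<gamma><n. es ! \<gamma> $ l * v \<gamma>) = 0)"
      proof -
        have "(\<Sum>i<N. xs ! i $ l * F.lift v i) = (\<Sum>\<gamma><n. es ! \<gamma> $ l * v \<gamma>)" for l
        proof -
          have "(\<Sum>i<N. xs ! i $ l * F.lift v i) = (\<Sum>i<N. es ! (\<sigma> i) $ l * F.lift v i)"
            by (rule sum.cong) (auto simp: xs N_def)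
          also have "\<dots> = (\<Sum>\<gamma><n. es ! \<gamma> $ l * F.push (F.lift v) \<gamma>)" by (rule F.sum_push)
          also have "\<dots> = (\<Sum>\<gamma><n. es ! \<gamma> $ l * v \<gamma>)" by (rule sum.cong) (auto simp: F.push_lift)
          finally show ?thesis .
        qed
        thus ?thesis by simp
      qed
      also have "\<dots> \<longleftrightarrow> row_kernel n qs v" by (auto simp: row_kernel_def qs_def)
      finally show ?thesis .
    qed
    have free: "S.free = free" unfolding S.free_def rk unfolding free_def n_def ..
    have "(\<Sum>\<gamma> | \<gamma> \<in> {..<n} - free \<and> proportional n qs \<gamma> g0. v \<gamma>) = 0"
      if "g0 \<in> {..<n} - free" "row_kernel n qs v" for g0 v
    proof -
      have "(\<Sum>\<gamma> | \<gamma> \<in> {..<n} - free \<and> proportional n S.rs' \<gamma> g0. v \<gamma>) = 0"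
      proof (rule class_sum_zero[where 'k = 'k])
        show "(\<Sum>\<gamma>\<in>{..<n} - free. of_int (v \<gamma>) * w \<gamma> * (\<Prod>\<gamma>'\<in>{..<n} - free - {\<gamma>}. u \<gamma>')) = (0 :: 'k)"
          if "row_kernel n S.rs' v" "w \<in> kernel_field n S.rs'" "u \<in> kernel_field n S.rs'" for v w u
          using S.logarithmic_identity[OF that] unfolding free .
        show "\<exists>x. row_kernel n S.rs' x \<and> x \<gamma> \<noteq> 0" if "\<gamma> \<in> {..<n} - free" for \<gamma>
          using that unfolding free[symmetric] S.free_def by blast
        show "row_kernel n S.rs' v" using that(2) unfolding rk .
      qed (use that(1) in auto)
      thus ?thesis unfolding proportional_def rk .
    qed
    thus ?thesis using S.card_free unfolding free by blast
  qed
  thus "card free = length xs - length es"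
    and "\<forall>g0\<in>{..<length es} - free. \<forall>v. row_kernel (length es) qs v \<longrightarrow>
      (\<Sum>\<gamma> | \<gamma> \<in> {..<length es} - free \<and> proportional (length es) qs \<gamma> g0. v \<gamma>) = 0"
    unfolding N_def n_def by blast+
qed

theorem theorem3p9:
  fixes m k :: nat and A :: "int vec multiset" and C :: "int vec set" and xs :: "int vec list"
  assumes "multiset_configuration m A C"
    and "mset xs = A"
    and "ones_in_row_span (mat_of_cols m xs)"
    and "self_dual (length xs)
           (toric_variety (mat_of_cols m xs) :: 'k :: {alg_closed_field, field_char_0} vec set)"
    and "k = size A - card C"
  shows "\<exists>d bs c0 cs C' A'.
    0 < d \<and>
    set bs \<subseteq> carrier_vec d \<and> (\<forall>b \<in> set bs. b $ 0 = 0) \<and> non_pyramidal (mat_of_cols d bs) \<and>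
    dim_vec c0 = k \<and> (0 < k \<longrightarrow> c0 $ 0 = 1) \<and>
    (\<forall>c \<in> set cs. (\<Sum>j < dim_vec c. c $ j) = 0) \<and>
    is_GLM d (if k = 0 then bs else unit_vec d 0 # bs) (if k = 0 then cs else c0 # cs) C' \<and>
    multiset_configuration (dim_row C') A' (set (cols C')) \<and>
    (\<forall>ys. mset ys = A' \<longrightarrow>
       ones_in_row_span (mat_of_cols (dim_row C') ys) \<and>
       (\<exists>\<pi>. \<pi> permutes {..<length ys} \<and>
          (toric_variety (mat_of_cols m xs) :: 'k vec set) =
            toric_variety (mat_of_cols (dim_row C') (permute_list \<pi> ys))))"
proof -
  have C: "set xs = C" "C \<subseteq> carrier_vec m" "finite C"
    using assms(1,2) by (auto simp: multiset_configuration_def)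
  obtain es where es: "set es = C" "distinct es" using finite_distinct_list[OF C(3)] by blast
  define N n where "N = length xs" and "n = length es"
  have n: "n = card C" unfolding n_def es(1)[symmetric] using distinct_card[OF es(2)] by simp
  have "\<forall>i\<in>{..<N}. \<exists>\<gamma>. \<gamma> < n \<and> es ! \<gamma> = xs ! i"
    unfolding N_def n_def using C(1) es(1) by (metis in_set_conv_nth lessThan_iff nth_mem)
  then obtain \<sigma> where \<sigma>: "\<And>i. i < N \<Longrightarrow> \<sigma> i < n" "\<And>i. i < N \<Longrightarrow> es ! (\<sigma> i) = xs ! i" by (metis lessThan_iff)
  have "\<forall>\<gamma>\<in>{..<n}. \<exists>i. i < N \<and> xs ! i = es ! \<gamma>"
    unfolding N_def n_def using C(1) es(1) by (metis in_set_conv_nth lessThan_iff nth_mem)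
  then obtain \<rho> where \<rho>: "\<And>\<gamma>. \<gamma> < n \<Longrightarrow> \<rho> \<gamma> < N" "\<And>\<gamma>. \<gamma> < n \<Longrightarrow> xs ! (\<rho> \<gamma>) = es ! \<gamma>" by (metis lessThan_iff)
  interpret F: fibers N n \<sigma> \<rho>
  proof
    show "\<sigma> (\<rho> \<gamma>) = \<gamma>" if "\<gamma> < n" for \<gamma>
    proof -
      have "es ! (\<sigma> (\<rho> \<gamma>)) = es ! \<gamma>" using \<sigma> \<rho> that by simp
      thus ?thesis using \<sigma>(1)[OF \<rho>(1)[OF that]] that es(2) unfolding n_def by (simp add: nth_eq_iff_index_eq)
    qed
  qed (use \<sigma> \<rho> in auto)
  define qs where "qs = map (\<lambda>l \<gamma>. es ! \<gamma> $ l) [0..<m]"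
  define free where "free = {\<gamma>. \<gamma> < n \<and> (\<forall>v. row_kernel n qs v \<longrightarrow> v \<gamma> = 0)}"
  have qs: "row_kernel n qs v \<longleftrightarrow> (\<forall>l<m. (\<Sum>\<gamma><n. es ! \<gamma> $ l * v \<gamma>) = 0)" for v
    by (auto simp: row_kernel_def qs_def)
  have fib: "fibers (length xs) (length es) \<sigma> \<rho>" using F.fibers_axioms unfolding N_def n_def .
  have xs_es: "es ! (\<sigma> i) = xs ! i" if "i < length xs" for i using \<sigma>(2) that unfolding N_def .
  note sdc = self_dual_configuration[OF fib es(2) C(2)[folded es(1)] xs_es assms(3,4), folded qs_def n_def]
  have card_free: "card free = length xs - n" unfolding free_def by (rule sdc(1))
  have class_sums: "\<forall>g0\<in>{..<n} - free. \<forall>v. row_kernel n qs v \<longrightarrow>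
      (\<Sum>\<gamma> | \<gamma> \<in> {..<n} - free \<and> proportional n qs \<gamma> g0. v \<gamma>) = 0"
    unfolding free_def by (rule sdc(2))
  have "size A = length xs" using assms(2) by (metis size_mset)
  hence k: "k = card free" using assms(5) n card_free by simp
  obtain bs c0 cs C' ord where glm: "set bs \<subseteq> carrier_vec (m + 1)" "\<forall>b\<in>set bs. b $ 0 = 0"
    "non_pyramidal (mat_of_cols (m + 1) bs)" "dim_vec c0 = k" "0 < k \<longrightarrow> c0 $ 0 = 1"
    "\<forall>c\<in>set cs. (\<Sum>j<dim_vec c. c $ j) = 0"
    "is_GLM (m + 1) (if k = 0 then bs else unit_vec (m + 1) 0 # bs) (if k = 0 then cs else c0 # cs) C'"
    and ord: "distinct ord" "set ord = {..<n}" and dimC: "dim_col C' = n"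
    and ker: "\<forall>v. C' *\<^sub>v list_vec v ord = 0\<^sub>v (dim_row C') \<longleftrightarrow> row_kernel n qs v"
    using build_glm[of es qs m, folded n_def, folded free_def, folded k, OF qs class_sums] by (elim exE conjE)
  have len_ord: "length ord = n" using distinct_card[OF ord(1)] ord(2) by simp
  have bij: "bij_betw ((!) ord) {..<n} {..<n}"
    by (rule bij_betw_nth) (use ord len_ord in auto)
  \<comment> \<open>The matrix \<open>C'\<close> lists its columns in the block order
    \<open>ord\<close>; \<open>pos\<close> finds the column that belongs to a given index of
    \<open>es\<close>.\<close>
  define pos where "pos = the_inv_into {..<n} ((!) ord)"
  have pos: "pos (ord ! p) = p" if "p < n" for p
    unfolding pos_def using the_inv_into_f_f[OF bij_betw_imp_inj_on[OF bij]] that by simp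
  have pos_bij: "pos ` {..<n} = {..<n}"
    unfolding pos_def using bij_betw_the_inv_into[OF bij] by (simp add: bij_betw_def)
  define R where "R = dim_row C'"
  \<comment> \<open>The columns of \<open>C'\<close> are repeated in the pattern in which the
    vectors of \<open>C\<close> occur in \<open>xs\<close>, so that the two lists correspond index
    by index.\<close>
  define ys0 where "ys0 = map (\<lambda>i. col C' (pos (\<sigma> i))) [0..<N]"
  have len: "length ys0 = N" by (simp add: ys0_def)
  have pos_lt: "pos \<gamma> < n" if "\<gamma> < n" for \<gamma> using pos_bij that by blast
  have kernel: "mat_kernel (mat_of_cols R ys0) = mat_kernel (mat_of_cols m xs)"
  proof (rule Set.set_eqI)
    fix u :: "int vec"
    \<comment> \<open>Copies of one column only see the sum of their coefficients, so both kernels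
      are preimages under \<open>push\<close> of kernels for the distinct columns.\<close>
    define w where "w = F.push (\<lambda>i. u $ i)"
    have row: "(\<Sum>i<N. ys0 ! i $ l * u $ i) = (C' *\<^sub>v list_vec w ord) $ l" if l: "l < R" for l
    proof -
      have "(\<Sum>i<N. ys0 ! i $ l * u $ i) = (\<Sum>i<N. C' $$ (l, pos (\<sigma> i)) * u $ i)"
        by (rule sum.cong) (use l pos_lt \<sigma> dimC in \<open>auto simp: ys0_def R_def\<close>)
      also have "\<dots> = (\<Sum>\<gamma><n. C' $$ (l, pos \<gamma>) * w \<gamma>)" unfolding w_def by (rule F.sum_push)
      also have "\<dots> = (\<Sum>p<n. C' $$ (l, pos (ord ! p)) * w (ord ! p))"
        by (rule sum.reindex_bij_betw[OF bij, symmetric])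
      also have "\<dots> = (\<Sum>p<n. C' $$ (l, p) * w (ord ! p))" by (rule sum.cong) (auto simp: pos)
      also have "\<dots> = (C' *\<^sub>v list_vec w ord) $ l"
        using l dimC len_ord by (auto simp: R_def list_vec_def scalar_prod_def atLeast0LessThan intro!: sum.cong)
      finally show ?thesis .
    qed
    have "(\<forall>l<R. (\<Sum>i<N. ys0 ! i $ l * u $ i) = 0) \<longleftrightarrow> C' *\<^sub>v list_vec w ord = 0\<^sub>v R"
      using row by (auto simp: vec_eq_iff R_def)
    also have "\<dots> \<longleftrightarrow> (\<forall>l<m. (\<Sum>\<gamma><n. es ! \<gamma> $ l * w \<gamma>) = 0)" unfolding R_def using ker[THEN spec, of w] qs by simp
    also have "\<dots> \<longleftrightarrow> (\<forall>l<m. (\<Sum>i<N. xs ! i $ l * u $ i) = 0)"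
    proof -
      have "(\<Sum>\<gamma><n. es ! \<gamma> $ l * w \<gamma>) = (\<Sum>i<N. xs ! i $ l * u $ i)" for l
        unfolding w_def F.sum_push[symmetric] by (rule sum.cong) (auto simp: \<sigma>)
      thus ?thesis by simp
    qed
    finally show "u \<in> mat_kernel (mat_of_cols R ys0) \<longleftrightarrow> u \<in> mat_kernel (mat_of_cols m xs)"
      unfolding mat_kernel_mat_of_cols len N_def[symmetric] by blast
  qed
  have ones0: "ones_in_row_span (mat_of_cols R ys0)"
    using assms(3) unfolding ones_in_row_span_iff_kernel kernel len N_def[symmetric] .
  have "\<gamma> \<in> \<sigma> ` {..<N}" if "\<gamma> < n" for \<gamma>
    using F.\<rho>[OF that] by (intro image_eqI[of _ _ "\<rho> \<gamma>"]) auto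
  hence \<sigma>_img: "\<sigma> ` {..<N} = {..<n}" using F.\<sigma> by auto
  have "set ys0 = col C' ` pos ` \<sigma> ` {..<N}" by (simp add: ys0_def image_image atLeast0LessThan)
  hence "set ys0 = col C' ` {..<n}" unfolding \<sigma>_img pos_bij .
  hence set_ys0: "set ys0 = set (cols C')" by (simp add: cols_def dimC atLeast0LessThan)
  have conf: "multiset_configuration (dim_row C') (mset ys0) (set (cols C'))"
    unfolding multiset_configuration_def using set_ys0 cols_dim[of C'] by simp
  have fin: "ones_in_row_span (mat_of_cols (dim_row C') ys) \<and>
       (\<exists>\<pi>. \<pi> permutes {..<length ys} \<and>
          (toric_variety (mat_of_cols m xs) :: 'k vec set) =
            toric_variety (mat_of_cols (dim_row C') (permute_list \<pi> ys)))" if ys: "mset ys = mset ys0" for ys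
  proof
    have "set ys = set ys0" using ys by (metis set_mset_mset)
    thus "ones_in_row_span (mat_of_cols (dim_row C') ys)"
      using ones0 unfolding ones_in_row_span_iff R_def by simp
    obtain \<pi> where \<pi>: "\<pi> permutes {..<length ys}" "permute_list \<pi> ys = ys0"
      using mset_eq_permutation[OF ys[symmetric]] by blast
    have "toric_variety (mat_of_cols m xs) = (toric_variety (mat_of_cols R ys0) :: 'k vec set)"
      by (rule toric_variety_cong) (simp_all add: kernel len N_def)
    thus "\<exists>\<pi>. \<pi> permutes {..<length ys} \<and>
          (toric_variety (mat_of_cols m xs) :: 'k vec set) =
            toric_variety (mat_of_cols (dim_row C') (permute_list \<pi> ys))"
      using \<pi> unfolding R_def by blast
  qed
  show ?thesis
    by (rule exI[of _ "m + 1"], rule exI[of _ bs], rule exI[of _ c0], rule exI[of _ cs],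
        rule exI[of _ C'], rule exI[of _ "mset ys0"]) (intro conjI allI impI glm conf fin, simp)
qed

end
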